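(* For every object $V$ of $\mathscr{C}^{H}$ put $$\theta_V=(\mathrm{Id}_{V}\otimes \overleftarrow{\mathrm{ev}}_{V})(c_{V,V}\otimes \mathrm{Id}_{V^{*}})(\mathrm{Id}_{V}\otimes \overrightarrow{\mathrm{coev}}_{V}),\qquad \theta'_V=(\overrightarrow{\mathrm{ev}}_V \otimes \mathrm{Id}_V)(\mathrm{Id}_{V^{*}} \otimes c_{V,V})(\overleftarrow{\mathrm{coev}}_V \otimes \mathrm{Id}_V).$$ Then the family $\{\theta_V\}_{V\in\mathscr{C}^H}$ is a twist, that is, $\theta_V=\theta'_V$ for all $V\in\mathscr{C}^{H}$.
   Context: Let $\ell\ge 3$ be an odd integer, $\xi=\exp(2\pi i/\ell)$, and $\xi^{x}:=\exp(2\pi i x/\ell)$ for $x\in\mathbb{C}$. Let $a_{11}=2$, $a_{12}=a_{21}=-1$, $a_{22}=0$. $\mathcal{U}_\xi\mathfrak{sl}(2|1)$ is the associative $\mathbb{C}$-superalgebra with generators $k_1^{\pm1},k_2^{\pm1},e_1,e_2,f_1,f_2$ ($e_2,f_2$ odd, the others even) and relations $k_1k_2=k_2k_1$, $k_ik_i^{-1}=k_i^{-1}k_i=1$, $k_ie_jk_i^{-1}=\xi^{a_{ij}}e_j$, $k_if_jk_i^{-1}=\xi^{-a_{ij}}f_j$, $e_1f_1-f_1e_1=\frac{k_1-k_1^{-1}}{\xi-\xi^{-1}}$, $e_2f_2+f_2e_2=\frac{k_2-k_2^{-1}}{\xi-\xi^{-1}}$, $e_1f_2=f_2e_1$, $e_2f_1=f_1e_2$,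 $e_2^2=f_2^2=0$, $e_1^2e_2-(\xi+\xi^{-1})e_1e_2e_1+e_2e_1^2=0$, $f_1^2f_2-(\xi+\xi^{-1})f_1f_2f_1+f_2f_1^2=0$. Put $e_3=e_1e_2-\xi^{-1}e_2e_1$, $f_3=f_2f_1-\xi f_1f_2$. $\mathcal{U}^H=\mathcal{U}_\xi^H\mathfrak{sl}(2|1)$ is obtained by adding even generators $h_1,h_2$ with $[h_i,e_j]=a_{ij}e_j$, $[h_i,f_j]=-a_{ij}f_j$, $[h_i,h_j]=[h_i,k_j]=0$. It is a Hopf superalgebra with $\Delta(e_i)=e_i\otimes1+k_i^{-1}\otimes e_i$, $\Delta(f_i)=f_i\otimes k_i+1\otimes f_i$, $\Delta(k_i)=k_i\otimes k_i$, $\Delta(h_i)=h_i\otimes1+1\otimes h_i$, $S(e_i)=-k_ie_i$, $S(f_i)=-f_ik_i^{-1}$, $S(k_i)=k_i^{-1}$, $S(h_i)=-h_i$, $\epsilon(k_i)=1$, $\epsilon(e_i)=\epsilon(f_i)=\epsilon(h_i)=0$. $\mathscr{C}^H$ is the monoidal category whose objects are finite dimensional ($\mathbb{Z}/2$-graded) $\mathcal{U}^H$-modules on which $e_1^\ell=f_1^\ell=0$, $h_1,h_2$ act diagonalizably and $k_i=\xi^{h_i}$; morphisms are the even $\mathcal{U}^H$-linear maps. The dual of $V$ is $V^*=\mathrm{Hom}_{\mathbb C}(V,\mathbb C)$ with $u\varphi=(-1)^{\deg u\deg\varphi}\varphi\circ S(u)$. With $\phi_0=k_1^{-\ell}k_2^{-2}$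 and a homogeneous basis $(v_i)$ of $V$ with dual basis $(v_i^* )$, the pivotal structure is: $\overrightarrow{\mathrm{ev}}_V(v_i^*\otimes v_j)=v_i^*(v_j)$, $\overrightarrow{\mathrm{coev}}_V(1)=\sum_i v_i\otimes v_i^*$, $\overleftarrow{\mathrm{ev}}_V(v_j\otimes v_i^* )=(-1)^{\deg v_j}v_i^*(\phi_0v_j)$, $\overleftarrow{\mathrm{coev}}_V(1)=\sum_i(-1)^{\deg v_i}v_i^*\otimes\phi_0^{-1}v_i$. The braiding of $\mathscr{C}^H$ is $c_{V,W}=\tau\circ\mathcal{R}:V\otimes W\to W\otimes V$, where $\tau(v\otimes w)=(-1)^{\deg v\deg w}w\otimes v$, $\mathcal{R}=\check{\mathcal R}\mathcal K$, $\mathcal{K}=\xi^{-h_1\otimes h_2-h_2\otimes h_1-2h_2\otimes h_2}$ (exponential of a diagonalizable operator on $V\otimes W$), and $\check{\mathcal R}=\big(\sum_{i=0}^{\ell-1}\frac{(\xi-\xi^{-1})^i e_1^i\otimes f_1^i}{(i)_{\xi^{-2}}!}\big)\big(1-(\xi-\xi^{-1})e_3\otimes f_3\big)\big(1-(\xi-\xi^{-1})e_2\otimes f_2\big)$, with $(n)_x!=\prod_{k=1}^n\frac{1-x^k}{1-x}$; tensor products of elements multiply and act with the super sign rule $(a\otimes b)(c\otimes d)=(-1)^{\deg b\deg c}ac\otimes bd$, $(a\otimes b)(v\otimes w)=(-1)^{\deg b\deg v}av\otimes bw$. *)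

theory Defs
  imports Complex_Main
begin
class complex_vec = ab_group_add +
  fixes scaleC :: "complex \<Rightarrow> 'a \<Rightarrow> 'a"  (infixr "*\<^sub>C" 75)
  assumes scaleC_add_right: "a *\<^sub>C (x + y) = a *\<^sub>C x + a *\<^sub>C y"
    and scaleC_add_left: "(a + b) *\<^sub>C x = a *\<^sub>C x + b *\<^sub>C x"
    and scaleC_scaleC: "a *\<^sub>C b *\<^sub>C x = (a * b) *\<^sub>C x"
    and scaleC_one: "1 *\<^sub>C x = x"

global_interpretation cvs: vector_space "scaleC :: complex \<Rightarrow> 'a \<Rightarrow> 'a::complex_vec"
  by unfold_locales (simp_all add: scaleC_add_right scaleC_add_left scaleC_scaleC scaleC_one)

instantiation complex :: complex_vec
begin
definition scaleC_complex :: "complex \<Rightarrow> complex \<Rightarrow> complex"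
  where "scaleC_complex a x = a * x"
instance
  by standard (simp_all add: scaleC_complex_def algebra_simps)
end

definition clinear :: "('a::complex_vec \<Rightarrow> 'b::complex_vec) \<Rightarrow> bool"
  where "clinear f \<longleftrightarrow> Vector_Spaces.linear scaleC scaleC f"

lemma clinear_iff:
  "clinear f \<longleftrightarrow> (\<forall>x y. f (x + y) = f x + f y) \<and> (\<forall>c x. f (c *\<^sub>C x) = c *\<^sub>C f x)"
  by (simp add: clinear_def linear_iff_module_hom module_hom_iff cvs.module_axioms)

definition cbilinear :: "('a::complex_vec \<Rightarrow> 'b::complex_vec \<Rightarrow> 'c::complex_vec) \<Rightarrow> bool"
  where "cbilinear f \<longleftrightarrow> (\<forall>w. clinear (\<lambda>v. f v w)) \<and> (\<forall>v. clinear (f v))"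

lemma cbilinear_iff:
  "cbilinear f \<longleftrightarrow>
     (\<forall>v v' w. f (v + v') w = f v w + f v' w) \<and> (\<forall>c v w. f (c *\<^sub>C v) w = c *\<^sub>C f v w) \<and>
     (\<forall>v w w'. f v (w + w') = f v w + f v w') \<and> (\<forall>c v w. f v (c *\<^sub>C w) = c *\<^sub>C f v w)"
  by (auto simp: cbilinear_def clinear_iff)

lemma cbilinear_minus_left: "cbilinear f \<Longrightarrow> f (- v) w = - f v w"
  unfolding cbilinear_def clinear_def
  by (metis Vector_Spaces.linear.axioms(3) module_hom.neg)

definition finite_dim :: "'a::complex_vec itself \<Rightarrow> bool"
  where "finite_dim _ \<longleftrightarrow> (\<exists>B :: 'a set. finite B \<and> cvs.span B = UNIV)"

definition diagonalizable :: "('a::complex_vec \<Rightarrow> 'a) \<Rightarrow> bool"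
  where "diagonalizable A \<longleftrightarrow> clinear A \<and>
    (\<exists>B. cvs.independent B \<and> cvs.span B = UNIV \<and> (\<forall>b\<in>B. \<exists>c. A b = c *\<^sub>C b))"

typedef (overloaded) 'a dual = "{f :: 'a::complex_vec \<Rightarrow> complex. clinear f}"
  morphisms dual_app Abs_dual
  by (rule exI[of _ "\<lambda>_. 0"]) (simp add: clinear_iff)

setup_lifting type_definition_dual

instantiation dual :: (complex_vec) complex_vec
begin
lift_definition zero_dual :: "'a dual" is "\<lambda>_. 0" by (simp add: clinear_iff)
lift_definition plus_dual :: "'a dual \<Rightarrow> 'a dual \<Rightarrow> 'a dual" is "\<lambda>f g v. f v + g v"
  by (simp add: clinear_iff scaleC_add_right)
lift_definition minus_dual :: "'a dual \<Rightarrow> 'a dual \<Rightarrow> 'a dual" is "\<lambda>f g v. f v - g v"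
  by (simp add: clinear_iff cvs.scale_right_diff_distrib)
lift_definition uminus_dual :: "'a dual \<Rightarrow> 'a dual" is "\<lambda>f v. - f v"
  by (simp add: clinear_iff)
lift_definition scaleC_dual :: "complex \<Rightarrow> 'a dual \<Rightarrow> 'a dual" is "\<lambda>c f v. c *\<^sub>C f v"
  by (simp add: clinear_iff scaleC_add_right mult.commute)
instance
  by standard (transfer; simp add: scaleC_complex_def algebra_simps; fail)+
end

text \<open>
  The tensor product over the complex numbers: formal sums of pure tensors, two of them being
  identified iff no bilinear form separates them.  Over a field this is the usual tensor product;
  its universal property is proved below.
\<close>

definition tensor_rel ::
    "('a::complex_vec \<times> 'b::complex_vec) list \<Rightarrow> ('a \<times> 'b) list \<Rightarrow> bool"
  where "tensor_rel xs ys \<longleftrightarrow> (\<forall>f :: 'a \<Rightarrow> 'b \<Rightarrow> complex. cbilinear f \<longrightarrow>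
    (\<Sum>(v, w)\<leftarrow>xs. f v w) = (\<Sum>(v, w)\<leftarrow>ys. f v w))"

quotient_type (overloaded) ('a, 'b) tensor =
    "('a::complex_vec \<times> 'b::complex_vec) list" / tensor_rel
  morphisms rep_tensor abs_tensor
  by (rule equivpI) (auto simp: reflp_def symp_def transp_def tensor_rel_def)

lift_definition pure_tensor ::
    "'a::complex_vec \<Rightarrow> 'b::complex_vec \<Rightarrow> ('a, 'b) tensor"  (infixl "\<otimes>\<^sub>C" 72)
  is "\<lambda>v w. [(v, w)]" .

lemma sum_list_scale_left:
  assumes "cbilinear (f :: 'a::complex_vec \<Rightarrow> 'b::complex_vec \<Rightarrow> 'c::complex_vec)"
  shows "(\<Sum>(v, w)\<leftarrow>map (\<lambda>(v, w). (c *\<^sub>C v, w)) xs. f v w) = c *\<^sub>C (\<Sum>(v, w)\<leftarrow>xs. f v w)"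
  using assms by (induction xs) (auto simp: cbilinear_iff scaleC_add_right)

lemma sum_list_minus_left:
  assumes "cbilinear (f :: 'a::complex_vec \<Rightarrow> 'b::complex_vec \<Rightarrow> 'c::complex_vec)"
  shows "(\<Sum>(v, w)\<leftarrow>map (\<lambda>(v, w). (- v, w)) xs. f v w) = - (\<Sum>(v, w)\<leftarrow>xs. f v w)"
  using cbilinear_minus_left[OF assms] by (induction xs) auto

instantiation tensor :: (complex_vec, complex_vec) complex_vec
begin
lift_definition zero_tensor :: "('a, 'b) tensor" is "[]" .
lift_definition plus_tensor :: "('a, 'b) tensor \<Rightarrow> ('a, 'b) tensor \<Rightarrow> ('a, 'b) tensor"
  is "(@)" by (simp add: tensor_rel_def)
lift_definition uminus_tensor :: "('a, 'b) tensor \<Rightarrow> ('a, 'b) tensor"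
  is "map (\<lambda>(v, w). (- v, w))" by (simp add: tensor_rel_def sum_list_minus_left del: map_map)
lift_definition scaleC_tensor :: "complex \<Rightarrow> ('a, 'b) tensor \<Rightarrow> ('a, 'b) tensor"
  is "\<lambda>c. map (\<lambda>(v, w). (c *\<^sub>C v, w))" by (simp add: tensor_rel_def sum_list_scale_left del: map_map)
definition minus_tensor :: "('a, 'b) tensor \<Rightarrow> ('a, 'b) tensor \<Rightarrow> ('a, 'b) tensor"
  where "minus_tensor s t = s + - t"
instance
proof
  fix s t u :: "('a, 'b) tensor" and c d :: complex
  show "s + t + u = s + (t + u)" by transfer (simp add: tensor_rel_def)
  show "s + t = t + s" by transfer (simp add: tensor_rel_def add.commute)
  show "0 + s = s" by transfer (simp add: tensor_rel_def)
  show "- s + s = 0"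
    by transfer (simp add: tensor_rel_def sum_list_minus_left del: map_map)
  show "s - t = s + - t" by (rule minus_tensor_def)
  show "c *\<^sub>C (s + t) = c *\<^sub>C s + c *\<^sub>C t" by transfer (simp add: tensor_rel_def)
  show "(c + d) *\<^sub>C s = c *\<^sub>C s + d *\<^sub>C s"
    by transfer (simp add: tensor_rel_def sum_list_scale_left scaleC_add_left [symmetric] del: map_map)
  show "c *\<^sub>C d *\<^sub>C s = (c * d) *\<^sub>C s"
    by transfer (simp add: tensor_rel_def sum_list_scale_left scaleC_scaleC del: map_map)
  show "1 *\<^sub>C s = s"
    by transfer (simp add: tensor_rel_def sum_list_scale_left scaleC_one del: map_map)
qed
end

text \<open>
  The linear map out of a tensor product induced by a bilinear map.  The choice of a representing
  formal sum is immaterial when \<open>f\<close> is bilinear.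
\<close>

definition tensor_lift ::
    "('a::complex_vec \<Rightarrow> 'b::complex_vec \<Rightarrow> 'c::complex_vec) \<Rightarrow> ('a, 'b) tensor \<Rightarrow> 'c"
  where "tensor_lift f t = (\<Sum>(v, w)\<leftarrow>rep_tensor t. f v w)"

lemma cbilinear_pure_tensor: "cbilinear (\<otimes>\<^sub>C)"
  unfolding cbilinear_iff by (intro conjI allI; transfer; simp add: tensor_rel_def cbilinear_iff)

lemma dual_separates:
  assumes "\<And>g :: 'a::complex_vec \<Rightarrow> complex. clinear g \<Longrightarrow> g x = 0"
  shows "x = 0"
proof (rule ccontr)
  assume "x \<noteq> 0"
  then have ind: "cvs.independent {x}" by simp
  let ?B = "cvs.extend_basis {x}"
  note B = cvs.independent_extend_basis[OF ind] and S = cvs.span_extend_basis[OF ind]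
  have "clinear (\<lambda>v. cvs.representation ?B v x)"
    using cvs.representation_add[OF B] cvs.representation_scale[OF B] S
    by (simp add: clinear_iff scaleC_complex_def)
  then have "cvs.representation ?B x x = 0" by (rule assms)
  moreover have "x \<in> ?B" using cvs.extend_basis_superset[OF ind] by simp
  ultimately show False using cvs.representation_basis[OF B] by simp
qed

lemma tensor_rel_sum_eq:
  fixes f :: "'a::complex_vec \<Rightarrow> 'b::complex_vec \<Rightarrow> 'c::complex_vec"
  assumes f: "cbilinear f" and r: "tensor_rel xs ys"
  shows "(\<Sum>(v, w)\<leftarrow>xs. f v w) = (\<Sum>(v, w)\<leftarrow>ys. f v w)"
proof -
  have "(\<Sum>(v, w)\<leftarrow>xs. f v w) - (\<Sum>(v, w)\<leftarrow>ys. f v w) = 0"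
  proof (rule dual_separates)
    fix g :: "'c \<Rightarrow> complex" assume g: "clinear g"
    then have g0: "g 0 = 0" unfolding clinear_iff by (metis cvs.scale_zero_left)
    have gs: "g (\<Sum>(v, w)\<leftarrow>zs. f v w) = (\<Sum>(v, w)\<leftarrow>zs. g (f v w))" for zs
      using g g0 by (induction zs) (auto simp: clinear_iff)
    have "cbilinear (\<lambda>v w. g (f v w))" using f g by (simp add: cbilinear_iff clinear_iff)
    with r have "(\<Sum>(v, w)\<leftarrow>xs. g (f v w)) = (\<Sum>(v, w)\<leftarrow>ys. g (f v w))"
      by (simp add: tensor_rel_def)
    moreover have "g (a - b) = g a - g b" for a b
      using g unfolding clinear_iff by (metis add_diff_cancel diff_add_cancel)
    ultimately show "g ((\<Sum>(v, w)\<leftarrow>xs. f v w) - (\<Sum>(v, w)\<leftarrow>ys. f v w)) = 0"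
      by (simp add: gs)
  qed
  then show ?thesis by simp
qed

lemma tensor_lift_abs:
  assumes "cbilinear f"
  shows "tensor_lift f (abs_tensor xs) = (\<Sum>(v, w)\<leftarrow>xs. f v w)"
  unfolding tensor_lift_def
  by (rule tensor_rel_sum_eq[OF assms]) (metis Quotient3_rel_rep Quotient3_tensor
      tensor.abs_eq_iff Quotient3_abs_rep)

lemma tensor_lift_pure: "cbilinear f \<Longrightarrow> tensor_lift f (v \<otimes>\<^sub>C w) = f v w"
  by (simp add: pure_tensor.abs_eq tensor_lift_abs)

lemma clinear_tensor_lift:
  assumes "cbilinear f"
  shows "clinear (tensor_lift f)"
proof -
  have "tensor_lift f (s + t) = tensor_lift f s + tensor_lift f t" for s t
    by (induction s rule: tensor.abs_induct, induction t rule: tensor.abs_induct)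
      (simp add: plus_tensor.abs_eq tensor_lift_abs[OF assms])
  moreover have "tensor_lift f (c *\<^sub>C s) = c *\<^sub>C tensor_lift f s" for c s
    by (induction s rule: tensor.abs_induct)
      (simp only: scaleC_tensor.abs_eq tensor_lift_abs[OF assms] sum_list_scale_left[OF assms])
  ultimately show ?thesis by (simp add: clinear_iff)
qed

lemma tensor_ext:
  assumes f: "clinear f" and g: "clinear g"
    and eq: "\<And>v w. f (v \<otimes>\<^sub>C w) = g (v \<otimes>\<^sub>C w)"
  shows "f = g"
proof
  fix t
  have zero: "h 0 = 0" if "clinear h" for h :: "('a, 'b) tensor \<Rightarrow> 'c"
    using that unfolding clinear_iff by (metis cvs.scale_zero_left)
  show "f t = g t"
  proof (induction t rule: tensor.abs_induct)
    case (1 xs)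
    show ?case
    proof (induction xs)
      case Nil
      show ?case using zero[OF f] zero[OF g] by (simp add: zero_tensor.abs_eq)
    next
      case (Cons p xs)
      have "abs_tensor (p # xs) = fst p \<otimes>\<^sub>C snd p + abs_tensor xs"
        by (simp add: pure_tensor.abs_eq plus_tensor.abs_eq)
      then show ?case using Cons f g eq by (simp add: clinear_iff)
    qed
  qed
qed

text \<open>No sign enters here: this is applied to even maps only; see \<open>super_act\<close> for the signed version.\<close>

definition tensor_map ::
    "('a::complex_vec \<Rightarrow> 'c::complex_vec) \<Rightarrow> ('b::complex_vec \<Rightarrow> 'd::complex_vec) \<Rightarrow>
      ('a, 'b) tensor \<Rightarrow> ('c, 'd) tensor"
  where "tensor_map f g = tensor_lift (\<lambda>v w. f v \<otimes>\<^sub>C g w)"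

definition assoc_right ::
    "(('a::complex_vec, 'b::complex_vec) tensor, 'c::complex_vec) tensor \<Rightarrow> ('a, ('b, 'c) tensor) tensor"
  where "assoc_right = tensor_lift (\<lambda>s w. tensor_lift (\<lambda>u v. u \<otimes>\<^sub>C (v \<otimes>\<^sub>C w)) s)"

definition assoc_left ::
    "('a::complex_vec, ('b::complex_vec, 'c::complex_vec) tensor) tensor \<Rightarrow> (('a, 'b) tensor, 'c) tensor"
  where "assoc_left = tensor_lift (\<lambda>u t. tensor_lift (\<lambda>v w. (u \<otimes>\<^sub>C v) \<otimes>\<^sub>C w) t)"

definition unit_right :: "('a::complex_vec, complex) tensor \<Rightarrow> 'a"
  where "unit_right = tensor_lift (\<lambda>v c. c *\<^sub>C v)"

definition unit_left :: "(complex, 'a::complex_vec) tensor \<Rightarrow> 'a"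
  where "unit_left = tensor_lift (\<lambda>c v. c *\<^sub>C v)"

definition xipow :: "nat \<Rightarrow> complex \<Rightarrow> complex"
  where "xipow l x = exp (2 * of_real pi * \<i> * x / of_nat l)"

abbreviation xi :: "nat \<Rightarrow> complex"
  where "xi l \<equiv> xipow l 1"

definition xi_bracket :: "nat \<Rightarrow> complex"
  where "xi_bracket l = xi l - inverse (xi l)"

definition qfact :: "complex \<Rightarrow> nat \<Rightarrow> complex"
  where "qfact x n = (\<Prod>k=1..n. (1 - x ^ k) / (1 - x))"

text \<open>
  The exponential of a diagonalizable operator: the linear operator acting on each eigenvector of
  \<open>A\<close> with eigenvalue \<open>c\<close> as the scalar \<open>xipow l c\<close>.
\<close>

definition xi_exp :: "nat \<Rightarrow> ('a::complex_vec \<Rightarrow> 'a) \<Rightarrow> 'a \<Rightarrow> 'a"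
  where "xi_exp l A = (THE X. clinear X \<and> (\<forall>c v. A v = c *\<^sub>C v \<longrightarrow> X v = xipow l c *\<^sub>C v))"

text \<open>
  The underlying space of a module is the whole type \<open>'v\<close>.  \<open>grade V p\<close> is the homogeneous
  component of degree \<open>p\<close>, for \<open>p\<close> in \<open>{0, 1}\<close>; the other fields are the actions of the
  generators with index in \<open>{1, 2}\<close>.  Values at other degrees and indices play no role.
\<close>

record 'v uh_module =
  grade :: "nat \<Rightarrow> 'v set"
  act_h :: "nat \<Rightarrow> 'v \<Rightarrow> 'v"
  act_k :: "nat \<Rightarrow> 'v \<Rightarrow> 'v"
  act_kinv :: "nat \<Rightarrow> 'v \<Rightarrow> 'v"
  act_e :: "nat \<Rightarrow> 'v \<Rightarrow> 'v"
  act_f :: "nat \<Rightarrow> 'v \<Rightarrow> 'v"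

definition super_space :: "('v::complex_vec) uh_module \<Rightarrow> bool"
  where "super_space V \<longleftrightarrow>
    cvs.subspace (grade V 0) \<and> cvs.subspace (grade V 1) \<and>
    grade V 0 \<inter> grade V 1 = {0} \<and> (\<forall>v. \<exists>x\<in>grade V 0. \<exists>y\<in>grade V 1. v = x + y)"

definition has_degree :: "('v::complex_vec) uh_module \<Rightarrow> nat \<Rightarrow> ('v \<Rightarrow> 'v) \<Rightarrow> bool"
  where "has_degree V d A \<longleftrightarrow> (\<forall>p\<in>{0, 1}. \<forall>v\<in>grade V p. A v \<in> grade V ((p + d) mod 2))"

definition cartan :: "nat \<Rightarrow> nat \<Rightarrow> complex"
  where "cartan i j = (if i = 1 \<and> j = 1 then 2 else if i = 2 \<and> j = 2 then 0 else -1)"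

definition gen_degree :: "nat \<Rightarrow> nat"
  where "gen_degree i = (if i = 2 then 1 else 0)"

definition uh_relations :: "nat \<Rightarrow> ('v::complex_vec) uh_module \<Rightarrow> bool"
  where "uh_relations l V \<longleftrightarrow>
   (let h = act_h V; k = act_k V; k' = act_kinv V; e = act_e V; f = act_f V in
    (\<forall>i\<in>{1, 2}. \<forall>j\<in>{1, 2}. \<forall>v.
      k i (k j v) = k j (k i v) \<and>
      k i (k' i v) = v \<and> k' i (k i v) = v \<and>
      k i (e j (k' i v)) = xipow l (cartan i j) *\<^sub>C e j v \<and>
      k i (f j (k' i v)) = xipow l (- cartan i j) *\<^sub>C f j v \<and>
      h i (e j v) - e j (h i v) = cartan i j *\<^sub>C e j v \<and>
      h i (f j v) - f j (h i v) = - cartan i j *\<^sub>C f j v \<and>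
      h i (h j v) = h j (h i v) \<and>
      h i (k j v) = k j (h i v)) \<and>
    (\<forall>v.
      e 1 (f 1 v) - f 1 (e 1 v) = inverse (xi_bracket l) *\<^sub>C (k 1 v - k' 1 v) \<and>
      e 2 (f 2 v) + f 2 (e 2 v) = inverse (xi_bracket l) *\<^sub>C (k 2 v - k' 2 v) \<and>
      e 1 (f 2 v) = f 2 (e 1 v) \<and> e 2 (f 1 v) = f 1 (e 2 v) \<and>
      e 2 (e 2 v) = 0 \<and> f 2 (f 2 v) = 0 \<and>
      e 1 (e 1 (e 2 v)) - (xi l + inverse (xi l)) *\<^sub>C e 1 (e 2 (e 1 v)) + e 2 (e 1 (e 1 v)) = 0 \<and>
      f 1 (f 1 (f 2 v)) - (xi l + inverse (xi l)) *\<^sub>C f 1 (f 2 (f 1 v)) + f 2 (f 1 (f 1 v)) = 0))"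

definition uh_representation :: "nat \<Rightarrow> ('v::complex_vec) uh_module \<Rightarrow> bool"
  where "uh_representation l V \<longleftrightarrow>
    super_space V \<and>
    (\<forall>i\<in>{1, 2}.
      clinear (act_h V i) \<and> has_degree V 0 (act_h V i) \<and>
      clinear (act_k V i) \<and> has_degree V 0 (act_k V i) \<and>
      clinear (act_kinv V i) \<and> has_degree V 0 (act_kinv V i) \<and>
      clinear (act_e V i) \<and> has_degree V (gen_degree i) (act_e V i) \<and>
      clinear (act_f V i) \<and> has_degree V (gen_degree i) (act_f V i)) \<and>
    uh_relations l V"

definition CH_object :: "nat \<Rightarrow> ('v::complex_vec) uh_module \<Rightarrow> bool"
  where "CH_object l V \<longleftrightarrow>
    finite_dim TYPE('v) \<and>
    uh_representation l V \<and>
    (\<forall>v. (act_e V 1 ^^ l) v = 0) \<and> (\<forall>v. (act_f V 1 ^^ l) v = 0) \<and>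
    (\<forall>i\<in>{1, 2}. diagonalizable (act_h V i) \<and> act_k V i = xi_exp l (act_h V i))"

definition act_e3 :: "nat \<Rightarrow> ('v::complex_vec) uh_module \<Rightarrow> 'v \<Rightarrow> 'v"
  where "act_e3 l V v = act_e V 1 (act_e V 2 v) - inverse (xi l) *\<^sub>C act_e V 2 (act_e V 1 v)"

definition act_f3 :: "nat \<Rightarrow> ('v::complex_vec) uh_module \<Rightarrow> 'v \<Rightarrow> 'v"
  where "act_f3 l V v = act_f V 2 (act_f V 1 v) - xi l *\<^sub>C act_f V 1 (act_f V 2 v)"

definition act_phi0 :: "nat \<Rightarrow> 'v uh_module \<Rightarrow> 'v \<Rightarrow> 'v"
  where "act_phi0 l V = (act_kinv V 1 ^^ l) \<circ> (act_kinv V 2 ^^ 2)"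

definition act_phi0_inv :: "nat \<Rightarrow> 'v uh_module \<Rightarrow> 'v \<Rightarrow> 'v"
  where "act_phi0_inv l V = (act_k V 2 ^^ 2) \<circ> (act_k V 1 ^^ l)"

definition component :: "('v::complex_vec) uh_module \<Rightarrow> nat \<Rightarrow> 'v \<Rightarrow> 'v"
  where "component V p v = (THE x. x \<in> grade V p \<and> v - x \<in> grade V (1 - p))"

text \<open>The linear extension of \<open>v \<mapsto> (-1)^(deg v) v\<close> from homogeneous vectors.\<close>

definition parity_op :: "('v::complex_vec) uh_module \<Rightarrow> 'v \<Rightarrow> 'v"
  where "parity_op V v = (\<Sum>p\<in>{0, 1}. (-1) ^ p *\<^sub>C component V p v)"

text \<open>
  The action of \<open>a \<otimes> b\<close>, for \<open>b\<close> of degree \<open>d\<close>: the linear extension of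
  \<open>v \<otimes> w \<mapsto> (-1)^(d deg v) (a v \<otimes> b w)\<close> from homogeneous \<open>v\<close>.
\<close>

definition super_act ::
    "('v::complex_vec) uh_module \<Rightarrow> nat \<Rightarrow> ('v \<Rightarrow> 'v) \<Rightarrow> ('w::complex_vec \<Rightarrow> 'w) \<Rightarrow>
      ('v, 'w) tensor \<Rightarrow> ('v, 'w) tensor"
  where "super_act V d a b =
    tensor_lift (\<lambda>v w. \<Sum>p\<in>{0, 1}. (-1) ^ (d * p) *\<^sub>C (a (component V p v) \<otimes>\<^sub>C b w))"

definition super_flip ::
    "('v::complex_vec) uh_module \<Rightarrow> ('w::complex_vec) uh_module \<Rightarrow> ('v, 'w) tensor \<Rightarrow> ('w, 'v) tensor"
  where "super_flip V W = tensor_lift (\<lambda>v w.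
    \<Sum>p\<in>{0, 1}. \<Sum>q\<in>{0, 1}. (-1) ^ (p * q) *\<^sub>C (component W q w \<otimes>\<^sub>C component V p v))"

definition K_op ::
    "nat \<Rightarrow> ('v::complex_vec) uh_module \<Rightarrow> ('w::complex_vec) uh_module \<Rightarrow> ('v, 'w) tensor \<Rightarrow> ('v, 'w) tensor"
  where "K_op l V W = xi_exp l (\<lambda>t.
    - super_act V 0 (act_h V 1) (act_h W 2) t
    - super_act V 0 (act_h V 2) (act_h W 1) t
    - 2 *\<^sub>C super_act V 0 (act_h V 2) (act_h W 2) t)"

definition R_check ::
    "nat \<Rightarrow> ('v::complex_vec) uh_module \<Rightarrow> ('w::complex_vec) uh_module \<Rightarrow> ('v, 'w) tensor \<Rightarrow> ('v, 'w) tensor"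
  where "R_check l V W =
    (\<lambda>t. \<Sum>i<l. (xi_bracket l ^ i / qfact (inverse (xi l ^ 2)) i) *\<^sub>C
        super_act V 0 (act_e V 1 ^^ i) (act_f W 1 ^^ i) t) \<circ>
    (\<lambda>t. t - xi_bracket l *\<^sub>C super_act V 1 (act_e3 l V) (act_f3 l W) t) \<circ>
    (\<lambda>t. t - xi_bracket l *\<^sub>C super_act V 1 (act_e V 2) (act_f W 2) t)"

definition braiding ::
    "nat \<Rightarrow> ('v::complex_vec) uh_module \<Rightarrow> ('w::complex_vec) uh_module \<Rightarrow> ('v, 'w) tensor \<Rightarrow> ('w, 'v) tensor"
  where "braiding l V W = super_flip V W \<circ> R_check l V W \<circ> K_op l V W"

definition homogeneous_basis :: "('v::complex_vec) uh_module \<Rightarrow> 'v set \<Rightarrow> bool"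
  where "homogeneous_basis V B \<longleftrightarrow>
    finite B \<and> cvs.independent B \<and> cvs.span B = UNIV \<and> B \<subseteq> grade V 0 \<union> grade V 1"

definition hbasis :: "('v::complex_vec) uh_module \<Rightarrow> 'v set"
  where "hbasis V = (SOME B. homogeneous_basis V B)"

definition dual_vec :: "('v::complex_vec) set \<Rightarrow> 'v \<Rightarrow> 'v dual"
  where "dual_vec B b = Abs_dual (\<lambda>v. cvs.representation B v b)"

definition ev_right :: "('v::complex_vec dual, 'v) tensor \<Rightarrow> complex"
  where "ev_right = tensor_lift dual_app"

definition coev_right :: "('v::complex_vec) uh_module \<Rightarrow> complex \<Rightarrow> ('v, 'v dual) tensor"
  where "coev_right V z = z *\<^sub>C (\<Sum>b\<in>hbasis V. b \<otimes>\<^sub>C dual_vec (hbasis V) b)"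

definition ev_left :: "nat \<Rightarrow> ('v::complex_vec) uh_module \<Rightarrow> ('v, 'v dual) tensor \<Rightarrow> complex"
  where "ev_left l V = tensor_lift (\<lambda>v \<phi>. dual_app \<phi> (act_phi0 l V (parity_op V v)))"

definition coev_left :: "nat \<Rightarrow> ('v::complex_vec) uh_module \<Rightarrow> complex \<Rightarrow> ('v dual, 'v) tensor"
  where "coev_left l V z =
    z *\<^sub>C (\<Sum>b\<in>hbasis V. dual_vec (hbasis V) b \<otimes>\<^sub>C act_phi0_inv l V (parity_op V b))"

text \<open>The associativity and unit isomorphisms, usually suppressed, are explicit below.\<close>

definition theta :: "nat \<Rightarrow> ('v::complex_vec) uh_module \<Rightarrow> 'v \<Rightarrow> 'v"
  where "theta l V =
    unit_right \<circ> tensor_map id (ev_left l V) \<circ> assoc_right \<circ>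
    tensor_map (braiding l V V) id \<circ>
    assoc_left \<circ> tensor_map id (coev_right V) \<circ> (\<lambda>v. v \<otimes>\<^sub>C 1)"

definition theta' :: "nat \<Rightarrow> ('v::complex_vec) uh_module \<Rightarrow> 'v \<Rightarrow> 'v"
  where "theta' l V =
    unit_left \<circ> tensor_map ev_right id \<circ> assoc_left \<circ>
    tensor_map id (braiding l V V) \<circ>
    assoc_right \<circ> tensor_map (coev_left l V) id \<circ> (\<lambda>v. 1 \<otimes>\<^sub>C v)"

end

theory Submission
  imports Defs "HOL-Computational_Algebra.Polynomial"
begin

text \<open>
  Both sides are linear, so it suffices to compare them on a homogeneous weight vector \<open>v\<close>, on which
  \<open>k\<^sub>1, k\<^sub>2\<close> act by \<open>x, y\<close>.  Unravelling the braiding turns them, up to the same Gaussian factor, into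
  \<open>x\<^sup>-\<^sup>l y\<^sup>-\<^sup>2\<close> resp. \<open>x\<^sup>l y\<^sup>2\<close> times explicit sums of words \<open>f \<dots> f e \<dots> e v\<close> resp.
  \<open>e \<dots> e f \<dots> f v\<close>.  Moving the odd generators past the powers of \<open>e\<^sub>1, f\<^sub>1\<close> factors each
  sum as an even part, coming from the subalgebra generated by \<open>e\<^sub>1, f\<^sub>1, k\<^sub>1\<close>, applied to a finite odd part.
  The odd parts differ by \<open>x\<^sup>2 y\<^sup>4\<close>, by normal ordering.  The even parts are polynomials of degree
  less than \<open>l\<close> in the Casimir element, written in Newton form with nodes \<open>s(x \<xi>\<^sup>2\<^sup>j)\<close> resp.
  \<open>s(x\<^sup>-\<^sup>1 \<xi>\<^sup>2\<^sup>j)\<close>; since \<open>s(x) = s(x\<^sup>-\<^sup>1 \<xi>\<^sup>-\<^sup>2)\<close> these are the same \<open>l\<close> nodes, at which the two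
  polynomials differ by \<open>x\<^sup>2\<^sup>l\<^sup>-\<^sup>2\<close>.  For generic \<open>x\<close> the nodes are distinct, and continuity in \<open>x\<close> does the rest.
\<close>

section \<open>Linear algebra\<close>

text \<open>The twists are compared on weight vectors, but the homogeneous basis that enters both of
  them is arbitrary. So the Cartan factor on a weight vector tensor a basis vector is kept as an
  operator, \<open>weight_op\<close>, until the dual basis has collapsed the sum. The scalars
  \<open>x ^ i\<close> and \<open>q ^ (2 * i)\<close> in the sums come from evaluating Cartan factor
  and pivot at the shifted weights.

  The Casimir element may fail to be diagonalizable, so agreement on its eigenvectors would not be
  enough; hence an identity between polynomials, which can be applied to any operator. The
  factorization does not hold term by term: moving \<open>f3\<close> past \<open>e1 ^^ i\<close>
  leaves extra terms, which are absorbed because \<open>twist_poly\<close> satisfies a relation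
  between the parameters \<open>x\<close> and \<open>x * q ^ 2\<close> whose error is killed by
  \<open>f1 ^^ l = 0\<close>. The same relation gives the values at the nodes.

  The two discrepancies multiply to \<open>x ^ (2 * l) * y ^ 4\<close>, the inverse square of the
  eigenvalue of the pivotal element. This is exactly the ratio of the pivotal scalars of the two
  sides, which enter with opposite exponents.\<close>

lemma xipow_add: "xipow l (x + y) = xipow l x * xipow l y"
  by (simp add: xipow_def distrib_left add_divide_distrib exp_add)

lemma xipow_minus: "xipow l (- x) = inverse (xipow l x)"
  by (simp add: xipow_def exp_minus)

lemma xipow_diff: "xipow l (x - y) = xipow l x * inverse (xipow l y)"
  using xipow_add[of l x "- y"] by (simp add: xipow_minus)

lemma xipow_of_nat_mult: "xipow l (of_nat n * x) = xipow l x ^ n"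
  by (simp add: xipow_def exp_of_nat_mult [symmetric] mult_ac)

lemma xipow_zero [simp]: "xipow l 0 = 1"
  by (simp add: xipow_def)

lemma xipow_nonzero [simp]: "xipow l x \<noteq> 0"
  by (simp add: xipow_def)

lemma xi_power_cis: "xi l ^ n = cis (2 * pi * real n / real l)"
proof -
  have "xi l ^ n = xipow l (of_nat n)"
    using xipow_of_nat_mult[of l n 1] by simp
  then show ?thesis
    by (simp add: xipow_def cis_conv_exp mult_ac)
qed

lemma xi_power_self: "l > 0 \<Longrightarrow> xi l ^ l = 1"
  by (simp add: xi_power_cis)

lemma xi_power_eq_1_iff:
  assumes "l > 0"
  shows "xi l ^ n = 1 \<longleftrightarrow> l dvd n"
proof -
  have "xi l ^ n = xi l ^ (l * (n div l) + n mod l)" by simp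
  also have "\<dots> = xi l ^ (n mod l)"
    using xi_power_self[OF assms] by (simp only: power_add power_mult) simp
  finally have red: "xi l ^ n = xi l ^ (n mod l)" .
  have "inj_on (\<lambda>k. cis (2 * pi * real k / real l)) {..<l}"
    using bij_betw_roots_unity[OF assms] by (simp add: bij_betw_def)
  then have inj: "inj_on (\<lambda>k. xi l ^ k) {..<l}"
    by (simp add: xi_power_cis)
  show ?thesis
  proof
    assume "xi l ^ n = 1"
    then have "xi l ^ (n mod l) = xi l ^ 0" using red by simp
    then have "n mod l = 0"
      using inj_onD[OF inj, of "n mod l" 0] assms by simp
    then show "l dvd n" by auto
  next
    assume "l dvd n"
    then show "xi l ^ n = 1" using red by simp
  qed
qed

section \<open>Linear maps, bilinear maps and spanning sets\<close>

lemma clinearD: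
  assumes "clinear f"
  shows "f (x + y) = f x + f y" "f (c *\<^sub>C x) = c *\<^sub>C f x" "f 0 = 0" "f (- x) = - f x"
    "f (x - y) = f x - f y" "f (sum g S) = (\<Sum>i\<in>S. f (g i))"
proof -
  have m: "module_hom scaleC scaleC f"
    using assms by (simp add: clinear_def Vector_Spaces.linear_def)
  show "f (x + y) = f x + f y" "f (c *\<^sub>C x) = c *\<^sub>C f x" "f 0 = 0" "f (- x) = - f x"
    "f (x - y) = f x - f y" "f (sum g S) = (\<Sum>i\<in>S. f (g i))"
    using module_hom.add[OF m] module_hom.scale[OF m] module_hom.zero[OF m]
      module_hom.neg[OF m] module_hom.diff[OF m] module_hom.sum[OF m] by auto
qed

lemma clinearI:
  "(\<And>x y. f (x + y) = f x + f y) \<Longrightarrow> (\<And>c x. f (c *\<^sub>C x) = c *\<^sub>C f x) \<Longrightarrow> clinear f"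
  by (simp add: clinear_iff)

lemma clinear_id: "clinear (\<lambda>x. x)" "clinear id"
  by (simp_all add: clinear_iff)

lemma clinear_compose: "clinear f \<Longrightarrow> clinear g \<Longrightarrow> clinear (\<lambda>x. f (g x))"
  by (simp add: clinear_iff)

lemma clinear_comp: "clinear f \<Longrightarrow> clinear g \<Longrightarrow> clinear (f \<circ> g)"
  by (simp add: clinear_iff)

lemma clinear_add: "clinear f \<Longrightarrow> clinear g \<Longrightarrow> clinear (\<lambda>x. f x + g x)"
  by (simp add: clinear_iff scaleC_add_right algebra_simps)

lemma clinear_diff: "clinear f \<Longrightarrow> clinear g \<Longrightarrow> clinear (\<lambda>x. f x - g x)"
  by (simp add: clinear_iff cvs.scale_right_diff_distrib algebra_simps)

lemma clinear_uminus: "clinear f \<Longrightarrow> clinear (\<lambda>x. - f x)"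
  by (simp add: clinear_iff)

lemma clinear_scale: "clinear f \<Longrightarrow> clinear (\<lambda>x. c *\<^sub>C f x)"
  by (simp add: clinear_iff scaleC_add_right scaleC_scaleC mult.commute)

lemma clinear_zero: "clinear (\<lambda>x. 0)"
  by (simp add: clinear_iff)

lemma clinear_sum: "(\<And>i. i \<in> S \<Longrightarrow> clinear (f i)) \<Longrightarrow> clinear (\<lambda>x. \<Sum>i\<in>S. f i x)"
  by (induction S rule: infinite_finite_induct) (simp_all add: clinear_zero clinear_add)

lemma clinear_funpow: "clinear f \<Longrightarrow> clinear (f ^^ n)" for f :: "'a::complex_vec \<Rightarrow> 'a"
  by (induction n) (auto simp: clinear_iff)

lemmas clinear_intros = clinear_id clinear_add clinear_diff
  clinear_uminus clinear_scale clinear_zero clinear_sum clinear_funpow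

lemma clinear_eq_on_span:
  assumes "clinear f" "clinear g" "\<And>x. x \<in> S \<Longrightarrow> f x = g x" "x \<in> cvs.span S"
  shows "f x = g x"
  using assms(4)
proof (induction rule: cvs.span_induct_alt)
  case base
  then show ?case using clinearD(3)[OF assms(1)] clinearD(3)[OF assms(2)] by simp
next
  case (step c x y)
  then show ?case using assms by (simp add: clinearD)
qed

lemma clinear_eq_on_spanning:
  assumes "clinear f" "clinear g" "cvs.span S = UNIV" "\<And>x. x \<in> S \<Longrightarrow> f x = g x"
  shows "f = g"
  using clinear_eq_on_span[OF assms(1,2,4)] assms(3) by auto

lemma cbilinearD:
  assumes "cbilinear f"
  shows "clinear (\<lambda>v. f v w)" "clinear (f v)"
  using assms by (simp_all add: cbilinear_def)

lemma cbilinearI: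
  "(\<And>w. clinear (\<lambda>v. f v w)) \<Longrightarrow> (\<And>v. clinear (f v)) \<Longrightarrow> cbilinear f"
  by (simp add: cbilinear_def)

lemma clinear_tensor_left: "clinear (\<lambda>v. v \<otimes>\<^sub>C w)"
  using cbilinearD(1)[OF cbilinear_pure_tensor] .

lemma clinear_tensor_right: "clinear (\<lambda>w. v \<otimes>\<^sub>C w)"
  using cbilinearD(2)[OF cbilinear_pure_tensor] .

lemma cbilinear_compose:
  "cbilinear f \<Longrightarrow> clinear g \<Longrightarrow> clinear h \<Longrightarrow> cbilinear (\<lambda>v w. f (g v) (h w))"
  by (simp add: cbilinear_def clinear_iff)

lemma cbilinear_tensor: "clinear g \<Longrightarrow> clinear h \<Longrightarrow> cbilinear (\<lambda>v w. g v \<otimes>\<^sub>C h w)"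
  by (rule cbilinear_compose[OF cbilinear_pure_tensor])

text \<open>Used with weight vectors in both factors: their tensors are eigenvectors of the exponent
  of the Cartan factor, so \<open>xi_exp_eigen\<close> applies to \<open>K_op\<close>.\<close>

lemma tensor_span:
  assumes "cvs.span S = UNIV" "cvs.span T = UNIV"
  shows "cvs.span {v \<otimes>\<^sub>C w |v w. v \<in> S \<and> w \<in> T} = UNIV"
proof -
  let ?R = "cvs.span {v \<otimes>\<^sub>C w |v w. v \<in> S \<and> w \<in> T}"
  have pre: "cvs.subspace {v. P v}" if "\<And>v. P v \<longleftrightarrow> f v \<in> ?R" "clinear f"
    for f :: "'c::complex_vec \<Rightarrow> ('a, 'b) tensor" and P
    using that cvs.span_zero cvs.span_add cvs.span_scale
    by (auto intro!: cvs.subspaceI simp: clinearD)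
  have 1: "v \<otimes>\<^sub>C w \<in> ?R" if "w \<in> T" for v w
  proof -
    have "cvs.subspace {v. v \<otimes>\<^sub>C w \<in> ?R}"
      by (rule pre[OF refl clinear_tensor_left])
    moreover have "S \<subseteq> {v. v \<otimes>\<^sub>C w \<in> ?R}" using that by (auto intro: cvs.span_base)
    ultimately have "cvs.span S \<subseteq> {v. v \<otimes>\<^sub>C w \<in> ?R}" by (rule cvs.span_minimal[rotated])
    then show ?thesis using assms(1) by auto
  qed
  have 2: "v \<otimes>\<^sub>C w \<in> ?R" for v w
  proof -
    have "cvs.subspace {w. v \<otimes>\<^sub>C w \<in> ?R}"
      by (rule pre[OF refl clinear_tensor_right])
    moreover have "T \<subseteq> {w. v \<otimes>\<^sub>C w \<in> ?R}" using 1 by auto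
    ultimately have "cvs.span T \<subseteq> {w. v \<otimes>\<^sub>C w \<in> ?R}" by (rule cvs.span_minimal[rotated])
    then show ?thesis using assms(2) by auto
  qed
  have "t \<in> ?R" for t
  proof (induction t rule: tensor.abs_induct)
    case (1 xs)
    show ?case
    proof (induction xs)
      case Nil
      show ?case unfolding zero_tensor.abs_eq [symmetric] by (rule cvs.span_zero)
    next
      case (Cons p xs)
      have "abs_tensor (p # xs) = fst p \<otimes>\<^sub>C snd p + abs_tensor xs"
        by (simp add: pure_tensor.abs_eq plus_tensor.abs_eq)
      then show ?case using cvs.span_add[OF 2 Cons] by simp
    qed
  qed
  then show ?thesis by auto
qed

section \<open>Eigenvectors and exponentials of diagonalizable operators\<close>

lemma eigenvectors_sum_zero:
  assumes "finite M" "clinear A" "\<And>c. c \<in> M \<Longrightarrow> A (z c) = c *\<^sub>C z c" "(\<Sum>c\<in>M. z c) = 0"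
  shows "\<forall>c\<in>M. z c = 0"
  using assms(1,3,4)
proof (induction M arbitrary: z rule: finite_induct)
  case empty
  then show ?case by simp
next
  case (insert d M)
  \<comment> \<open>Applying \<open>A - d\<close> kills the summand for \<open>d\<close> and
    multiplies the one for \<open>c\<close> by \<open>c - d\<close>, which is nonzero on
    \<open>M\<close>.\<close>
  define y where "y c = (c - d) *\<^sub>C z c" for c
  have "(\<Sum>c\<in>M. y c) = A (\<Sum>c\<in>insert d M. z c) - d *\<^sub>C (\<Sum>c\<in>insert d M. z c)"
    using insert.hyps insert.prems(1) by (simp add: y_def clinearD[OF assms(2)] cvs.scale_sum_right
        cvs.scale_right_distrib cvs.scale_left_diff_distrib sum_subtractf)
  also have "\<dots> = 0" using insert.prems by (simp add: clinearD[OF assms(2)])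
  finally have "(\<Sum>c\<in>M. y c) = 0" .
  moreover have "A (y c) = c *\<^sub>C y c" if "c \<in> M" for c
    using insert.prems(1)[of c] that
    by (simp add: y_def clinearD[OF assms(2)] scaleC_scaleC mult.commute)
  ultimately have "\<forall>c\<in>M. y c = 0" using insert.IH by blast
  then have "\<forall>c\<in>M. z c = 0" using insert.hyps by (auto simp: y_def)
  then show ?case using insert.prems(2) insert.hyps by simp
qed

lemma eigenvector_decomposition:
  assumes A: "clinear A" and "cvs.span {v. \<exists>c. A v = c *\<^sub>C v} = UNIV"
  obtains M z where "finite M" "\<And>c. A (z c) = c *\<^sub>C z c" "(v::'a::complex_vec) = (\<Sum>c\<in>M. z c)"
proof -
  have "v \<in> cvs.span {v. \<exists>c. A v = c *\<^sub>C v}" using assms by simp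
  then have "\<exists>M z. finite M \<and> (\<forall>c. A (z c) = c *\<^sub>C z c) \<and> v = (\<Sum>c\<in>M. z c)"
  proof (induction rule: cvs.span_induct_alt)
    case base
    then show ?case by (intro exI[of _ "{}"] exI[of _ "\<lambda>_. 0"]) (simp add: clinearD[OF A])
  next
    case (step r x y)
    then obtain d M z where d: "A x = d *\<^sub>C x" and M: "finite M"
      and z: "\<And>c. A (z c) = c *\<^sub>C z c" and y: "y = (\<Sum>c\<in>M. z c)" by auto
    define z' where "z' = (\<lambda>c. (if c \<in> M then z c else 0) + (if c = d then r *\<^sub>C x else 0))"
    have "(\<Sum>c\<in>insert d M. z' c) =
        (\<Sum>c\<in>insert d M. if c \<in> M then z c else 0) + (\<Sum>c\<in>insert d M. if c = d then r *\<^sub>C x else 0)"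
      by (simp add: z'_def sum.distrib)
    also have "\<dots> = y + r *\<^sub>C x"
    proof -
      have "(\<Sum>c\<in>insert d M. if c \<in> M then z c else 0) = (\<Sum>c\<in>M. z c)"
        by (rule sum.mono_neutral_cong_right) (use M in auto)
      then show ?thesis using M y by simp
    qed
    finally have "r *\<^sub>C x + y = (\<Sum>c\<in>insert d M. z' c)" by (simp add: add.commute)
    moreover have "A (z' c) = c *\<^sub>C z' c" for c
      using d z by (simp add: z'_def clinearD[OF A] scaleC_add_right scaleC_scaleC mult.commute)
    ultimately show ?case using M by (intro exI[of _ "insert d M"] exI[of _ z']) simp
  qed
  then show thesis using that by blast
qed

text \<open>Justifies the definite description in \<open>xi_exp\<close>. Uniqueness: the
  eigenvectors span. Existence: scale an eigenbasis; an arbitrary eigenvector involves only basis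
  vectors with its own eigenvalue, so it is scaled correctly too.\<close>

lemma xi_exp_eigen:
  assumes A: "clinear A" and sp: "cvs.span {v. \<exists>c. A v = c *\<^sub>C v} = UNIV"
  shows "clinear (xi_exp l A)" "A v = c *\<^sub>C v \<Longrightarrow> xi_exp l A v = xipow l c *\<^sub>C v"
proof -
  let ?E = "{v. \<exists>c. A v = c *\<^sub>C v}"
  obtain B where B: "B \<subseteq> ?E" "cvs.independent B" "?E \<subseteq> cvs.span B"
    using cvs.maximal_independent_subset[of ?E] by blast
  have spB: "cvs.span B = UNIV"
    using B sp cvs.span_minimal[OF B(3)] by auto
  define ev where "ev b = (SOME c. A b = c *\<^sub>C b)" for b
  have ev: "A b = ev b *\<^sub>C b" if "b \<in> B" for b
  proof -
    have "\<exists>c. A b = c *\<^sub>C b" using that B(1) by auto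
    then show ?thesis unfolding ev_def by (rule someI_ex)
  qed
  have "\<exists>X. Vector_Spaces.linear scaleC scaleC X \<and> (\<forall>b\<in>B. X b = xipow l (ev b) *\<^sub>C b)"
  proof -
    interpret vector_space_pair "scaleC :: complex \<Rightarrow> 'a \<Rightarrow> 'a" "scaleC :: complex \<Rightarrow> 'a \<Rightarrow> 'a" ..
    show ?thesis by (rule linear_independent_extend[OF B(2)])
  qed
  then obtain X where X: "clinear X" "\<And>b. b \<in> B \<Longrightarrow> X b = xipow l (ev b) *\<^sub>C b"
    unfolding clinear_def by blast
  have Xe: "X v = xipow l c *\<^sub>C v" if v: "A v = c *\<^sub>C v" for c v
  proof -
    let ?r = "cvs.representation B v" and ?S = "{b. cvs.representation B v b \<noteq> 0}"
    have fin: "finite ?S" using cvs.finite_representation .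
    have vs: "v = (\<Sum>b\<in>?S. ?r b *\<^sub>C b)"
      using cvs.sum_nonzero_representation_eq[OF B(2)] spB by simp
    have SB: "?S \<subseteq> B" using cvs.representation_ne_zero by blast
    have "(\<Sum>b\<in>?S. (?r b * (ev b - c)) *\<^sub>C b) = (\<Sum>b\<in>?S. ?r b *\<^sub>C A b - c *\<^sub>C ?r b *\<^sub>C b)"
      using SB ev by (intro sum.cong) (auto simp: scaleC_scaleC algebra_simps
          cvs.scale_left_diff_distrib)
    also have "\<dots> = A (\<Sum>b\<in>?S. ?r b *\<^sub>C b) - c *\<^sub>C (\<Sum>b\<in>?S. ?r b *\<^sub>C b)"
      by (simp only: sum_subtractf clinearD[OF A] cvs.scale_sum_right)
    also have "\<dots> = 0" using vs v by simp
    finally have "?r b * (ev b - c) = 0" if "b \<in> ?S" for b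
      using cvs.independentD[OF B(2) fin SB, of "\<lambda>b. ?r b * (ev b - c)"] that by blast
    then have "ev b = c" if "b \<in> ?S" for b using that by force
    then have "X (\<Sum>b\<in>?S. ?r b *\<^sub>C b) = xipow l c *\<^sub>C (\<Sum>b\<in>?S. ?r b *\<^sub>C b)"
      using X SB by (auto simp: clinearD[OF X(1)] cvs.scale_sum_right scaleC_scaleC mult.commute
          intro!: sum.cong)
    then show ?thesis using vs by simp
  qed
  have "xi_exp l A = X"
    unfolding xi_exp_def
  proof (rule the_equality)
    show "clinear X \<and> (\<forall>c v. A v = c *\<^sub>C v \<longrightarrow> X v = xipow l c *\<^sub>C v)"
      using X(1) Xe by blast
  next
    fix Y assume Y: "clinear Y \<and> (\<forall>c v. A v = c *\<^sub>C v \<longrightarrow> Y v = xipow l c *\<^sub>C v)"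
    show "Y = X"
    proof (rule clinear_eq_on_spanning[OF _ X(1) sp])
      fix v assume "v \<in> ?E"
      then obtain c where c: "A v = c *\<^sub>C v" by blast
      then have "Y v = xipow l c *\<^sub>C v" using Y by blast
      then show "Y v = X v" using Xe[OF c] by simp
    qed (use Y in simp)
  qed
  then show "clinear (xi_exp l A)" "A v = c *\<^sub>C v \<Longrightarrow> xi_exp l A v = xipow l c *\<^sub>C v"
    using X(1) Xe by auto
qed

lemma diagonalizable_span:
  "diagonalizable A \<Longrightarrow> cvs.span {v. \<exists>c. A v = c *\<^sub>C v} = UNIV"
proof -
  assume "diagonalizable A"
  then obtain B where B: "cvs.span B = UNIV" "\<forall>b\<in>B. \<exists>c. A b = c *\<^sub>C b"
    unfolding diagonalizable_def by blast
  then have "cvs.span B \<subseteq> cvs.span {v. \<exists>c. A v = c *\<^sub>C v}"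
    by (intro cvs.span_mono) auto
  then show ?thesis using B(1) by auto
qed

text \<open>Split an eigenvector of \<open>A\<close> into eigenvectors of \<open>B\<close>. As
  \<open>A - a\<close> commutes with \<open>B\<close> and kills the sum, it kills each summand by
  \<open>eigenvectors_sum_zero\<close>, so the summands are joint eigenvectors.\<close>

lemma commuting_eigenvectors_span:
  assumes A: "clinear A" "cvs.span {v. \<exists>c. A v = c *\<^sub>C v} = UNIV"
    and B: "clinear B" "cvs.span {v. \<exists>c. B v = c *\<^sub>C v} = UNIV"
    and comm: "\<And>v. A (B v) = B (A v)"
  shows "cvs.span {v :: 'a::complex_vec. \<exists>a b. A v = a *\<^sub>C v \<and> B v = b *\<^sub>C v} = UNIV"
proof -
  let ?J = "{v. \<exists>a b. A v = a *\<^sub>C v \<and> B v = b *\<^sub>C v}"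
  have "v \<in> cvs.span ?J" if v: "A v = a *\<^sub>C v" for v a
  proof -
    obtain M z where M: "finite M" "\<And>c. B (z c) = c *\<^sub>C z c" "v = (\<Sum>c\<in>M. z c)"
      using eigenvector_decomposition[OF B] by metis
    have "\<forall>c\<in>M. A (z c) - a *\<^sub>C z c = 0"
    proof (rule eigenvectors_sum_zero[OF M(1) B(1)])
      show "B (A (z c) - a *\<^sub>C z c) = c *\<^sub>C (A (z c) - a *\<^sub>C z c)" for c
        using M(2) by (simp add: clinearD[OF B(1)] comm [symmetric] clinearD[OF A(1)]
            cvs.scale_right_diff_distrib scaleC_scaleC mult.commute)
      show "(\<Sum>c\<in>M. A (z c) - a *\<^sub>C z c) = 0"
        using v M(3) by (simp add: sum_subtractf clinearD[OF A(1)] cvs.scale_sum_right)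
    qed
    then have "z c \<in> ?J" if "c \<in> M" for c using M(2) that by auto
    then have "(\<Sum>c\<in>M. z c) \<in> cvs.span ?J"
      by (intro cvs.span_sum cvs.span_base) auto
    then show ?thesis using M(3) by simp
  qed
  then have "cvs.span {v. \<exists>c. A v = c *\<^sub>C v} \<subseteq> cvs.span ?J"
    by (intro cvs.span_minimal cvs.subspace_span) auto
  then show ?thesis using A(2) by auto
qed

section \<open>Even twist polynomials\<close>

text \<open>The eigenvalue of the Casimir element on a vector killed by \<open>e\<^sub>1\<close> on which \<open>k\<^sub>1 = x\<close>.\<close>

definition newton_node :: "complex \<Rightarrow> complex \<Rightarrow> complex"
  where "newton_node q x = (q * x + inverse (q * x)) / (q - inverse q) ^ 2"

text \<open>With \<open>q = xi l\<close>, the coefficient of the \<open>i\<close>-th term in the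
  even factor of \<open>R_check\<close>.\<close>

definition rcoeff :: "complex \<Rightarrow> nat \<Rightarrow> complex"
  where "rcoeff q i = (q - inverse q) ^ i / qfact (inverse (q ^ 2)) i"

text \<open>The polynomial in the Casimir element by which \<open>f1 ^^ i\<close> after
  \<open>e1 ^^ i\<close> acts where \<open>k1\<close> is \<open>x\<close>: each \<open>e1\<close>
  multiplies the eigenvalue of \<open>k1\<close> by \<open>q ^ 2\<close>, hence the nodes.\<close>

definition newton_poly :: "complex \<Rightarrow> complex \<Rightarrow> nat \<Rightarrow> complex poly"
  where "newton_poly q x i = (\<Prod>j<i. [:- newton_node q (x * q ^ (2 * j)), 1:])"

definition twist_poly :: "complex \<Rightarrow> nat \<Rightarrow> complex \<Rightarrow> complex poly"
  where "twist_poly q l x = (\<Sum>i<l. smult (rcoeff q i * q ^ (2 * i) * x ^ i) (newton_poly q x i))"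

lemma newton_node_inverse:
  assumes "q \<noteq> 0"
  shows "newton_node q (inverse x * inverse (q ^ 2)) = newton_node q x"
proof -
  have "q * (inverse x * inverse (q ^ 2)) = inverse (q * x)"
    using assms by (simp add: power2_eq_square field_simps)
  then show ?thesis
    unfolding newton_node_def by (simp only: inverse_inverse_eq add.commute)
qed

lemma newton_poly_Suc_left:
  "newton_poly q x (Suc i) = [:- newton_node q x, 1:] * newton_poly q (x * q ^ 2) i"
proof -
  have "newton_poly q x (Suc i) = [:- newton_node q x, 1:] *
      (\<Prod>j<i. [:- newton_node q (x * q ^ (2 * Suc j)), 1:])"
    unfolding newton_poly_def by (subst prod.lessThan_Suc_shift) simp
  then show ?thesis
    by (simp add: newton_poly_def power2_eq_square mult.assoc)
qed

lemma newton_poly_Suc: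
  "newton_poly q x (Suc i) = newton_poly q x i * [:- newton_node q (x * q ^ (2 * i)), 1:]"
  by (simp add: newton_poly_def)

lemma degree_newton_poly: "degree (newton_poly q x i) = i"
proof -
  have "degree (newton_poly q x i) = (\<Sum>j<i. degree [:- newton_node q (x * q ^ (2 * j)), 1:])"
    unfolding newton_poly_def by (rule degree_prod_eq_sum_degree) auto
  then show ?thesis by simp
qed

text \<open>\<open>q\<close> is a primitive \<open>l\<close>-th root of unity. As \<open>l\<close>
  is odd, so is \<open>q ^ 2\<close>; the denominators of \<open>rcoeff\<close> and the distinctness
  of the nodes rely on this.\<close>

locale odd_root =
  fixes q :: complex and l :: nat
  assumes l: "odd l" "l \<ge> 3"
    and q_eq_1_iff: "q ^ n = 1 \<longleftrightarrow> l dvd n"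
begin

lemma q_nonzero [simp]: "q \<noteq> 0"
  using q_eq_1_iff[of l] l by (cases "q = 0") (auto simp: power_0_left)

lemma q_even_power: "q ^ (2 * n) = 1 \<longleftrightarrow> l dvd n"
  using l by (simp add: q_eq_1_iff coprime_dvd_mult_right_iff)

lemma q_bracket_nonzero: "q - inverse q \<noteq> 0"
proof
  assume "q - inverse q = 0"
  then have "q ^ (2 * 1) = 1" by (simp add: power2_eq_square field_simps)
  then show False using l q_even_power[of 1] by simp
qed

lemma rcoeff_0 [simp]: "rcoeff q 0 = 1"
  by (simp add: rcoeff_def qfact_def)

text \<open>The factor on the left is the new one in the q-factorial. It reappears in
  \<open>newton_node_diff\<close> with \<open>m = Suc i\<close>, which makes the Newton expansions
  telescope.\<close>

lemma rcoeff_Suc: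
  assumes "Suc i < l"
  shows "rcoeff q (Suc i) * (1 - inverse (q ^ (2 * Suc i))) = rcoeff q i * (q - inverse q) ^ 2 * inverse q"
proof -
  have n: "1 - inverse (q ^ 2) \<noteq> 0"
    using q_even_power[of 1] l by auto
  have n': "1 - inverse (q ^ (2 * Suc i)) \<noteq> 0"
    using q_even_power[of "Suc i"] assms nat_dvd_not_less[of "Suc i" l]
    by (metis inverse_eq_1_iff right_minus_eq zero_less_Suc)
  have "inverse (q ^ 2) ^ Suc i = inverse (q ^ (2 * Suc i))"
    by (simp only: power_mult power_inverse)
  then have "rcoeff q (Suc i) = rcoeff q i * (q - inverse q) *
      ((1 - inverse (q ^ 2)) / (1 - inverse (q ^ (2 * Suc i))))"
    by (simp add: rcoeff_def qfact_def)
  then have "rcoeff q (Suc i) * (1 - inverse (q ^ (2 * Suc i))) =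
      rcoeff q i * (q - inverse q) * (1 - inverse (q ^ 2))"
    using n' by (simp del: mult_Suc_right)
  also have "1 - inverse (q ^ 2) = inverse q * (q - inverse q)"
    by (simp add: power2_eq_square field_simps)
  finally show ?thesis by (simp add: power2_eq_square mult_ac)
qed

text \<open>The first factor cancels against \<open>rcoeff_Suc\<close>. The second can vanish only
  if \<open>x ^ (2 * l) = 1\<close>, which yields distinct nodes for generic
  \<open>x\<close>.\<close>

lemma newton_node_diff:
  assumes "x \<noteq> 0"
  shows "newton_node q x - newton_node q (x * q ^ (2 * m)) =
    (1 - inverse (q ^ (2 * m))) * (inverse (q * x) - q ^ (2 * m) * q * x) / (q - inverse q) ^ 2"
proof -
  have "q ^ (2 * m) \<noteq> 0" by simp
  then show ?thesis
    unfolding newton_node_def diff_divide_distrib [symmetric]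
    by (rule_tac arg_cong[where f = "\<lambda>t. t / _"]) (use assms in \<open>simp add: field_simps\<close>)
qed

text \<open>Telescoping: the left side is a Newton expansion in the shifted nodes whose coefficients
  cancel except for the leading one.\<close>

lemma twist_poly_shift_partial:
  assumes "x \<noteq> 0" "n < l"
  shows "(\<Sum>i<Suc n. rcoeff q i * q ^ (2 * i) * x ^ i * poly (newton_poly q x i) t)
    - q ^ 4 * x ^ 2 * (\<Sum>i<Suc n. rcoeff q i * q ^ (2 * i) * (x * q ^ 2) ^ i * poly (newton_poly q (x * q ^ 2) i) t)
    = rcoeff q n * q ^ (2 * n) * x ^ n * (1 - q ^ (2 * n + 4) * x ^ 2) * poly (newton_poly q (x * q ^ 2) n) t"
  using assms(2)
proof (induction n)
  case 0
  then show ?case by (simp add: newton_poly_def)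
next
  case (Suc n)
  let ?N = "\<lambda>i. poly (newton_poly q x i) t" and ?M = "\<lambda>i. poly (newton_poly q (x * q ^ 2) i) t"
  let ?Q = "q ^ (2 * Suc n)"
  let ?c = "rcoeff q (Suc n)"
  have N: "?N (Suc n) = (t - newton_node q x) * ?M n"
    by (simp add: newton_poly_Suc_left algebra_simps)
  have arg: "x * q ^ 2 * q ^ (2 * n) = x * ?Q"
    by (simp add: power2_eq_square)
  have M: "?M (Suc n) = (t - newton_node q (x * ?Q)) * ?M n"
    unfolding newton_poly_Suc arg by (simp add: algebra_simps)
  have c: "?c * (newton_node q x - newton_node q (x * ?Q)) =
      rcoeff q n * inverse q * (inverse (q * x) - ?Q * q * x)"
  proof -
    have "?c * (newton_node q x - newton_node q (x * ?Q)) =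
        ?c * (1 - inverse ?Q) * (inverse (q * x) - ?Q * q * x) / (q - inverse q) ^ 2"
      unfolding newton_node_diff[OF assms(1)] by (simp only: mult.assoc times_divide_eq_right)
    then show ?thesis
      unfolding rcoeff_Suc[OF Suc.prems] using q_bracket_nonzero by (simp del: mult_Suc_right)
  qed
  \<comment> \<open>The previous leading coefficient is rewritten with a node difference as factor.
    Added to the factor \<open>t - newton_node q x\<close> of the new term, this difference gives
    \<open>t - newton_node q (x * ?Q)\<close>, the factor by which \<open>?M (Suc n)\<close> extends
    \<open>?M n\<close>.\<close>
  have key: "rcoeff q n * q ^ (2 * n) * x ^ n * (1 - q ^ (2 * n + 4) * x ^ 2)
      = ?c * ?Q * x ^ Suc n * (newton_node q x - newton_node q (x * ?Q))"
  proof -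
    have "?c * ?Q * x ^ Suc n * (newton_node q x - newton_node q (x * ?Q)) =
        ?Q * x ^ Suc n * (?c * (newton_node q x - newton_node q (x * ?Q)))"
      by (simp only: mult_ac)
    also have "\<dots> = ?Q * x ^ Suc n * (rcoeff q n * inverse q * (inverse (q * x) - ?Q * q * x))"
      by (simp only: c)
    also have "\<dots> = rcoeff q n * q ^ (2 * n) * x ^ n * (1 - q ^ (2 * n + 4) * x ^ 2)"
      using assms(1) by (simp add: field_simps power_add power2_eq_square numeral_eq_Suc)
    finally show ?thesis by (rule sym)
  qed
  have pw: "(x * q ^ 2) ^ Suc n = x ^ Suc n * ?Q"
    by (simp only: power_mult_distrib power_mult)
  have pw2: "q ^ (2 * Suc n + 4) = ?Q * q ^ 4"
    by (simp only: power_add)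
  define T1 where "T1 = (\<Sum>i<Suc n. rcoeff q i * q ^ (2 * i) * x ^ i * ?N i)"
  define T2 where "T2 = (\<Sum>i<Suc n. rcoeff q i * q ^ (2 * i) * (x * q ^ 2) ^ i * ?M i)"
  have IH: "T1 - q ^ 4 * x ^ 2 * T2 =
      ?c * ?Q * x ^ Suc n * (newton_node q x - newton_node q (x * ?Q)) * ?M n"
    unfolding T1_def T2_def key [symmetric] using Suc by simp
  have "(T1 + ?c * ?Q * x ^ Suc n * ?N (Suc n)) -
      q ^ 4 * x ^ 2 * (T2 + ?c * ?Q * (x * q ^ 2) ^ Suc n * ?M (Suc n)) =
      (T1 - q ^ 4 * x ^ 2 * T2) + ?c * ?Q * x ^ Suc n * ?N (Suc n)
      - q ^ 4 * x ^ 2 * (?c * ?Q * (x ^ Suc n * ?Q) * ?M (Suc n))"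
    unfolding pw by (simp only: distrib_left diff_diff_eq [symmetric] add_diff_eq diff_add_eq)
  also have "\<dots> = ?c * ?Q * x ^ Suc n * (1 - ?Q * q ^ 4 * x ^ 2) * ?M (Suc n)"
    unfolding IH N M by algebra
  finally show ?case
    unfolding pw2 T1_def T2_def by (simp only: sum.lessThan_Suc[of _ "Suc n"])
qed

lemma poly_twist_poly:
  "poly (twist_poly q l x) t = (\<Sum>i<l. rcoeff q i * q ^ (2 * i) * x ^ i * poly (newton_poly q x i) t)"
  by (simp add: twist_poly_def poly_sum)

text \<open>The case \<open>n = l - 1\<close>. The scalar is left abstract because the Newton
  polynomial on the right is what disappears in both applications: at the nodes of
  \<open>x * q ^ (2 * j)\<close> for \<open>0 < j < l\<close>, and on vectors \<open>f1 w\<close> by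
  nilpotency.\<close>

lemma twist_poly_shift:
  assumes "x \<noteq> 0"
  obtains \<kappa> where "twist_poly q l x - smult (q ^ 4 * x ^ 2) (twist_poly q l (x * q ^ 2)) =
    smult \<kappa> (newton_poly q (x * q ^ 2) (l - 1))"
proof -
  obtain n where n: "l = Suc n" using l by (cases l) auto
  have nl: "n < l" "l - 1 = n" using n by auto
  have "poly (twist_poly q l x - smult (q ^ 4 * x ^ 2) (twist_poly q l (x * q ^ 2))) =
    poly (smult (rcoeff q n * q ^ (2 * n) * x ^ n * (1 - q ^ (2 * n + 4) * x ^ 2))
      (newton_poly q (x * q ^ 2) (l - 1)))"
  proof (rule ext, goal_cases)
    case (1 t)
    show ?case
      using twist_poly_shift_partial[OF assms nl(1), of t]
      unfolding n [symmetric] nl(2) poly_diff poly_smult poly_twist_poly .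
  qed
  then show thesis using that unfolding poly_eq_poly_eq_iff by blast
qed

lemma newton_poly_root: "j < i \<Longrightarrow> poly (newton_poly q x i) (newton_node q (x * q ^ (2 * j))) = 0"
  by (auto simp: newton_poly_def poly_prod)

text \<open>Shifting \<open>m\<close> times contributes the factors
  \<open>q ^ 4 * (x * q ^ (2 * j)) ^ 2\<close> for \<open>j < m\<close>. After that the node is the
  leading one, where all terms but the constant one vanish.\<close>

lemma twist_poly_at_node:
  assumes "x \<noteq> 0" "m < l"
  shows "poly (twist_poly q l x) (newton_node q (x * q ^ (2 * m))) = x ^ (2 * m) * q ^ (2 * m * (m + 1))"
  using assms
proof (induction m arbitrary: x)
  case 0
  have z: "i > 0 \<Longrightarrow> poly (newton_poly q x i) (newton_node q x) = 0" for i
    using newton_poly_root[of 0 i x] by simp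
  have "(\<Sum>i<l. rcoeff q i * q ^ (2 * i) * x ^ i * poly (newton_poly q x i) (newton_node q x)) =
      (\<Sum>i<l. if i = 0 then 1 else 0)"
  proof (rule sum.cong)
    fix i show "rcoeff q i * q ^ (2 * i) * x ^ i * poly (newton_poly q x i) (newton_node q x) =
        (if i = 0 then 1 else 0)"
      using z[of i] by (cases i) (simp_all add: newton_poly_def [of _ _ 0])
  qed simp
  then show ?case using 0 by (simp add: poly_twist_poly)
next
  case (Suc m)
  let ?x = "x * q ^ 2" and ?t = "newton_node q (x * q ^ (2 * Suc m))"
  have arg: "x * q ^ (2 * Suc m) = ?x * q ^ (2 * m)"
    by (simp add: power2_eq_square)
  obtain \<kappa> where k: "twist_poly q l x - smult (q ^ 4 * x ^ 2) (twist_poly q l ?x) =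
      smult \<kappa> (newton_poly q ?x (l - 1))"
    using twist_poly_shift[OF Suc.prems(1)] .
  have "poly (newton_poly q ?x (l - 1)) ?t = 0"
    unfolding arg by (rule newton_poly_root) (use Suc.prems in auto)
  then have "poly (twist_poly q l x) ?t = q ^ 4 * x ^ 2 * poly (twist_poly q l ?x) ?t"
    using arg_cong[OF k, of "\<lambda>p. poly p ?t"] by simp
  also have "poly (twist_poly q l ?x) ?t = ?x ^ (2 * m) * q ^ (2 * m * (m + 1))"
    unfolding arg by (rule Suc.IH) (use Suc.prems in auto)
  also have "?x ^ (2 * m) = x ^ (2 * m) * q ^ (2 * (2 * m))"
    by (simp only: power_mult_distrib power_mult [symmetric])
  also have "q ^ 4 * x ^ 2 * (x ^ (2 * m) * q ^ (2 * (2 * m)) * q ^ (2 * m * (m + 1))) =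
      x ^ (2 + 2 * m) * q ^ (4 + 2 * (2 * m) + 2 * m * (m + 1))"
    by (simp only: power_add mult_ac)
  also have "2 + 2 * m = 2 * Suc m" by simp
  also have "4 + 2 * (2 * m) + 2 * m * (m + 1) = 2 * Suc m * (Suc m + 1)"
    by (simp add: algebra_simps)
  finally show ?case .
qed

lemma twist_poly_symmetry_generic:
  assumes x: "x \<noteq> 0" and gen: "x ^ (2 * l) \<noteq> 1"
  shows "twist_poly q l x = smult (x ^ (2 * (l - 1))) (twist_poly q l (inverse x))"
proof (rule ccontr)
  let ?p = "twist_poly q l x - smult (x ^ (2 * (l - 1))) (twist_poly q l (inverse x))"
  let ?s = "\<lambda>m. newton_node q (x * q ^ (2 * m))"
  assume "\<not> ?thesis"
  then have p: "?p \<noteq> 0" by simp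
  have deg: "degree (twist_poly q l y) \<le> l - 1" for y
    unfolding twist_poly_def
    by (rule degree_sum_le) (auto intro: order.trans[OF degree_smult_le] simp: degree_newton_poly)
  have "degree ?p \<le> l - 1"
    by (intro degree_diff_le deg order.trans[OF degree_smult_le])
  moreover have "card {t. poly ?p t = 0} \<le> degree ?p"
    by (rule card_poly_roots_bound[OF p])
  moreover have "?s ` {..<l} \<subseteq> {t. poly ?p t = 0}"
  proof safe
    fix m assume m: "m < l"
    \<comment> \<open>The nodes for \<open>inverse x\<close> are those for \<open>x\<close> in
      reverse order: node \<open>m\<close> of one list is node \<open>l - 1 - m\<close> of the
      other.\<close>
    define k where "k = l - 1 - m"
    have ql: "q ^ (2 * l) = 1" by (simp add: q_even_power)
    have mk: "m + 1 + k = l" using m by (simp add: k_def)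
    have "inverse (q ^ (2 * (m + 1))) = q ^ (2 * k)"
    proof -
      have "q ^ (2 * (m + 1)) * q ^ (2 * k) = 1"
        using ql by (simp only: power_add [symmetric] distrib_left [symmetric] mk)
      then show ?thesis by (rule inverse_unique)
    qed
    moreover have "?s m = newton_node q (inverse x * inverse (q ^ (2 * (m + 1))))"
      using newton_node_inverse[OF q_nonzero, of "x * q ^ (2 * m)"]
      by (simp add: power2_eq_square mult_ac)
    ultimately have "?s m = newton_node q (inverse x * q ^ (2 * k))" by simp
    then have 1: "poly (twist_poly q l (inverse x)) (?s m) =
        inverse x ^ (2 * k) * q ^ (2 * k * (k + 1))"
      using twist_poly_at_node[of "inverse x" k] x m by (simp add: k_def)
    have "x ^ (2 * (l - 1)) = x ^ (2 * m) * x ^ (2 * k)"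
    proof -
      have "2 * (l - 1) = 2 * m + 2 * k" using mk by simp
      then show ?thesis by (simp only: power_add)
    qed
    then have 2: "x ^ (2 * (l - 1)) * inverse x ^ (2 * k) = x ^ (2 * m)"
      using x by (simp add: power_inverse)
    \<comment> \<open>As \<open>m + k + 1 = l\<close>, the exponents differ by a multiple of
      \<open>2 * l\<close>. The two cases account for truncated subtraction.\<close>
    have "q ^ (2 * k * (k + 1)) = q ^ (2 * m * (m + 1))"
    proof (cases "k \<le> m")
      case True
      have "2 * m * (m + 1) = 2 * k * (k + 1) + 2 * l * (m - k)"
      proof -
        obtain d where d: "m = k + d" using True le_Suc_ex by blast
        show ?thesis using mk unfolding d by (auto simp: algebra_simps)
      qed
      then show ?thesis using ql by (simp only: power_add power_mult) simp
    next
      case False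
      have "2 * k * (k + 1) = 2 * m * (m + 1) + 2 * l * (k - m)"
      proof -
        obtain d where d: "k = m + d" using False le_Suc_ex nat_le_linear by blast
        show ?thesis using mk unfolding d by (auto simp: algebra_simps)
      qed
      then show ?thesis using ql by (simp only: power_add power_mult) simp
    qed
    then show "poly ?p (?s m) = 0"
      using 1 2 twist_poly_at_node[OF x m] by simp
  qed
  moreover have "card (?s ` {..<l}) = l"
  proof -
    have "inj_on ?s {..<l}"
    proof (rule linorder_inj_onI)
      fix m n assume mn: "m < n" "m \<in> {..<l}" "n \<in> {..<l}"
      show "?s m \<noteq> ?s n"
      proof
        assume eq: "?s m = ?s n"
        define y where "y = x * q ^ (2 * m)"
        have y: "y \<noteq> 0" using x by (simp add: y_def)
        have "x * q ^ (2 * n) = y * q ^ (2 * (n - m))"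
        proof -
          have "2 * n = 2 * m + 2 * (n - m)" using mn by simp
          then have "q ^ (2 * n) = q ^ (2 * m) * q ^ (2 * (n - m))" by (simp only: power_add)
          then show ?thesis by (simp only: y_def mult.assoc)
        qed
        then have "newton_node q y - newton_node q (y * q ^ (2 * (n - m))) = 0"
          using eq unfolding y_def by (simp only: diff_self)
        moreover have "1 - inverse (q ^ (2 * (n - m))) \<noteq> 0"
          using q_even_power[of "n - m"] mn nat_dvd_not_less[of "n - m" l] by auto
        ultimately have "inverse (q * y) - q ^ (2 * (n - m)) * q * y = 0"
          unfolding newton_node_diff[OF y] using q_bracket_nonzero by simp
        then have "q ^ (2 * (n - m)) * q ^ 2 * y ^ 2 = 1"
          using y by (simp add: field_simps power2_eq_square)
        \<comment> \<open>The \<open>l\<close>-th power removes every power of \<open>q\<close> and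
          leaves a condition on \<open>x\<close> alone.\<close>
        then have "(q ^ (2 * (n - m)) * q ^ 2 * y ^ 2) ^ l = 1" by simp
        moreover have "q ^ (l * k) = 1" for k
          by (simp add: q_eq_1_iff)
        ultimately have "x ^ (2 * l) = 1"
          by (simp only: y_def power_mult_distrib power_mult [symmetric] mult.commute[of _ l] mult_1_left mult_1_right)
        then show False using gen by simp
      qed
    qed auto
    then show ?thesis by (simp add: card_image)
  qed
  ultimately show False
    using card_mono[OF poly_roots_finite[OF p], of "?s ` {..<l}"] l by linarith
qed

text \<open>Values with \<open>x ^ (2 * l) = 1\<close>, where nodes can collide, do occur: on the
  trivial module \<open>x = 1\<close>. For a fixed argument \<open>t\<close> both sides are
  continuous in \<open>x\<close> away from zero and agree off a finite set.\<close>

lemma twist_poly_symmetry: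
  assumes x: "x \<noteq> 0"
  shows "twist_poly q l x = smult (x ^ (2 * (l - 1))) (twist_poly q l (inverse x))"
proof -
  have "poly (twist_poly q l x) t = poly (smult (x ^ (2 * (l - 1))) (twist_poly q l (inverse x))) t" for t
  proof -
    define D where "D y = poly (twist_poly q l y) t - poly (smult (y ^ (2 * (l - 1))) (twist_poly q l (inverse y))) t" for y
    have node: "isCont (\<lambda>y. newton_node q (g y * c)) x" if "isCont g x" "g x \<noteq> 0" "c \<noteq> 0" for g c
      unfolding newton_node_def using that q_bracket_nonzero
      by (intro isCont_divide isCont_add isCont_mult continuous_at_within_inverse continuous_const) auto
    have "isCont (\<lambda>y. poly (newton_poly q (g y) i) t) x" if "isCont g x" "g x \<noteq> 0" for g i
      unfolding newton_poly_def poly_prod poly_pCons poly_0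
      by (intro continuous_intros node that) auto
    then have tw: "isCont (\<lambda>y. poly (twist_poly q l (g y)) t) x" if "isCont g x" "g x \<noteq> 0" for g
      unfolding poly_twist_poly using that by (intro continuous_intros)
    have "isCont inverse x"
      using continuous_at_within_inverse[OF continuous_ident x] by simp
    then have "isCont D x"
      unfolding D_def poly_smult using x by (intro continuous_intros tw) auto
    then have lim: "(D \<longlongrightarrow> D x) (at x)" by (simp add: isCont_def)
    have "finite ({y::complex. y ^ (2 * l) = 1} \<union> {0})"
      using l finite_nth_roots[of "2 * l" 1] by simp
    \<comment> \<open>\<open>x\<close> may itself be exceptional. It is taken out of the excluded
      set, since the filter \<open>at x\<close> ignores the point \<open>x\<close>.\<close>
    then have "closed (({y::complex. y ^ (2 * l) = 1} \<union> {0}) - {x})"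
      by (intro finite_imp_closed finite_Diff)
    then have "open (- (({y::complex. y ^ (2 * l) = 1} \<union> {0}) - {x}))"
      by (rule open_Compl)
    then have "eventually (\<lambda>y. y \<in> - (({y::complex. y ^ (2 * l) = 1} \<union> {0}) - {x})) (at x)"
      unfolding eventually_at_topological by blast
    then have "eventually (\<lambda>y. D y = 0) (at x)"
      using eventually_neq_at_within[of x x UNIV]
    proof eventually_elim
      case (elim y)
      then show ?case using twist_poly_symmetry_generic[of y] by (auto simp: D_def)
    qed
    then have "(D \<longlongrightarrow> 0) (at x)" by (rule tendsto_eventually)
    then have "D x = 0" using lim tendsto_unique[of "at x"] by force
    then show ?thesis by (simp add: D_def)
  qed
  then show ?thesis unfolding poly_eq_poly_eq_iff [symmetric] by blast
qed

end

section \<open>Normal ordering\<close>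

definition op_poly :: "('a::complex_vec \<Rightarrow> 'a) \<Rightarrow> complex poly \<Rightarrow> 'a \<Rightarrow> 'a"
  where "op_poly A p v = (\<Sum>i\<le>degree p. coeff p i *\<^sub>C (A ^^ i) v)"

text \<open>Lets polynomials of different degrees be summed up to a common bound, whence additivity
  in the polynomial.\<close>

lemma op_poly_altdef:
  assumes "degree p \<le> n"
  shows "op_poly A p v = (\<Sum>i\<le>n. coeff p i *\<^sub>C (A ^^ i) v)"
  unfolding op_poly_def
  by (rule sum.mono_neutral_left) (use assms in \<open>auto simp: coeff_eq_0\<close>)

lemma op_poly_1 [simp]: "op_poly A 1 v = v"
  by (simp add: op_poly_def)

lemma op_poly_0 [simp]: "op_poly A 0 v = 0"
  by (simp add: op_poly_def)

lemma op_poly_add: "op_poly A (p + p') v = op_poly A p v + op_poly A p' v"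
proof -
  let ?n = "max (degree p) (degree p')"
  show ?thesis
    using op_poly_altdef[of "p + p'" ?n A v] op_poly_altdef[of p ?n A v] op_poly_altdef[of p' ?n A v]
    by (simp add: degree_add_le_max scaleC_add_left sum.distrib)
qed

lemma op_poly_smult: "op_poly A (smult c p) v = c *\<^sub>C op_poly A p v"
  using op_poly_altdef[of "smult c p" "degree p" A v]
  by (simp add: op_poly_def cvs.scale_sum_right scaleC_scaleC degree_smult_le)

lemma op_poly_diff: "op_poly A (p - p') v = op_poly A p v - op_poly A p' v"
  using op_poly_add[of A p "- p'" v] op_poly_smult[of A "- 1" p' v] by (simp add: scaleC_one)

lemma op_poly_sum: "op_poly A (\<Sum>i\<in>S. p i) v = (\<Sum>i\<in>S. op_poly A (p i) v)"
  by (induction S rule: infinite_finite_induct) (simp_all add: op_poly_add)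

lemma op_poly_pCons_0:
  assumes "clinear A"
  shows "op_poly A (pCons 0 p) v = A (op_poly A p v)"
proof -
  have "op_poly A (pCons 0 p) v = (\<Sum>i\<le>Suc (degree p). coeff (pCons 0 p) i *\<^sub>C (A ^^ i) v)"
    by (rule op_poly_altdef) (rule degree_pCons_le)
  also have "\<dots> = A (op_poly A p v)"
    unfolding sum.atMost_Suc_shift by (simp add: op_poly_def clinearD[OF assms])
  finally show ?thesis .
qed

lemma op_poly_mult_linear:
  assumes "clinear A"
  shows "op_poly A (p * [:- s, 1:]) v = A (op_poly A p v) - s *\<^sub>C op_poly A p v"
proof -
  have "p * [:- s, 1:] = pCons 0 p - smult s p" by simp
  then show ?thesis by (simp only: op_poly_diff op_poly_smult op_poly_pCons_0[OF assms])
qed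

lemma op_poly_commute:
  assumes "clinear B" "\<And>v. B (A v) = A (B v)"
  shows "B (op_poly A p v) = op_poly A p (B v)"
proof -
  have "B ((A ^^ i) v) = (A ^^ i) (B v)" for i
    using assms(2) by (induction i) auto
  then show ?thesis by (simp add: op_poly_def clinearD[OF assms(1)])
qed

text \<open>Turns a vector identity into a ring identity between complex numbers.\<close>

lemma vec_eqI:
  assumes "\<And>g :: 'a::complex_vec \<Rightarrow> complex. clinear g \<Longrightarrow> g x = g y"
  shows "x = y"
  using dual_separates[of "x - y"] assms by (simp add: clinearD)

section \<open>The quantum group acting on a vector space, and its weight vectors\<close>

locale uq_sl21 = odd_root q l for q l +
  fixes e1 e2 f1 f2 k1 k2 k1' k2' :: "'v::complex_vec \<Rightarrow> 'v"
  assumes lin: "clinear e1" "clinear e2" "clinear f1" "clinear f2"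
      "clinear k1" "clinear k2" "clinear k1'" "clinear k2'"
    and inv: "k1 (k1' v) = v" "k1' (k1 v) = v" "k2 (k2' v) = v" "k2' (k2 v) = v"
    and conj_e: "k1 (e1 (k1' v)) = q ^ 2 *\<^sub>C e1 v" "k1 (e2 (k1' v)) = inverse q *\<^sub>C e2 v"
      "k2 (e1 (k2' v)) = inverse q *\<^sub>C e1 v" "k2 (e2 (k2' v)) = e2 v"
    and conj_f: "k1 (f1 (k1' v)) = inverse (q ^ 2) *\<^sub>C f1 v" "k1 (f2 (k1' v)) = q *\<^sub>C f2 v"
      "k2 (f1 (k2' v)) = q *\<^sub>C f1 v" "k2 (f2 (k2' v)) = f2 v"
    and e1_f1: "e1 (f1 v) - f1 (e1 v) = inverse (q - inverse q) *\<^sub>C (k1 v - k1' v)"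
    and e2_f2: "e2 (f2 v) + f2 (e2 v) = inverse (q - inverse q) *\<^sub>C (k2 v - k2' v)"
    and e_f: "e1 (f2 v) = f2 (e1 v)" "e2 (f1 v) = f1 (e2 v)"
    and odd_square: "e2 (e2 v) = 0" "f2 (f2 v) = 0"
    and nilpotent: "(e1 ^^ l) v = 0" "(f1 ^^ l) v = 0"
begin

lemmas linD = lin[THEN clinearD(1)] lin[THEN clinearD(2)] lin[THEN clinearD(3)]
  lin[THEN clinearD(4)] lin[THEN clinearD(5)]

lemmas lin_compose = lin[THEN clinear_compose]

definition e3 :: "'v \<Rightarrow> 'v" where "e3 v = e1 (e2 v) - inverse q *\<^sub>C e2 (e1 v)"

definition f3 :: "'v \<Rightarrow> 'v" where "f3 v = f2 (f1 v) - q *\<^sub>C f1 (f2 v)"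

definition kwt :: "complex \<Rightarrow> complex \<Rightarrow> 'v \<Rightarrow> bool"
  where "kwt x y v \<longleftrightarrow> x \<noteq> 0 \<and> y \<noteq> 0 \<and> k1 v = x *\<^sub>C v \<and> k2 v = y *\<^sub>C v"

lemma lin3: "clinear e3" "clinear f3"
  unfolding e3_def f3_def by (intro clinear_intros lin lin_compose)+

lemma k_e: "k1 (e1 v) = q ^ 2 *\<^sub>C e1 (k1 v)" "k1 (e2 v) = inverse q *\<^sub>C e2 (k1 v)"
    "k2 (e1 v) = inverse q *\<^sub>C e1 (k2 v)" "k2 (e2 v) = e2 (k2 v)"
  using conj_e(1,2)[of "k1 v"] conj_e(3,4)[of "k2 v"] by (simp_all only: inv)

lemma k_f: "k1 (f1 v) = inverse (q ^ 2) *\<^sub>C f1 (k1 v)" "k1 (f2 v) = q *\<^sub>C f2 (k1 v)"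
    "k2 (f1 v) = q *\<^sub>C f1 (k2 v)" "k2 (f2 v) = f2 (k2 v)"
  using conj_f(1,2)[of "k1 v"] conj_f(3,4)[of "k2 v"] by (simp_all only: inv)

lemma k'_move:
  assumes "clinear k'" "c \<noteq> 0" "\<And>v. k (k' v) = v" "\<And>v. k' (k v) = v" "\<And>v. k (g v) = c *\<^sub>C g (k v)"
  shows "k' (g v) = inverse c *\<^sub>C g (k' v)"
proof -
  have "k' (k (g (k' v))) = k' (c *\<^sub>C g v)" using assms(3,5) by simp
  then have "g (k' v) = c *\<^sub>C k' (g v)" by (simp add: assms(4) clinearD[OF assms(1)])
  then show ?thesis using assms(2) by (simp add: scaleC_scaleC scaleC_one)
qed

lemma k'_e: "k1' (e1 v) = inverse (q ^ 2) *\<^sub>C e1 (k1' v)" "k1' (e2 v) = q *\<^sub>C e2 (k1' v)"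
    "k2' (e1 v) = q *\<^sub>C e1 (k2' v)" "k2' (e2 v) = e2 (k2' v)"
  using k'_move[of k1' "q ^ 2" k1 e1 v] k'_move[of k1' "inverse q" k1 e2 v]
    k'_move[of k2' "inverse q" k2 e1 v] k'_move[of k2' 1 k2 e2 v]
  by (simp_all add: lin inv k_e scaleC_one)

lemma k'_f: "k1' (f1 v) = q ^ 2 *\<^sub>C f1 (k1' v)" "k1' (f2 v) = inverse q *\<^sub>C f2 (k1' v)"
    "k2' (f1 v) = inverse q *\<^sub>C f1 (k2' v)" "k2' (f2 v) = f2 (k2' v)"
  using k'_move[of k1' "inverse (q ^ 2)" k1 f1 v] k'_move[of k1' q k1 f2 v]
    k'_move[of k2' q k2 f1 v] k'_move[of k2' 1 k2 f2 v]
  by (simp_all add: lin inv k_f scaleC_one)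

lemma kwt_inv:
  assumes "kwt x y v"
  shows "k1' v = inverse x *\<^sub>C v" "k2' v = inverse y *\<^sub>C v"
proof -
  have "k1' (x *\<^sub>C v) = v" "k2' (y *\<^sub>C v) = v"
    using inv[of v] assms unfolding kwt_def by auto
  then have "x *\<^sub>C k1' v = v" "y *\<^sub>C k2' v = v" by (simp_all add: linD)
  then have "inverse x *\<^sub>C x *\<^sub>C k1' v = inverse x *\<^sub>C v" "inverse y *\<^sub>C y *\<^sub>C k2' v = inverse y *\<^sub>C v"
    by simp_all
  then show "k1' v = inverse x *\<^sub>C v" "k2' v = inverse y *\<^sub>C v"
    using assms by (simp_all add: scaleC_scaleC kwt_def scaleC_one)
qed

lemma kwt_diff_scale: "kwt x y u \<Longrightarrow> kwt x y w \<Longrightarrow> kwt x y (u - c *\<^sub>C w)"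
  by (simp add: kwt_def linD scaleC_scaleC cvs.scale_right_diff_distrib mult.commute)

lemma kwt_move:
  assumes "kwt x y v"
  shows "kwt (x * q ^ 2) (y * inverse q) (e1 v)" "kwt (x * inverse q) y (e2 v)"
    "kwt (x * inverse (q ^ 2)) (y * q) (f1 v)" "kwt (x * q) y (f2 v)"
    "kwt (x * q) (y * inverse q) (e3 v)" "kwt (x * inverse q) (y * q) (f3 v)"
proof -
  have e1: "kwt (x * q ^ 2) (y * inverse q) (e1 v)" and e2: "kwt (x * inverse q) y (e2 v)"
    and f1: "kwt (x * inverse (q ^ 2)) (y * q) (f1 v)" and f2: "kwt (x * q) y (f2 v)"
    if "kwt x y v" for x y v
    using that by (auto simp: kwt_def k_e k_f linD scaleC_scaleC mult_ac)
  show "kwt (x * q ^ 2) (y * inverse q) (e1 v)" "kwt (x * inverse q) y (e2 v)"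
    "kwt (x * inverse (q ^ 2)) (y * q) (f1 v)" "kwt (x * q) y (f2 v)"
    using e1 e2 f1 f2 assms by blast+
  have *: "q ^ 2 * inverse q = q" "inverse q * q ^ 2 = q" "inverse (q ^ 2) * q = inverse q"
      "q * inverse (q ^ 2) = inverse q"
    by (simp_all add: power2_eq_square)
  show "kwt (x * q) (y * inverse q) (e3 v)"
    unfolding e3_def using e1[OF e2[OF assms]] e2[OF e1[OF assms]]
    by (intro kwt_diff_scale) (simp_all add: mult.assoc *)
  show "kwt (x * inverse q) (y * q) (f3 v)"
    unfolding f3_def using f1[OF f2[OF assms]] f2[OF f1[OF assms]]
    by (intro kwt_diff_scale) (simp_all add: mult.assoc *)
qed

section \<open>The Casimir element of the quantum sl(2) generated by \<open>e1\<close>,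
  \<open>f1\<close> and \<open>k1\<close>\<close>

definition casimir :: "'v \<Rightarrow> 'v"
  where "casimir v = f1 (e1 v) + inverse ((q - inverse q) ^ 2) *\<^sub>C (q *\<^sub>C k1 v + inverse q *\<^sub>C k1' v)"

lemma lin_casimir: "clinear casimir"
  unfolding casimir_def by (intro clinear_intros lin lin_compose)

lemma e1_f1': "e1 (f1 v) = f1 (e1 v) + inverse (q - inverse q) *\<^sub>C (k1 v - k1' v)"
  using e1_f1[of v] by (simp add: algebra_simps)

lemma e2_f2': "e2 (f2 v) = inverse (q - inverse q) *\<^sub>C (k2 v - k2' v) - f2 (e2 v)"
  using e2_f2[of v] by (simp add: algebra_simps)

lemma casimir_altdef:
  "casimir v = e1 (f1 v) + inverse ((q - inverse q) ^ 2) *\<^sub>C (inverse q *\<^sub>C k1 v + q *\<^sub>C k1' v)"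
proof -
  have b: "inverse (q - inverse q) = inverse ((q - inverse q) ^ 2) * (q - inverse q)"
    using q_bracket_nonzero by (simp add: power2_eq_square)
  show ?thesis
  proof (rule vec_eqI)
    fix g :: "'v \<Rightarrow> complex" assume g: "clinear g"
    show "g (casimir v) = g (e1 (f1 v) + inverse ((q - inverse q) ^ 2) *\<^sub>C (inverse q *\<^sub>C k1 v + q *\<^sub>C k1' v))"
      unfolding casimir_def e1_f1' b
      by (simp only: clinearD[OF g] scaleC_complex_def) algebra
  qed
qed

text \<open>With the defining form inside \<open>e1\<close> and \<open>casimir_altdef\<close> on
  \<open>e1 v\<close>, both sides have the same term \<open>e1 (f1 (e1 v))\<close>. The torus parts
  match because moving \<open>k1\<close> past \<open>e1\<close> costs \<open>q ^ 2\<close>, which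
  turns \<open>inverse q\<close> into \<open>q\<close>.\<close>

lemma casimir_e1: "e1 (casimir v) = casimir (e1 v)"
proof -
  have *: "inverse q * q ^ 2 = q" "q * inverse (q ^ 2) = inverse q"
    by (simp_all add: power2_eq_square)
  show ?thesis
    unfolding casimir_altdef[of "e1 v"] unfolding casimir_def
    by (simp only: linD k_e k'_e scaleC_scaleC *)
qed

lemma casimir_f1: "f1 (casimir v) = casimir (f1 v)"
proof -
  have *: "inverse q * q ^ 2 = q" "q * inverse (q ^ 2) = inverse q"
    by (simp_all add: power2_eq_square)
  show ?thesis
    unfolding casimir_altdef[of v] unfolding casimir_def
    by (simp only: linD k_f k'_f scaleC_scaleC *)
qed

lemma f1_e1_kwt:
  assumes "kwt x y v"
  shows "f1 (e1 v) = casimir v - newton_node q x *\<^sub>C v"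
proof -
  have n: "newton_node q x = inverse ((q - inverse q) ^ 2) * (q * x + inverse q * inverse x)"
    by (simp add: newton_node_def divide_inverse mult.commute)
  show ?thesis
    unfolding casimir_def kwt_inv[OF assms] n using assms
    by (simp add: kwt_def scaleC_scaleC scaleC_add_left [symmetric])
qed

text \<open>Exchanging \<open>e1\<close> and \<open>f1\<close> replaces \<open>x\<close> by its
  inverse. This is why the primed sum has the same polynomial with parameter
  \<open>inverse x\<close>.\<close>

lemma e1_f1_kwt:
  assumes "kwt x y v"
  shows "e1 (f1 v) = casimir v - newton_node q (inverse x) *\<^sub>C v"
proof -
  have n: "newton_node q (inverse x) = inverse ((q - inverse q) ^ 2) * (inverse q * x + q * inverse x)"
    by (simp add: newton_node_def divide_inverse mult.commute add.commute)
  show ?thesis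
    unfolding casimir_altdef kwt_inv[OF assms] n using assms
    by (simp add: kwt_def scaleC_scaleC scaleC_add_left [symmetric])
qed

text \<open>The second eigenvalue is written as an inverse so that \<open>e1_f1_kwt\<close> directly
  produces the nodes of \<open>newton_poly q (inverse x)\<close>.\<close>

lemma kwt_funpow:
  assumes "kwt x y v"
  shows "kwt (x * q ^ (2 * i)) (y * inverse q ^ i) ((e1 ^^ i) v)"
    "kwt (inverse (inverse x * q ^ (2 * i))) (y * q ^ i) ((f1 ^^ i) v)"
proof (induction i)
  case 0
  show "kwt (x * q ^ (2 * 0)) (y * inverse q ^ 0) ((e1 ^^ 0) v)"
    "kwt (inverse (inverse x * q ^ (2 * 0))) (y * q ^ 0) ((f1 ^^ 0) v)"
    using assms by simp_all
next
  case (Suc i)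
  show "kwt (x * q ^ (2 * Suc i)) (y * inverse q ^ Suc i) ((e1 ^^ Suc i) v)"
    "kwt (inverse (inverse x * q ^ (2 * Suc i))) (y * q ^ Suc i) ((f1 ^^ Suc i) v)"
    using kwt_move(1)[OF Suc(1)] kwt_move(3)[OF Suc(2)] by (simp_all add: power2_eq_square mult_ac)
qed

lemma f1_e1_power:
  assumes "kwt x y v"
  shows "(f1 ^^ i) ((e1 ^^ i) v) = op_poly casimir (newton_poly q x i) v"
proof (induction i)
  case 0
  then show ?case by (simp add: newton_poly_def)
next
  case (Suc i)
  have c: "(f1 ^^ i) (casimir u) = casimir ((f1 ^^ i) u)" for u
    by (induction i) (simp_all add: casimir_f1)
  have "(f1 ^^ Suc i) ((e1 ^^ Suc i) v) = (f1 ^^ i) (f1 (e1 ((e1 ^^ i) v)))"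
    by (simp add: funpow_swap1)
  also have "\<dots> = casimir ((f1 ^^ i) ((e1 ^^ i) v)) - newton_node q (x * q ^ (2 * i)) *\<^sub>C (f1 ^^ i) ((e1 ^^ i) v)"
    unfolding f1_e1_kwt[OF kwt_funpow(1)[OF assms]]
    by (simp add: clinearD[OF clinear_funpow[OF lin(3)]] c)
  finally show ?case
    unfolding Suc newton_poly_Suc op_poly_mult_linear[OF lin_casimir] .
qed

lemma e1_f1_power:
  assumes "kwt x y v"
  shows "(e1 ^^ i) ((f1 ^^ i) v) = op_poly casimir (newton_poly q (inverse x) i) v"
proof (induction i)
  case 0
  then show ?case by (simp add: newton_poly_def)
next
  case (Suc i)
  have c: "(e1 ^^ i) (casimir u) = casimir ((e1 ^^ i) u)" for u
    by (induction i) (simp_all add: casimir_e1)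
  have "(e1 ^^ Suc i) ((f1 ^^ Suc i) v) = (e1 ^^ i) (e1 (f1 ((f1 ^^ i) v)))"
    by (simp add: funpow_swap1)
  also have "\<dots> = casimir ((e1 ^^ i) ((f1 ^^ i) v)) - newton_node q (inverse x * q ^ (2 * i)) *\<^sub>C (e1 ^^ i) ((f1 ^^ i) v)"
    unfolding e1_f1_kwt[OF kwt_funpow(2)[OF assms]] inverse_inverse_eq
    by (simp add: clinearD[OF clinear_funpow[OF lin(1)]] c)
  finally show ?case
    unfolding Suc newton_poly_Suc op_poly_mult_linear[OF lin_casimir] .
qed

text \<open>The eigenvalue of \<open>k1\<close> is a separate parameter, not read off from
  \<open>v\<close>; this makes \<open>even_twist x\<close> linear on the whole space.\<close>

definition even_twist :: "complex \<Rightarrow> 'v \<Rightarrow> 'v"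
  where "even_twist x v = (\<Sum>i<l. (rcoeff q i * q ^ (2 * i) * x ^ i) *\<^sub>C (f1 ^^ i) ((e1 ^^ i) v))"

definition even_twist' :: "complex \<Rightarrow> 'v \<Rightarrow> 'v"
  where "even_twist' x v = (\<Sum>i<l. (rcoeff q i * q ^ (2 * i) * inverse x ^ i) *\<^sub>C (e1 ^^ i) ((f1 ^^ i) v))"

lemma even_twist_poly:
  assumes "kwt x y v"
  shows "even_twist x v = op_poly casimir (twist_poly q l x) v"
  unfolding even_twist_def twist_poly_def op_poly_sum op_poly_smult f1_e1_power[OF assms] ..

lemma even_twist'_poly:
  assumes "kwt x y v"
  shows "even_twist' x v = op_poly casimir (twist_poly q l (inverse x)) v"
  unfolding even_twist'_def twist_poly_def op_poly_sum op_poly_smult e1_f1_power[OF assms] ..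

lemma even_twist_eq:
  assumes "kwt x y v"
  shows "even_twist x v = x ^ (2 * (l - 1)) *\<^sub>C even_twist' x v"
proof -
  have "x \<noteq> 0" using assms by (simp add: kwt_def)
  show ?thesis
    unfolding even_twist_poly[OF assms] even_twist'_poly[OF assms] op_poly_smult [symmetric]
    by (rule arg_cong[OF twist_poly_symmetry[OF \<open>x \<noteq> 0\<close>]])
qed

text \<open>\<open>f1\<close> commutes with the Casimir element and lowers the eigenvalue
  \<open>x * q ^ 2\<close> to \<open>x\<close>, so \<open>twist_poly_shift\<close> compares the two
  sides. Its error term becomes \<open>f1 ^^ l\<close> applied to some vector, hence zero.\<close>

lemma even_twist_f1:
  assumes "kwt (x * q ^ 2) y w"
  shows "even_twist x (f1 w) = (q ^ 4 * x ^ 2) *\<^sub>C f1 (even_twist (x * q ^ 2) w)"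
proof -
  have x: "x \<noteq> 0" using assms by (simp add: kwt_def)
  have fw: "kwt x (y * q) (f1 w)" using kwt_move(3)[OF assms] by (simp add: mult.assoc)
  obtain \<kappa> where k: "twist_poly q l x - smult (q ^ 4 * x ^ 2) (twist_poly q l (x * q ^ 2)) =
      smult \<kappa> (newton_poly q (x * q ^ 2) (l - 1))"
    using twist_poly_shift[OF x] .
  have "op_poly casimir (newton_poly q (x * q ^ 2) (l - 1)) (f1 w) = f1 ((f1 ^^ (l - 1)) ((e1 ^^ (l - 1)) w))"
    unfolding f1_e1_power[OF assms] by (simp add: op_poly_commute lin casimir_f1)
  also have "\<dots> = (f1 ^^ Suc (l - 1)) ((e1 ^^ (l - 1)) w)" by simp
  also have "\<dots> = 0" using l nilpotent by simp
  finally have "op_poly casimir (twist_poly q l x - smult (q ^ 4 * x ^ 2) (twist_poly q l (x * q ^ 2))) (f1 w) = 0"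
    unfolding k op_poly_smult by simp
  then show ?thesis
    unfolding even_twist_poly[OF fw] even_twist_poly[OF assms] op_poly_diff op_poly_smult
    by (simp add: op_poly_commute lin casimir_f1)
qed

lemma even_twist'_e1:
  assumes "kwt (x * inverse (q ^ 2)) y w"
  shows "even_twist' x (e1 w) = (q ^ 4 * inverse x ^ 2) *\<^sub>C e1 (even_twist' (x * inverse (q ^ 2)) w)"
proof -
  have x: "inverse x \<noteq> 0" using assms by (simp add: kwt_def)
  have ew: "kwt x (y * inverse q) (e1 w)" using kwt_move(1)[OF assms] by (simp add: mult.assoc)
  obtain \<kappa> where k: "twist_poly q l (inverse x) - smult (q ^ 4 * inverse x ^ 2) (twist_poly q l (inverse x * q ^ 2)) =
      smult \<kappa> (newton_poly q (inverse x * q ^ 2) (l - 1))"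
    using twist_poly_shift[OF x] .
  have i: "inverse (x * inverse (q ^ 2)) = inverse x * q ^ 2" by simp
  have "op_poly casimir (newton_poly q (inverse x * q ^ 2) (l - 1)) (e1 w) = e1 ((e1 ^^ (l - 1)) ((f1 ^^ (l - 1)) w))"
    unfolding e1_f1_power[OF assms] i by (simp add: op_poly_commute lin casimir_e1)
  also have "\<dots> = (e1 ^^ Suc (l - 1)) ((f1 ^^ (l - 1)) w)" by simp
  also have "\<dots> = 0" using l nilpotent by simp
  finally have "op_poly casimir (twist_poly q l (inverse x) - smult (q ^ 4 * inverse x ^ 2) (twist_poly q l (inverse x * q ^ 2))) (e1 w) = 0"
    unfolding k op_poly_smult by simp
  then show ?thesis
    unfolding even_twist'_poly[OF ew] even_twist'_poly[OF assms] i op_poly_diff op_poly_smult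
    by (simp add: op_poly_commute lin casimir_e1)
qed

text \<open>
  The combination \<open>f\<^sub>2 f\<^sub>1 - q\<^sup>-\<^sup>1 f\<^sub>1 f\<^sub>2\<close>, where one expects \<open>f\<^sub>3 = f\<^sub>2 f\<^sub>1 - q f\<^sub>1 f\<^sub>2\<close>, absorbs the
  terms created by moving \<open>f\<^sub>3\<close> past the powers of \<open>e\<^sub>1\<close>; similarly for \<open>e\<^sub>3\<close> in the primed version.
\<close>

definition odd_twist :: "complex \<Rightarrow> complex \<Rightarrow> 'v \<Rightarrow> 'v"
  where "odd_twist x y v = v
    + ((q - inverse q) * q ^ 2 * x * y) *\<^sub>C (f2 (f1 (e3 v)) - inverse q *\<^sub>C f1 (f2 (e3 v)))
    + ((q - inverse q) * y) *\<^sub>C f2 (e2 v)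
    - ((q - inverse q) ^ 2 * q ^ 2 * x * y ^ 2) *\<^sub>C f3 (f2 (e3 (e2 v)))"

definition odd_twist' :: "complex \<Rightarrow> complex \<Rightarrow> 'v \<Rightarrow> 'v"
  where "odd_twist' x y v = v
    - ((q - inverse q) * inverse x * inverse y) *\<^sub>C (e1 (e2 (f3 v)) - q *\<^sub>C e2 (e1 (f3 v)))
    - ((q - inverse q) * inverse y) *\<^sub>C e2 (f2 v)
    - ((q - inverse q) ^ 2 * q ^ 2 * inverse x * inverse y ^ 2) *\<^sub>C e3 (e2 (f3 (f2 v)))"

section \<open>Commutation of the odd root vectors and the comparison of the odd parts\<close>

lemmas normal_order = linD e1_f1' e2_f2' e_f odd_square k_e k_f k'_e k'_f

text \<open>All \<open>e\<close> are moved to the right of all \<open>f\<close>. The values of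
  \<open>g\<close> on the resulting words and the reciprocals are independent atoms for
  \<open>algebra\<close>, so the identities defining the reciprocals have to be supplied; the next
  three lemmas work alike.\<close>

lemma e1_f3: "e1 (f3 v) = f3 (e1 v) - q *\<^sub>C f2 (k1 v)"
proof (rule vec_eqI)
  fix g :: "'v \<Rightarrow> complex" assume g: "clinear g"
  have "q * inverse q = 1" by simp
  moreover have "inverse (q - inverse q) * (q - inverse q) = 1" using q_bracket_nonzero by simp
  ultimately show "g (e1 (f3 v)) = g (f3 (e1 v) - q *\<^sub>C f2 (k1 v))"
    unfolding f3_def by (simp only: normal_order clinearD[OF g] scaleC_complex_def) algebra
qed

lemma e3_f1: "e3 (f1 v) = f1 (e3 v) - e2 (k1' v)"
proof (rule vec_eqI)
  fix g :: "'v \<Rightarrow> complex" assume g: "clinear g"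
  have "q * inverse q = 1" by simp
  moreover have "inverse (q - inverse q) * (q - inverse q) = 1" using q_bracket_nonzero by simp
  ultimately show "g (e3 (f1 v)) = g (f1 (e3 v) - e2 (k1' v))"
    unfolding e3_def by (simp only: normal_order clinearD[OF g] scaleC_complex_def) algebra
qed

lemma e2_f3: "e2 (f3 v) = f1 (k2' v) - f3 (e2 v)"
proof (rule vec_eqI)
  fix g :: "'v \<Rightarrow> complex" assume g: "clinear g"
  have "q * inverse q = 1" by simp
  moreover have "inverse (q - inverse q) * (q - inverse q) = 1" using q_bracket_nonzero by simp
  ultimately show "g (e2 (f3 v)) = g (f1 (k2' v) - f3 (e2 v))"
    unfolding f3_def by (simp only: normal_order clinearD[OF g] scaleC_complex_def) algebra
qed

lemma e3_f2: "e3 (f2 v) = inverse q *\<^sub>C e1 (k2 v) - f2 (e3 v)"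
proof (rule vec_eqI)
  fix g :: "'v \<Rightarrow> complex" assume g: "clinear g"
  have "q * inverse q = 1" by simp
  moreover have "inverse (q - inverse q) * (q - inverse q) = 1" using q_bracket_nonzero by simp
  ultimately show "g (e3 (f2 v)) = g (inverse q *\<^sub>C e1 (k2 v) - f2 (e3 v))"
    unfolding e3_def by (simp only: normal_order clinearD[OF g] scaleC_complex_def) algebra
qed

text \<open>The factor can be read off from the longest word \<open>f3 (f2 (e3 (e2 v)))\<close>: in
  normal order its coefficients are \<open>x * y ^ 2\<close> and the inverse of that, times the same
  constant.\<close>

lemma odd_twist_eq:
  assumes v: "kwt x y v"
  shows "odd_twist x y v = (x ^ 2 * y ^ 4) *\<^sub>C odd_twist' x y v"
proof (rule vec_eqI)
  fix g :: "'v \<Rightarrow> complex" assume g: "clinear g"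
  define p where "p = inverse q"
  define X where "X = inverse x"
  define Y where "Y = inverse y"
  define b where "b = q - inverse q"
  define B where "B = inverse (q - inverse q)"
  have k: "k1 v = x *\<^sub>C v" "k2 v = y *\<^sub>C v" "k1' v = X *\<^sub>C v" "k2' v = Y *\<^sub>C v"
    using v kwt_inv[OF v] by (simp_all add: kwt_def X_def Y_def)
  have p2: "inverse (q ^ 2) = p ^ 2" by (simp add: p_def power_inverse)
  have B': "inverse (q - p) = B" by (simp add: B_def p_def)
  note expand = e1_f3 e2_f3 e3_f1 e3_f2 linD lin3[THEN clinearD(1)] lin3[THEN clinearD(2)]
    lin3[THEN clinearD(4)] lin3[THEN clinearD(5)] k_e k_f k'_e k'_f k clinearD[OF g] scaleC_complex_def
    B' p2 p_def [symmetric] X_def [symmetric] Y_def [symmetric]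
  have e3: "e3 u = e1 (e2 u) - p *\<^sub>C e2 (e1 u)" and f3: "f2 (f1 u) = f3 u + q *\<^sub>C f1 (f2 u)" for u
    by (simp_all add: e3_def f3_def p_def)
  have b: "b = q - p" and eqs: "q * p = 1" "x * X = 1" "y * Y = 1" "B * (q - p) = 1"
    using v q_bracket_nonzero by (simp_all add: kwt_def p_def X_def Y_def b_def B_def)
  have 1: "g (odd_twist x y v) = g v
      + b * q ^ 2 * x * y * (g (f3 (e1 (e2 v))) - p * g (f3 (e2 (e1 v)))
        + (q - p) * (g (f1 (f2 (e1 (e2 v)))) - p * g (f1 (f2 (e2 (e1 v))))))
      + b * y * g (f2 (e2 v)) - b ^ 2 * q ^ 2 * x * y ^ 2 * g (f3 (f2 (e3 (e2 v))))"
    unfolding odd_twist_def f3 e3[of v] by (simp only: expand) (algebra | use eqs b in algebra)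
  have 2: "g (e1 (e2 (f3 v)) - q *\<^sub>C e2 (e1 (f3 v))) =
      Y * (g (f1 (e1 v)) + B * (x - X) * g v) - g (f3 (e1 (e2 v))) + x * g (f2 (e2 v))
      - q * (q * Y * g (f1 (e1 v)) - g (f3 (e2 (e1 v)))) + q ^ 2 * x * (B * (y - Y) * g v - g (f2 (e2 v)))"
    by (simp only: expand e1_f1' e2_f2') (algebra | use eqs b in algebra)
  have 3: "g (e2 (f2 v)) = B * (y - Y) * g v - g (f2 (e2 v))"
    by (simp only: expand e2_f2') (algebra | use eqs b in algebra)
  \<comment> \<open>The anticommutator of \<open>e3\<close> and \<open>f3\<close> is the bracket of
    \<open>k1 k2\<close>. It is needed at \<open>v\<close> and at \<open>f2 (e2 v)\<close>, which
    has the same weight.\<close>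
  have e3f3: "e3 (f3 u) = (B * (x * y - X * Y)) *\<^sub>C u - f3 (e3 u)" if "kwt x y u" for u
  proof (rule vec_eqI)
    fix h :: "'v \<Rightarrow> complex" assume h: "clinear h"
    have k: "k1 u = x *\<^sub>C u" "k2 u = y *\<^sub>C u" "k1' u = X *\<^sub>C u" "k2' u = Y *\<^sub>C u"
      using that kwt_inv[OF that] by (simp_all add: kwt_def X_def Y_def)
    show "h (e3 (f3 u)) = h ((B * (x * y - X * Y)) *\<^sub>C u - f3 (e3 u))"
      unfolding e3 by (simp only: expand e1_f1' e2_f2' k clinearD[OF h]) (algebra | use eqs b in algebra)
  qed
  have w: "kwt x y (f2 (e2 v))"
    using kwt_move(4)[OF kwt_move(2)[OF v]] by (simp add: mult.assoc)
  have 4: "e3 (e2 (f3 (f2 v))) = Y *\<^sub>C e3 (f1 (f2 v)) - e3 (f3 (B *\<^sub>C (y *\<^sub>C v - Y *\<^sub>C v) - f2 (e2 v)))"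
    by (simp only: e2_f3 e2_f2' k k'_f linD lin3[THEN clinearD(5)] lin3[THEN clinearD(2)] B_def)
  have 5: "g (e3 (f1 (f2 v))) = p * y * g (f1 (e1 v)) - (g (f1 (f2 (e1 (e2 v)))) - p * g (f1 (f2 (e2 (e1 v)))))
      - p * X * (B * (y - Y) * g v - g (f2 (e2 v)))"
    by (simp only: expand e2_f2' e3[of v]) (algebra | use eqs b in algebra)
  have 6: "g (e3 (f3 (B *\<^sub>C (y *\<^sub>C v - Y *\<^sub>C v) - f2 (e2 v)))) =
      B * (y - Y) * (B * (x * y - X * Y) * g v - (g (f3 (e1 (e2 v))) - p * g (f3 (e2 (e1 v)))))
      - (B * (x * y - X * Y) * g (f2 (e2 v)) - (p * y * g (f3 (e1 (e2 v))) - g (f3 (f2 (e3 (e2 v))))))"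
  proof -
    have e3f2: "e3 (f2 (e2 v)) = (p * y) *\<^sub>C e1 (e2 v) - f2 (e3 (e2 v))"
      by (simp only: e3_f2 k_e k linD p_def scaleC_scaleC)
    show ?thesis
      by (simp only: linD lin3[THEN clinearD(5)] lin3[THEN clinearD(2)] e3f2 e3f3[OF v] e3f3[OF w]
          clinearD[OF g] scaleC_complex_def e3[of v]) (algebra | use eqs b in algebra)
  qed
  have "g ((x ^ 2 * y ^ 4) *\<^sub>C odd_twist' x y v) = x ^ 2 * y ^ 4 * (g v
      - b * X * Y * g (e1 (e2 (f3 v)) - q *\<^sub>C e2 (e1 (f3 v))) - b * Y * g (e2 (f2 v))
      - b ^ 2 * q ^ 2 * X * Y ^ 2 * (Y * g (e3 (f1 (f2 v)))
        - g (e3 (f3 (B *\<^sub>C (y *\<^sub>C v - Y *\<^sub>C v) - f2 (e2 v))))))"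
    unfolding odd_twist'_def 4 clinearD[OF g] scaleC_complex_def b_def X_def Y_def ..
  \<comment> \<open>The word \<open>f1 (e1 v)\<close> does not occur on the left. On the right it
    cancels: the factor \<open>1 - q ^ 2\<close> coming from 2 is opposite to \<open>b * q\<close>
    coming from 5.\<close>
  then show "g (odd_twist x y v) = g ((x ^ 2 * y ^ 4) *\<^sub>C odd_twist' x y v)"
    unfolding 1 2 3 5 6 b using eqs by algebra
qed

text \<open>
  The values of \<open>theta\<close> and \<open>theta'\<close> on a homogeneous weight vector, up to Gaussian and pivotal scalars;
  the super signs do not depend on the parity of the vector.
\<close>

definition theta_sum :: "complex \<Rightarrow> complex \<Rightarrow> 'v \<Rightarrow> 'v"
  where "theta_sum x y v = (\<Sum>i<l. (rcoeff q i * q ^ (2 * i) * x ^ i) *\<^sub>C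
    ((f1 ^^ i) ((e1 ^^ i) v)
     + ((q - inverse q) * q ^ 2 * x * y) *\<^sub>C (f1 ^^ i) (f3 ((e1 ^^ i) (e3 v)))
     + ((q - inverse q) * y) *\<^sub>C (f1 ^^ i) (f2 ((e1 ^^ i) (e2 v)))
     - ((q - inverse q) ^ 2 * q ^ 2 * x * y ^ 2) *\<^sub>C (f1 ^^ i) (f3 (f2 ((e1 ^^ i) (e3 (e2 v)))))))"

definition theta_sum' :: "complex \<Rightarrow> complex \<Rightarrow> 'v \<Rightarrow> 'v"
  where "theta_sum' x y v = (\<Sum>i<l. (rcoeff q i * q ^ (2 * i) * inverse x ^ i) *\<^sub>C
    ((e1 ^^ i) ((f1 ^^ i) v)
     - ((q - inverse q) * q ^ 2 * inverse x * inverse y) *\<^sub>C (e1 ^^ i) (e3 ((f1 ^^ i) (f3 v)))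
     - ((q - inverse q) * inverse y) *\<^sub>C (e1 ^^ i) (e2 ((f1 ^^ i) (f2 v)))
     - ((q - inverse q) ^ 2 * q ^ 2 * inverse x * inverse y ^ 2) *\<^sub>C
        (e1 ^^ i) (e3 (e2 ((f1 ^^ i) (f3 (f2 v)))))))"

section \<open>Moving odd root vectors past powers of \<open>e1\<close> and
  \<open>f1\<close>\<close>

lemma lin_power: "clinear (e1 ^^ i)" "clinear (f1 ^^ i)"
  by (intro clinear_funpow lin)+

lemma lin_even_twist: "clinear (even_twist x)" "clinear (even_twist' x)"
proof -
  note * = lin_power(1)[THEN clinear_compose] lin_power(2)[THEN clinear_compose] lin_power
  show "clinear (even_twist x)" "clinear (even_twist' x)"
    unfolding even_twist_def even_twist'_def
    by (intro clinear_sum clinear_scale * )+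
qed

lemma f2_e1_power: "f2 ((e1 ^^ i) v) = (e1 ^^ i) (f2 v)"
  by (induction i) (simp_all add: e_f [symmetric])

lemma e2_f1_power: "e2 ((f1 ^^ i) v) = (f1 ^^ i) (e2 v)"
  by (induction i) (simp_all add: e_f)

text \<open>By \<open>e1_f3\<close>, each \<open>e1\<close> that \<open>f3\<close> crosses leaves a
  term \<open>q *\<^sub>C f2 (k1 u)\<close>. The \<open>k1\<close> eigenvalues run through
  \<open>x * q ^ (2 * j)\<close>, and \<open>f2\<close> commutes with \<open>e1\<close>, so the
  terms add up to a geometric sum.\<close>

lemma f3_e1_power:
  assumes "kwt x y v"
  shows "f3 ((e1 ^^ i) v) = (e1 ^^ i) (f3 v) + (q * x * (\<Sum>j<i. q ^ (2 * j))) *\<^sub>C (e1 ^^ (i - 1)) (f2 v)"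
  using assms
proof (induction i arbitrary: x y v)
  case 0
  then show ?case by simp
next
  case (Suc i)
  let ?S = "\<Sum>j<i. q ^ (2 * j)"
  have S: "(\<Sum>j<Suc i. q ^ (2 * j)) = 1 + q ^ 2 * ?S"
    unfolding sum.lessThan_Suc_shift by (simp add: sum_distrib_left power_add [symmetric] del: sum.lessThan_Suc)
  have k: "k1 v = x *\<^sub>C v" using Suc.prems by (simp add: kwt_def)
  have shift: "?S *\<^sub>C (e1 ^^ (i - 1)) (f2 (e1 v)) = ?S *\<^sub>C (e1 ^^ i) (f2 v)"
    by (cases i) (simp_all add: e_f [symmetric] funpow_swap1)
  have "f3 ((e1 ^^ Suc i) v) = (e1 ^^ i) (f3 (e1 v)) + (q * (x * q ^ 2) * ?S) *\<^sub>C (e1 ^^ (i - 1)) (f2 (e1 v))"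
    using Suc.IH[OF kwt_move(1)[OF Suc.prems]] by (simp add: funpow_swap1)
  also have "f3 (e1 v) = e1 (f3 v) + (q * x) *\<^sub>C f2 v"
    using e1_f3[of v] by (simp add: k linD scaleC_scaleC)
  also have "(e1 ^^ i) (e1 (f3 v) + (q * x) *\<^sub>C f2 v) = (e1 ^^ Suc i) (f3 v) + (q * x) *\<^sub>C (e1 ^^ i) (f2 v)"
    by (simp add: clinearD[OF lin_power(1)] funpow_swap1)
  also have "(q * (x * q ^ 2) * ?S) *\<^sub>C (e1 ^^ (i - 1)) (f2 (e1 v)) = (q * (x * q ^ 2)) *\<^sub>C (?S *\<^sub>C (e1 ^^ i) (f2 v))"
    unfolding shift [symmetric] by (simp add: scaleC_scaleC)
  finally show ?case
    by (simp only: S scaleC_scaleC diff_Suc_1 distrib_left mult_1_right scaleC_add_left add.assoc mult.assoc)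
qed

lemma e3_f1_power:
  assumes "kwt x y v"
  shows "e3 ((f1 ^^ i) v) = (f1 ^^ i) (e3 v) - (inverse x * (\<Sum>j<i. q ^ (2 * j))) *\<^sub>C (f1 ^^ (i - 1)) (e2 v)"
  using assms
proof (induction i arbitrary: x y v)
  case 0
  then show ?case by simp
next
  case (Suc i)
  let ?S = "\<Sum>j<i. q ^ (2 * j)"
  have S: "(\<Sum>j<Suc i. q ^ (2 * j)) = 1 + q ^ 2 * ?S"
    unfolding sum.lessThan_Suc_shift by (simp add: sum_distrib_left power_add [symmetric] del: sum.lessThan_Suc)
  have shift: "?S *\<^sub>C (f1 ^^ (i - 1)) (e2 (f1 v)) = ?S *\<^sub>C (f1 ^^ i) (e2 v)"
    by (cases i) (simp_all add: e_f funpow_swap1)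
  have "e3 ((f1 ^^ Suc i) v) = (f1 ^^ i) (e3 (f1 v)) - (inverse x * q ^ 2 * ?S) *\<^sub>C (f1 ^^ (i - 1)) (e2 (f1 v))"
    using Suc.IH[OF kwt_move(3)[OF Suc.prems]] by (simp add: funpow_swap1)
  also have "e3 (f1 v) = f1 (e3 v) - inverse x *\<^sub>C e2 v"
    by (simp only: e3_f1 kwt_inv[OF Suc.prems] linD)
  also have "(f1 ^^ i) (f1 (e3 v) - inverse x *\<^sub>C e2 v) = (f1 ^^ Suc i) (e3 v) - inverse x *\<^sub>C (f1 ^^ i) (e2 v)"
    by (simp add: clinearD[OF lin_power(2)] funpow_swap1)
  also have "(inverse x * q ^ 2 * ?S) *\<^sub>C (f1 ^^ (i - 1)) (e2 (f1 v)) = (inverse x * q ^ 2) *\<^sub>C (?S *\<^sub>C (f1 ^^ i) (e2 v))"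
    unfolding shift [symmetric] by (simp add: scaleC_scaleC)
  finally show ?case
    by (simp only: S scaleC_scaleC diff_Suc_1 distrib_left mult_1_right scaleC_add_left diff_diff_eq mult.assoc)
qed

text \<open>The geometric sum is \<open>q ^ (2 * i)\<close> times the q-integer in
  \<open>inverse (q ^ 2)\<close> by which the q-factorial grows from \<open>i\<close> to
  \<open>Suc i\<close>, so it cancels that denominator.\<close>

lemma rcoeff_geometric:
  assumes "Suc i < l"
  shows "rcoeff q (Suc i) * (\<Sum>j<Suc i. q ^ (2 * j)) = rcoeff q i * (q - inverse q) * q ^ (2 * i)"
proof -
  let ?Q = "q ^ (2 * Suc i)"
  have Q: "1 - inverse ?Q \<noteq> 0"
    using q_even_power[of "Suc i"] assms nat_dvd_not_less[of "Suc i" l]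
    by (metis inverse_eq_1_iff right_minus_eq zero_less_Suc)
  have "(1 - q ^ 2) * (\<Sum>j<Suc i. (q ^ 2) ^ j) = 1 - (q ^ 2) ^ Suc i"
    by (rule one_diff_power_eq [symmetric])
  then have g: "(1 - q ^ 2) * (\<Sum>j<Suc i. q ^ (2 * j)) = 1 - ?Q"
    by (simp only: power_mult)
  have q2: "1 - q ^ 2 = - q * (q - inverse q)"
    by (simp add: power2_eq_square right_diff_distrib)
  have "1 - ?Q = - ?Q * (1 - inverse ?Q)"
    by (simp add: right_diff_distrib del: mult_Suc_right power_Suc)
  then have "q * (q - inverse q) * (\<Sum>j<Suc i. q ^ (2 * j)) = ?Q * (1 - inverse ?Q)"
    using g unfolding q2 by (simp only: mult_minus_left neg_equal_iff_equal)
  then have "q * (q - inverse q) * (rcoeff q (Suc i) * (\<Sum>j<Suc i. q ^ (2 * j))) =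
      ?Q * (rcoeff q (Suc i) * (1 - inverse ?Q))"
    by (metis mult.left_commute)
  also have "\<dots> = ?Q * (rcoeff q i * (q - inverse q) ^ 2 * inverse q)"
    unfolding rcoeff_Suc[OF assms] ..
  also have "\<dots> = q * (q - inverse q) * (rcoeff q i * (q - inverse q) * q ^ (2 * i))"
    by (simp add: power2_eq_square)
  finally show ?thesis
    using q_bracket_nonzero by (simp only: mult_cancel_left) auto
qed

text \<open>
  At \<open>i = 0\<close> the exponent \<open>i - 1\<close> is truncated, but the geometric sum vanishes; the shifted sum lacks its
  last term, which is zero by nilpotency.
\<close>

lemma geometric_sum_f1:
  "(\<Sum>i<l. (rcoeff q i * q ^ (2 * i) * x ^ i * (\<Sum>j<i. q ^ (2 * j))) *\<^sub>C (f1 ^^ i) ((e1 ^^ (i - 1)) w))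
    = ((q - inverse q) * q ^ 2 * x) *\<^sub>C f1 (even_twist (x * q ^ 2) w)"
proof -
  obtain n where n: "l = Suc n" using l by (cases l) auto
  have "f1 ((f1 ^^ n) ((e1 ^^ n) w)) = 0"
    using nilpotent(2)[of "(e1 ^^ n) w"] unfolding n by simp
  then have "f1 (even_twist (x * q ^ 2) w) =
      (\<Sum>i<n. (rcoeff q i * q ^ (2 * i) * (x * q ^ 2) ^ i) *\<^sub>C f1 ((f1 ^^ i) ((e1 ^^ i) w)))"
    unfolding even_twist_def unfolding n by (simp add: clinearD[OF lin(3)])
  moreover have "(rcoeff q (Suc i) * q ^ (2 * Suc i) * x ^ Suc i * (\<Sum>j<Suc i. q ^ (2 * j))) =
      (q - inverse q) * q ^ 2 * x * (rcoeff q i * q ^ (2 * i) * (x * q ^ 2) ^ i)" if "i < n" for i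
  proof -
    have Q: "q ^ (2 * Suc i) = q ^ 2 * q ^ (2 * i)" by (simp only: mult_Suc_right power_add)
    have "rcoeff q (Suc i) * q ^ (2 * Suc i) * x ^ Suc i * (\<Sum>j<Suc i. q ^ (2 * j)) =
        q ^ (2 * Suc i) * x ^ Suc i * (rcoeff q (Suc i) * (\<Sum>j<Suc i. q ^ (2 * j)))"
      by (simp only: mult_ac)
    also have "\<dots> = q ^ (2 * Suc i) * x ^ Suc i * (rcoeff q i * (q - inverse q) * q ^ (2 * i))"
      using rcoeff_geometric[of i] that n by (simp only: Suc_less_eq)
    also have "\<dots> = (q - inverse q) * q ^ 2 * x * (rcoeff q i * q ^ (2 * i) * (x ^ i * q ^ (2 * i)))"
      unfolding Q by (simp only: power_Suc mult_ac)
    also have "x ^ i * q ^ (2 * i) = (x * q ^ 2) ^ i"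
      by (simp only: power_mult_distrib power_mult)
    finally show ?thesis .
  qed
  ultimately show ?thesis
    unfolding n sum.lessThan_Suc_shift
    by (simp add: cvs.scale_sum_right scaleC_scaleC del: sum.lessThan_Suc power_Suc mult_Suc_right)
qed

lemma geometric_sum_e1:
  "(\<Sum>i<l. (rcoeff q i * q ^ (2 * i) * inverse x ^ i * (\<Sum>j<i. q ^ (2 * j))) *\<^sub>C (e1 ^^ i) ((f1 ^^ (i - 1)) w))
    = ((q - inverse q) * q ^ 2 * inverse x) *\<^sub>C e1 (even_twist' (x * inverse (q ^ 2)) w)"
proof -
  obtain n where n: "l = Suc n" using l by (cases l) auto
  have i: "inverse (x * inverse (q ^ 2)) = inverse x * q ^ 2" by simp
  have "e1 ((e1 ^^ n) ((f1 ^^ n) w)) = 0"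
    using nilpotent(1)[of "(f1 ^^ n) w"] unfolding n by simp
  then have "e1 (even_twist' (x * inverse (q ^ 2)) w) =
      (\<Sum>i<n. (rcoeff q i * q ^ (2 * i) * (inverse x * q ^ 2) ^ i) *\<^sub>C e1 ((e1 ^^ i) ((f1 ^^ i) w)))"
    unfolding even_twist'_def i unfolding n by (simp add: clinearD[OF lin(1)])
  moreover have "(rcoeff q (Suc i) * q ^ (2 * Suc i) * inverse x ^ Suc i * (\<Sum>j<Suc i. q ^ (2 * j))) =
      (q - inverse q) * q ^ 2 * inverse x * (rcoeff q i * q ^ (2 * i) * (inverse x * q ^ 2) ^ i)" if "i < n" for i
  proof -
    have Q: "q ^ (2 * Suc i) = q ^ 2 * q ^ (2 * i)" by (simp only: mult_Suc_right power_add)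
    have "rcoeff q (Suc i) * q ^ (2 * Suc i) * inverse x ^ Suc i * (\<Sum>j<Suc i. q ^ (2 * j)) =
        q ^ (2 * Suc i) * inverse x ^ Suc i * (rcoeff q (Suc i) * (\<Sum>j<Suc i. q ^ (2 * j)))"
      by (simp only: mult_ac)
    also have "\<dots> = q ^ (2 * Suc i) * inverse x ^ Suc i * (rcoeff q i * (q - inverse q) * q ^ (2 * i))"
      using rcoeff_geometric[of i] that n by (simp only: Suc_less_eq)
    also have "\<dots> = (q - inverse q) * q ^ 2 * inverse x * (rcoeff q i * q ^ (2 * i) * (inverse x ^ i * q ^ (2 * i)))"
      unfolding Q by (simp only: power_Suc mult_ac)
    also have "inverse x ^ i * q ^ (2 * i) = (inverse x * q ^ 2) ^ i"
      by (simp only: power_mult_distrib power_mult)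
    finally show ?thesis .
  qed
  ultimately show ?thesis
    unfolding n sum.lessThan_Suc_shift
    by (simp add: cvs.scale_sum_right scaleC_scaleC del: sum.lessThan_Suc power_Suc mult_Suc_right)
qed

text \<open>The extra terms from moving \<open>f3\<close> sum to a multiple of
  \<open>f1 (even_twist (x * q ^ 2) ?w)\<close>, which \<open>even_twist_f1\<close> turns into
  \<open>even_twist x (f1 ?w)\<close>. In the odd part this changes the coefficient
  \<open>- q\<close> of \<open>f1 (f2 (e3 v))\<close> inside \<open>f3 (e3 v)\<close> to
  \<open>- q + (q - inverse q)\<close>, as in \<open>odd_twist\<close>.\<close>

lemma theta_sum_factor:
  assumes v: "kwt x y v"
  shows "theta_sum x y v = even_twist x (odd_twist x y v)"
proof -
  let ?b = "q - inverse q" and ?w = "f2 (e3 v)"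
  let ?c = "\<lambda>i. rcoeff q i * q ^ (2 * i) * x ^ i" and ?g = "\<lambda>i. \<Sum>j<i. q ^ (2 * j)"
  let ?T = "even_twist x"
  have f3e: "f3 ((e1 ^^ i) (e3 v)) = (e1 ^^ i) (f3 (e3 v)) + (q ^ 2 * x * ?g i) *\<^sub>C (e1 ^^ (i - 1)) ?w" for i
    using f3_e1_power[OF kwt_move(5)[OF v], of i] by (simp add: power2_eq_square mult_ac)
  \<comment> \<open>Here no extra term survives: it would contain \<open>f2 (f2 u)\<close>.\<close>
  have f3f2: "f3 ((e1 ^^ i) (f2 u)) = (e1 ^^ i) (f3 (f2 u))" if "kwt x' y' u" for i u x' y'
    using f3_e1_power[OF kwt_move(4)[OF that]]
    by (simp add: odd_square clinearD[OF lin_power(1)])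
  have "theta_sum x y v = (\<Sum>i<l. ?c i *\<^sub>C (f1 ^^ i) ((e1 ^^ i) (v
      + (?b * q ^ 2 * x * y) *\<^sub>C f3 (e3 v) + (?b * y) *\<^sub>C f2 (e2 v)
      - (?b ^ 2 * q ^ 2 * x * y ^ 2) *\<^sub>C f3 (f2 (e3 (e2 v)))))
      + (?b * q ^ 2 * x * y * (q ^ 2 * x)) *\<^sub>C (?c i * ?g i) *\<^sub>C (f1 ^^ i) ((e1 ^^ (i - 1)) ?w))"
    unfolding theta_sum_def f3e f3f2[OF kwt_move(5)[OF kwt_move(2)[OF v]]] f2_e1_power
  proof (rule sum.cong[OF refl], rule vec_eqI, goal_cases)
    case (1 i g)
    show ?case
      by (simp only: clinearD[OF lin_power(1)] clinearD[OF lin_power(2)] clinearD[OF 1(2)]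
          scaleC_complex_def algebra_simps)
  qed
  also have "\<dots> = ?T (v + (?b * q ^ 2 * x * y) *\<^sub>C f3 (e3 v) + (?b * y) *\<^sub>C f2 (e2 v)
      - (?b ^ 2 * q ^ 2 * x * y ^ 2) *\<^sub>C f3 (f2 (e3 (e2 v))))
      + (?b * q ^ 2 * x * y * (q ^ 2 * x)) *\<^sub>C (?b * q ^ 2 * x) *\<^sub>C f1 (even_twist (x * q ^ 2) ?w)"
    unfolding sum.distrib cvs.scale_sum_right [symmetric] geometric_sum_f1 even_twist_def[of x] ..
  also have "(?b * q ^ 2 * x * y * (q ^ 2 * x)) *\<^sub>C (?b * q ^ 2 * x) *\<^sub>C f1 (even_twist (x * q ^ 2) ?w) =
      (?b ^ 2 * q ^ 2 * x * y) *\<^sub>C ?T (f1 ?w)"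
  proof -
    have "kwt (x * q ^ 2) (y * inverse q) ?w"
      using kwt_move(4)[OF kwt_move(5)[OF v]] by (simp add: power2_eq_square mult.assoc)
    from even_twist_f1[OF this] show ?thesis
      by (simp add: scaleC_scaleC power2_eq_square power4_eq_xxxx mult_ac)
  qed
  also have "?T (v + (?b * q ^ 2 * x * y) *\<^sub>C f3 (e3 v) + (?b * y) *\<^sub>C f2 (e2 v)
      - (?b ^ 2 * q ^ 2 * x * y ^ 2) *\<^sub>C f3 (f2 (e3 (e2 v)))) + (?b ^ 2 * q ^ 2 * x * y) *\<^sub>C ?T (f1 ?w)
      = ?T (v + (?b * q ^ 2 * x * y) *\<^sub>C f3 (e3 v) + (?b * y) *\<^sub>C f2 (e2 v)
      - (?b ^ 2 * q ^ 2 * x * y ^ 2) *\<^sub>C f3 (f2 (e3 (e2 v))) + (?b ^ 2 * q ^ 2 * x * y) *\<^sub>C f1 ?w)"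
    by (simp only: clinearD[OF lin_even_twist(1)])
  also have "\<dots> = ?T (odd_twist x y v)"
  proof (rule arg_cong[where f = ?T], rule vec_eqI)
    fix g :: "'v \<Rightarrow> complex" assume g: "clinear g"
    have "q * inverse q = 1" by simp
    moreover define p where "p = inverse q"
    ultimately have p: "q * p = 1" by simp
    show "g (v + (?b * q ^ 2 * x * y) *\<^sub>C f3 (e3 v) + (?b * y) *\<^sub>C f2 (e2 v)
      - (?b ^ 2 * q ^ 2 * x * y ^ 2) *\<^sub>C f3 (f2 (e3 (e2 v))) + (?b ^ 2 * q ^ 2 * x * y) *\<^sub>C f1 ?w) =
      g (odd_twist x y v)"
      unfolding odd_twist_def f3_def[of "e3 v"] p_def [symmetric]
      by (simp only: clinearD[OF g] scaleC_complex_def) (algebra | use p in algebra)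
  qed
  finally show ?thesis .
qed

text \<open>The mirror image of \<open>theta_sum_factor\<close>. In \<open>q ^ 2\<close> times
  \<open>e3 (f3 v)\<close>, the coefficient of \<open>e1 (e2 (f3 v))\<close> drops from
  \<open>q ^ 2\<close> to \<open>q ^ 2 - (q - inverse q) * q = 1\<close>, while that of
  \<open>e2 (e1 (f3 v))\<close> stays \<open>- q\<close>.\<close>

lemma theta_sum'_factor:
  assumes v: "kwt x y v"
  shows "theta_sum' x y v = even_twist' x (odd_twist' x y v)"
proof -
  let ?b = "q - inverse q" and ?w = "e2 (f3 v)"
  let ?c = "\<lambda>i. rcoeff q i * q ^ (2 * i) * inverse x ^ i" and ?g = "\<lambda>i. \<Sum>j<i. q ^ (2 * j)"
  let ?T = "even_twist' x" and ?X = "inverse x" and ?Y = "inverse y"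
  have e3f: "e3 ((f1 ^^ i) (f3 v)) = (f1 ^^ i) (e3 (f3 v)) - (q * ?X * ?g i) *\<^sub>C (f1 ^^ (i - 1)) ?w" for i
    using e3_f1_power[OF kwt_move(6)[OF v], of i] by (simp add: mult_ac)
  have e3e2: "e3 ((f1 ^^ i) (e2 u)) = (f1 ^^ i) (e3 (e2 u))" if "kwt x' y' u" for i u x' y'
    using e3_f1_power[OF kwt_move(2)[OF that]]
    by (simp add: odd_square clinearD[OF lin_power(2)])
  have "theta_sum' x y v = (\<Sum>i<l. ?c i *\<^sub>C (e1 ^^ i) ((f1 ^^ i) (v
      - (?b * q ^ 2 * ?X * ?Y) *\<^sub>C e3 (f3 v) - (?b * ?Y) *\<^sub>C e2 (f2 v)
      - (?b ^ 2 * q ^ 2 * ?X * ?Y ^ 2) *\<^sub>C e3 (e2 (f3 (f2 v)))))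
      + (?b * q ^ 2 * ?X * ?Y * (q * ?X)) *\<^sub>C (?c i * ?g i) *\<^sub>C (e1 ^^ i) ((f1 ^^ (i - 1)) ?w))"
    unfolding theta_sum'_def e3f e3e2[OF kwt_move(6)[OF kwt_move(4)[OF v]]] e2_f1_power
  proof (rule sum.cong[OF refl], rule vec_eqI, goal_cases)
    case (1 i g)
    show ?case
      by (simp only: clinearD[OF lin_power(1)] clinearD[OF lin_power(2)] clinearD[OF 1(2)]
          scaleC_complex_def algebra_simps)
  qed
  also have "\<dots> = ?T (v - (?b * q ^ 2 * ?X * ?Y) *\<^sub>C e3 (f3 v) - (?b * ?Y) *\<^sub>C e2 (f2 v)
      - (?b ^ 2 * q ^ 2 * ?X * ?Y ^ 2) *\<^sub>C e3 (e2 (f3 (f2 v))))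
      + (?b * q ^ 2 * ?X * ?Y * (q * ?X)) *\<^sub>C (?b * q ^ 2 * ?X) *\<^sub>C e1 (even_twist' (x * inverse (q ^ 2)) ?w)"
    unfolding sum.distrib cvs.scale_sum_right [symmetric] geometric_sum_e1 even_twist'_def[of x] ..
  also have "(?b * q ^ 2 * ?X * ?Y * (q * ?X)) *\<^sub>C (?b * q ^ 2 * ?X) *\<^sub>C e1 (even_twist' (x * inverse (q ^ 2)) ?w) =
      (?b ^ 2 * q * ?X * ?Y) *\<^sub>C ?T (e1 ?w)"
  proof -
    have "kwt (x * inverse (q ^ 2)) (y * q) ?w"
      using kwt_move(2)[OF kwt_move(6)[OF v]] by (simp add: power2_eq_square mult.assoc)
    from even_twist'_e1[OF this] show ?thesis
      by (simp add: scaleC_scaleC power2_eq_square power4_eq_xxxx mult_ac)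
  qed
  also have "?T (v - (?b * q ^ 2 * ?X * ?Y) *\<^sub>C e3 (f3 v) - (?b * ?Y) *\<^sub>C e2 (f2 v)
      - (?b ^ 2 * q ^ 2 * ?X * ?Y ^ 2) *\<^sub>C e3 (e2 (f3 (f2 v)))) + (?b ^ 2 * q * ?X * ?Y) *\<^sub>C ?T (e1 ?w)
      = ?T (v - (?b * q ^ 2 * ?X * ?Y) *\<^sub>C e3 (f3 v) - (?b * ?Y) *\<^sub>C e2 (f2 v)
      - (?b ^ 2 * q ^ 2 * ?X * ?Y ^ 2) *\<^sub>C e3 (e2 (f3 (f2 v))) + (?b ^ 2 * q * ?X * ?Y) *\<^sub>C e1 ?w)"
    by (simp only: clinearD[OF lin_even_twist(2)])
  also have "\<dots> = ?T (odd_twist' x y v)"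
  proof (rule arg_cong[where f = ?T], rule vec_eqI)
    fix g :: "'v \<Rightarrow> complex" assume g: "clinear g"
    have "q * inverse q = 1" by simp
    moreover define p where "p = inverse q"
    ultimately have p: "q * p = 1" by simp
    show "g (v - (?b * q ^ 2 * ?X * ?Y) *\<^sub>C e3 (f3 v) - (?b * ?Y) *\<^sub>C e2 (f2 v)
      - (?b ^ 2 * q ^ 2 * ?X * ?Y ^ 2) *\<^sub>C e3 (e2 (f3 (f2 v))) + (?b ^ 2 * q * ?X * ?Y) *\<^sub>C e1 ?w) =
      g (odd_twist' x y v)"
      unfolding odd_twist'_def e3_def[of "f3 v"] p_def [symmetric]
      by (simp only: clinearD[OF g] scaleC_complex_def) (algebra | use p in algebra)
  qed
  finally show ?thesis .
qed

lemma theta_sum_eq: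
  assumes v: "kwt x y v"
  shows "theta_sum x y v = (x ^ (2 * l) * y ^ 4) *\<^sub>C theta_sum' x y v"
proof -
  have q: "inverse q * q ^ 2 = q" "q ^ 2 * inverse q = q" by (simp_all add: power2_eq_square)
  have "kwt x y (e1 (e2 (f3 v)))" "kwt x y (e2 (e1 (f3 v)))" "kwt x y (e2 (f2 v))"
      "kwt x y (e3 (e2 (f3 (f2 v))))"
    using kwt_move(1)[OF kwt_move(2)[OF kwt_move(6)[OF v]]]
      kwt_move(2)[OF kwt_move(1)[OF kwt_move(6)[OF v]]] kwt_move(2)[OF kwt_move(4)[OF v]]
      kwt_move(5)[OF kwt_move(2)[OF kwt_move(6)[OF kwt_move(4)[OF v]]]]
    by (simp_all add: mult.assoc q)
  \<comment> \<open>The odd part preserves the weight, so \<open>even_twist_eq\<close> applies to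
    its value with the same \<open>x\<close>.\<close>
  then have fix_weight: "kwt x y (odd_twist' x y v)"
    unfolding odd_twist'_def by (intro kwt_diff_scale v)
  have "theta_sum x y v = (x ^ 2 * y ^ 4) *\<^sub>C even_twist x (odd_twist' x y v)"
    unfolding theta_sum_factor[OF v] odd_twist_eq[OF v] by (rule clinearD[OF lin_even_twist(1)])
  also have "\<dots> = (x ^ 2 * y ^ 4 * x ^ (2 * (l - 1))) *\<^sub>C theta_sum' x y v"
    unfolding even_twist_eq[OF fix_weight] theta_sum'_factor[OF v] scaleC_scaleC ..
  also have "x ^ 2 * y ^ 4 * x ^ (2 * (l - 1)) = x ^ (2 + 2 * (l - 1)) * y ^ 4"
    by (simp only: power_add mult_ac)
  also have "2 + 2 * (l - 1) = 2 * l" using l by simp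
  finally show ?thesis .
qed

end

section \<open>Tensor products of super vector spaces\<close>

text \<open>\<open>tensor_lift\<close> sums over a chosen representative of \<open>t\<close>, the
  same one in all three terms. The lemma makes nested lifts linear in the outer parameter.\<close>

lemma tensor_lift_add: "tensor_lift (\<lambda>v w. f v w + g v w) t = tensor_lift f t + tensor_lift g t"
proof -
  have "(\<Sum>(v, w)\<leftarrow>xs. f v w + g v w) = (\<Sum>(v, w)\<leftarrow>xs. f v w) + (\<Sum>(v, w)\<leftarrow>xs. g v w)" for xs
    by (induction xs) (auto simp: algebra_simps)
  then show ?thesis by (simp add: tensor_lift_def)
qed

lemma tensor_lift_scale: "tensor_lift (\<lambda>v w. c *\<^sub>C f v w) t = c *\<^sub>C tensor_lift f t"
proof -
  have "(\<Sum>(v, w)\<leftarrow>xs. c *\<^sub>C f v w) = c *\<^sub>C (\<Sum>(v, w)\<leftarrow>xs. f v w)" for xs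
    by (induction xs) (auto simp: scaleC_add_right)
  then show ?thesis by (simp add: tensor_lift_def)
qed

lemma tensor_map_pure:
  "clinear f \<Longrightarrow> clinear g \<Longrightarrow> tensor_map f g (v \<otimes>\<^sub>C w) = f v \<otimes>\<^sub>C g w"
  unfolding tensor_map_def by (rule tensor_lift_pure) (rule cbilinear_tensor)

lemma clinear_tensor_map: "clinear f \<Longrightarrow> clinear g \<Longrightarrow> clinear (tensor_map f g)"
  unfolding tensor_map_def by (rule clinear_tensor_lift) (rule cbilinear_tensor)

lemma tensor_add_left: "(u + v) \<otimes>\<^sub>C w = u \<otimes>\<^sub>C w + v \<otimes>\<^sub>C w"
  and tensor_scale_left: "(c *\<^sub>C v) \<otimes>\<^sub>C w = c *\<^sub>C (v \<otimes>\<^sub>C w)"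
  and tensor_add_right: "v \<otimes>\<^sub>C (w + z) = v \<otimes>\<^sub>C w + v \<otimes>\<^sub>C z"
  and tensor_scale_right: "v \<otimes>\<^sub>C (c *\<^sub>C w) = c *\<^sub>C (v \<otimes>\<^sub>C w)"
  using cbilinear_pure_tensor unfolding cbilinear_iff by blast+

lemma tensor_minus_left: "(- v) \<otimes>\<^sub>C w = - (v \<otimes>\<^sub>C w)"
  by (rule clinearD(4)[OF clinear_tensor_left])

lemma assoc_right_pure: "assoc_right ((u \<otimes>\<^sub>C v) \<otimes>\<^sub>C w) = u \<otimes>\<^sub>C (v \<otimes>\<^sub>C w)"
  and clinear_assoc_right: "clinear assoc_right"
proof -
  have inner: "cbilinear (\<lambda>u v. u \<otimes>\<^sub>C (v \<otimes>\<^sub>C w))" for w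
    by (rule cbilinear_tensor[OF clinear_id(1) clinear_tensor_left])
  have outer: "cbilinear (\<lambda>s w. tensor_lift (\<lambda>u v. u \<otimes>\<^sub>C (v \<otimes>\<^sub>C w)) s)"
    by (intro cbilinearI clinear_tensor_lift inner clinearI)
      (simp_all add: tensor_add_right tensor_scale_right tensor_lift_add tensor_lift_scale)
  show "assoc_right ((u \<otimes>\<^sub>C v) \<otimes>\<^sub>C w) = u \<otimes>\<^sub>C (v \<otimes>\<^sub>C w)"
    unfolding assoc_right_def by (simp add: tensor_lift_pure[OF outer] tensor_lift_pure[OF inner])
  show "clinear assoc_right"
    unfolding assoc_right_def by (rule clinear_tensor_lift[OF outer])
qed

lemma assoc_left_pure: "assoc_left (u \<otimes>\<^sub>C (v \<otimes>\<^sub>C w)) = (u \<otimes>\<^sub>C v) \<otimes>\<^sub>C w"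
  and clinear_assoc_left: "clinear assoc_left"
proof -
  have inner: "cbilinear (\<lambda>v w. (u \<otimes>\<^sub>C v) \<otimes>\<^sub>C w)" for u
    by (rule cbilinear_tensor[OF clinear_tensor_right clinear_id(1)])
  have outer: "cbilinear (\<lambda>u t. tensor_lift (\<lambda>v w. (u \<otimes>\<^sub>C v) \<otimes>\<^sub>C w) t)"
    by (intro cbilinearI clinear_tensor_lift inner clinearI)
      (simp_all add: tensor_add_left tensor_scale_left tensor_lift_add tensor_lift_scale)
  show "assoc_left (u \<otimes>\<^sub>C (v \<otimes>\<^sub>C w)) = (u \<otimes>\<^sub>C v) \<otimes>\<^sub>C w"
    unfolding assoc_left_def by (simp add: tensor_lift_pure[OF outer] tensor_lift_pure[OF inner])
  show "clinear assoc_left"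
    unfolding assoc_left_def by (rule clinear_tensor_lift[OF outer])
qed

lemma unit_right_pure: "unit_right (v \<otimes>\<^sub>C c) = c *\<^sub>C v"
  and clinear_unit_right: "clinear unit_right"
proof -
  have b: "cbilinear (\<lambda>v c. c *\<^sub>C v)"
    by (intro cbilinearI clinearI)
      (simp_all add: scaleC_add_right scaleC_add_left scaleC_scaleC scaleC_complex_def mult.commute)
  show "unit_right (v \<otimes>\<^sub>C c) = c *\<^sub>C v" "clinear unit_right"
    unfolding unit_right_def using tensor_lift_pure[OF b] clinear_tensor_lift[OF b] by auto
qed

lemma unit_left_pure: "unit_left (c \<otimes>\<^sub>C v) = c *\<^sub>C v"
  and clinear_unit_left: "clinear unit_left"
proof -
  have b: "cbilinear (\<lambda>c v. c *\<^sub>C v)"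
    by (intro cbilinearI clinearI)
      (simp_all add: scaleC_add_right scaleC_add_left scaleC_scaleC scaleC_complex_def mult.commute)
  show "unit_left (c \<otimes>\<^sub>C v) = c *\<^sub>C v" "clinear unit_left"
    unfolding unit_left_def using tensor_lift_pure[OF b] clinear_tensor_lift[OF b] by auto
qed

lemma clinear_dual_app: "clinear (dual_app \<phi>)"
  using dual_app by blast

lemma dual_app_add: "dual_app (\<phi> + \<psi>) v = dual_app \<phi> v + dual_app \<psi> v"
  and dual_app_scale: "dual_app (c *\<^sub>C \<phi>) v = c *\<^sub>C dual_app \<phi> v"
  by (transfer, simp)+

lemma cbilinear_dual_app: "cbilinear dual_app"
  by (intro cbilinearI clinear_dual_app clinearI) (simp_all add: dual_app_add dual_app_scale)

lemma cbilinear_dual_app_flip: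
  assumes "clinear f"
  shows "cbilinear (\<lambda>v \<phi>. dual_app \<phi> (f v))"
  by (intro cbilinearI clinear_compose[OF clinear_dual_app assms] clinearI)
    (simp_all add: dual_app_add dual_app_scale)

lemma ev_right_pure: "ev_right (\<phi> \<otimes>\<^sub>C v) = dual_app \<phi> v"
  and clinear_ev_right: "clinear ev_right"
  unfolding ev_right_def
  by (rule tensor_lift_pure[OF cbilinear_dual_app] clinear_tensor_lift[OF cbilinear_dual_app])+

text \<open>The completeness relation of dual bases. It collapses the basis sums introduced by the
  coevaluations.\<close>

lemma basis_expansion:
  assumes B: "finite B" "cvs.independent B" "cvs.span B = UNIV" and G: "clinear G"
  shows "(\<Sum>b\<in>B. dual_app (dual_vec B b) w *\<^sub>C G b) = G w"
proof -
  have "clinear (\<lambda>v. cvs.representation B v b)" for b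
    using cvs.representation_add[OF B(2)] cvs.representation_scale[OF B(2)] B(3)
    by (simp add: clinear_iff scaleC_complex_def)
  then have "dual_app (dual_vec B b) w = cvs.representation B w b" for b
    unfolding dual_vec_def by (subst Abs_dual_inverse) auto
  moreover have "(\<Sum>b\<in>B. cvs.representation B w b *\<^sub>C b) = w"
    using cvs.sum_representation_eq[OF B(2), of w B] B by simp
  ultimately show ?thesis
    by (metis (no_types, lifting) clinearD(2,6)[OF G] sum.cong)
qed

section \<open>Homogeneous components, parity and super signs\<close>

locale super_vector_space =
  fixes V :: "('v::complex_vec) uh_module"
  assumes super_space: "super_space V"
begin

lemma grade_subspace: "p \<in> {0, 1} \<Longrightarrow> cvs.subspace (grade V p)"
  using super_space by (auto simp: super_space_def)

text \<open>On the degrees \<open>0\<close> and \<open>1\<close>, the natural number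
  \<open>1 - p\<close> is the opposite parity.\<close>

lemma component_eqI:
  assumes p: "p \<in> {0, 1}" and x: "x \<in> grade V p" "v - x \<in> grade V (1 - p)"
  shows "component V p v = x"
  unfolding component_def
proof (rule the_equality)
  show "x \<in> grade V p \<and> v - x \<in> grade V (1 - p)" using x by simp
next
  fix y assume y: "y \<in> grade V p \<and> v - y \<in> grade V (1 - p)"
  have p': "1 - p \<in> {0, 1}" using p by auto
  have "x - y \<in> grade V p" using x y cvs.subspace_diff[OF grade_subspace[OF p]] by blast
  moreover have "(v - y) - (v - x) \<in> grade V (1 - p)"
    using x y cvs.subspace_diff[OF grade_subspace[OF p']] by blast
  ultimately have "x - y \<in> grade V 0 \<inter> grade V 1" using p by auto
  moreover have "grade V 0 \<inter> grade V 1 = {0}" using super_space unfolding super_space_def by blast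
  ultimately have "x - y \<in> {0}" by (simp only:)
  then show "y = x" by simp
qed

lemma component_decomposition:
  shows "component V 0 v \<in> grade V 0" "component V 1 v \<in> grade V 1"
    "component V 0 v + component V 1 v = v"
proof -
  obtain x y where xy: "x \<in> grade V 0" "y \<in> grade V 1" "v = x + y"
    using super_space unfolding super_space_def by metis
  have "component V 0 v = x" "component V 1 v = y"
    using xy by (auto intro!: component_eqI)
  then show "component V 0 v \<in> grade V 0" "component V 1 v \<in> grade V 1"
    "component V 0 v + component V 1 v = v" using xy by auto
qed

lemma component_homogeneous:
  assumes "v \<in> grade V p" "p \<in> {0, 1}" "r \<in> {0, 1}"
  shows "component V r v = (if r = p then v else 0)"
proof -
  have z: "0 \<in> grade V s" if "s \<in> {0, 1}" for s
    using cvs.subspace_0[OF grade_subspace[OF that]] .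
  show ?thesis
  proof (cases "r = p")
    case True
    then show ?thesis using assms z[of "1 - r"] by (auto intro!: component_eqI)
  next
    case False
    then have "1 - r = p" using assms by auto
    then show ?thesis using False assms z[of r] by (auto intro!: component_eqI)
  qed
qed

lemma clinear_component:
  assumes p: "p \<in> {0, 1}"
  shows "clinear (component V p)"
proof -
  have p': "1 - p \<in> {0, 1}" using p by auto
  have *: "component V p v \<in> grade V p \<and> v - component V p v \<in> grade V (1 - p)" for v
  proof -
    have "v - component V 0 v = component V 1 v" "v - component V 1 v = component V 0 v"
      using component_decomposition(3)[of v] by (metis add_diff_cancel_left' add_diff_cancel_right')+
    then show ?thesis using component_decomposition(1,2)[of v] p by auto
  qed
  note S = grade_subspace[OF p] grade_subspace[OF p']
  show ?thesis
  proof (rule clinearI)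
    fix v w
    have "v + w - (component V p v + component V p w) = (v - component V p v) + (w - component V p w)"
      by simp
    then show "component V p (v + w) = component V p v + component V p w"
      using * by (intro component_eqI p) (simp_all only: cvs.subspace_add[OF S(1)] cvs.subspace_add[OF S(2)])
  next
    fix c v
    have "c *\<^sub>C v - c *\<^sub>C component V p v = c *\<^sub>C (v - component V p v)"
      by (simp add: cvs.scale_right_diff_distrib)
    then show "component V p (c *\<^sub>C v) = c *\<^sub>C component V p v"
      using * by (intro component_eqI p) (simp_all only: cvs.subspace_scale[OF S(1)] cvs.subspace_scale[OF S(2)])
  qed
qed

lemma clinear_parity_op: "clinear (parity_op V)"
  unfolding parity_op_def by (intro clinear_sum clinear_scale clinear_component)

lemma parity_op_homogeneous:
  assumes "v \<in> grade V p" "p \<in> {0, 1}"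
  shows "parity_op V v = (-1) ^ p *\<^sub>C v"
  using assms by (auto simp: parity_op_def component_homogeneous)

lemma parity_op_component: "parity_op V v = component V 0 v - component V 1 v"
  by (simp add: parity_op_def scaleC_one)

lemma parity_op_power_homogeneous:
  assumes "v \<in> grade V p" "p \<in> {0, 1}"
  shows "(parity_op V ^^ r) v = (-1) ^ (r * p) *\<^sub>C v"
  by (induction r) (simp_all add: scaleC_one parity_op_homogeneous[OF assms] scaleC_scaleC
      clinearD[OF clinear_parity_op] power_add mult.commute)

lemma homogeneous_span: "cvs.span (grade V 0 \<union> grade V 1) = UNIV"
proof -
  have "v \<in> cvs.span (grade V 0 \<union> grade V 1)" for v
    using component_decomposition[of v] cvs.span_add[of "component V 0 v" _ "component V 1 v"]
    by (metis UnCI cvs.span_base)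
  then show ?thesis by auto
qed

lemma homogeneous_eqI:
  assumes "clinear f" "clinear g" "\<And>p v. p \<in> {0, 1} \<Longrightarrow> v \<in> grade V p \<Longrightarrow> f v = g v"
  shows "f v = g v"
proof -
  have "f v = g v" if "v \<in> grade V 0 \<union> grade V 1" for v
    using that assms(3)[of 0] assms(3)[of 1] by blast
  from clinear_eq_on_spanning[OF assms(1,2) homogeneous_span this] show ?thesis by simp
qed

text \<open>The super sign becomes the parity operator on the left vector, so the formulas hold for
  inhomogeneous \<open>v\<close> as well.\<close>

lemma super_act_pure:
  assumes "clinear a" "clinear b"
  shows "super_act V 0 a b (v \<otimes>\<^sub>C w) = a v \<otimes>\<^sub>C b w"
    "super_act V 1 a b (v \<otimes>\<^sub>C w) = a (parity_op V v) \<otimes>\<^sub>C b w"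
    and "clinear (super_act V d a b)"
proof -
  have c: "cbilinear (\<lambda>v w. \<Sum>p\<in>{0, 1}. (-1) ^ (d * p) *\<^sub>C (a (component V p v) \<otimes>\<^sub>C b w))" for d
  proof (intro cbilinearI clinear_sum clinear_scale)
    fix p :: nat and w v assume p: "p \<in> {0, 1}"
    show "clinear (\<lambda>v. a (component V p v) \<otimes>\<^sub>C b w)"
      using clinear_compose[OF clinear_tensor_left clinear_compose[OF assms(1) clinear_component[OF p]]] .
    show "clinear (\<lambda>w. a (component V p v) \<otimes>\<^sub>C b w)"
      using clinear_compose[OF clinear_tensor_right assms(2)] .
  qed
  have "a (component V 0 v) + a (component V 1 v) = a v"
    by (simp only: clinearD(1)[OF assms(1), symmetric] component_decomposition(3))
  then show "super_act V 0 a b (v \<otimes>\<^sub>C w) = a v \<otimes>\<^sub>C b w"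
    unfolding super_act_def tensor_lift_pure[OF c] by (simp add: scaleC_one tensor_add_left [symmetric])
  have "a (component V 0 v) - a (component V 1 v) = a (parity_op V v)"
    by (simp only: clinearD(5)[OF assms(1), symmetric] parity_op_component)
  then show "super_act V 1 a b (v \<otimes>\<^sub>C w) = a (parity_op V v) \<otimes>\<^sub>C b w"
    unfolding super_act_def tensor_lift_pure[OF c]
    by (simp add: scaleC_one clinearD(5)[OF clinear_tensor_left, symmetric])
  show "clinear (super_act V d a b)"
    unfolding super_act_def by (rule clinear_tensor_lift[OF c])
qed

text \<open>One homogeneous factor is enough: the sign becomes a power of the parity operator on the
  other factor. In the traces that other factor is the image of a basis vector, over which the sum
  runs.\<close>

lemma super_flip_pure:
  shows "v \<in> grade V r \<Longrightarrow> r \<in> {0, 1} \<Longrightarrow> super_flip V V (v \<otimes>\<^sub>C w) = (parity_op V ^^ r) w \<otimes>\<^sub>C v"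
    and "w \<in> grade V r \<Longrightarrow> r \<in> {0, 1} \<Longrightarrow> super_flip V V (v \<otimes>\<^sub>C w) = w \<otimes>\<^sub>C (parity_op V ^^ r) v"
    and "clinear (super_flip V V)"
proof -
  have c: "cbilinear (\<lambda>v w. \<Sum>p\<in>{0, 1}. \<Sum>q\<in>{0, 1}.
      (-1) ^ (p * q) *\<^sub>C (component V q w \<otimes>\<^sub>C component V p v))"
  proof (intro cbilinearI clinear_sum clinear_scale)
    fix p q :: nat and w v assume p: "p \<in> {0, 1}" and q: "q \<in> {0, 1}"
    show "clinear (\<lambda>v. component V q w \<otimes>\<^sub>C component V p v)"
      using clinear_compose[OF clinear_tensor_right clinear_component[OF p]] .
    show "clinear (\<lambda>w. component V q w \<otimes>\<^sub>C component V p v)"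
      using clinear_compose[OF clinear_tensor_left clinear_component[OF q]] .
  qed
  show "clinear (super_flip V V)"
    unfolding super_flip_def by (rule clinear_tensor_lift[OF c])
  have zero: "0 \<otimes>\<^sub>C u = 0" "u \<otimes>\<^sub>C 0 = 0" for u :: 'v
    using clinearD(3)[OF clinear_tensor_left] clinearD(3)[OF clinear_tensor_right] by blast+
  show "super_flip V V (v \<otimes>\<^sub>C w) = (parity_op V ^^ r) w \<otimes>\<^sub>C v"
    if v: "v \<in> grade V r" and r: "r \<in> {0, 1}"
  proof -
    have "component V 0 v = (if r = 0 then v else 0)" "component V 1 v = (if r = 1 then v else 0)"
      using component_homogeneous[OF v r] by auto
    then show ?thesis
      using r component_decomposition(3)[of w]
      unfolding super_flip_def tensor_lift_pure[OF c]
      by (auto simp: zero scaleC_one parity_op_component tensor_add_left [symmetric]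
          clinearD(5)[OF clinear_tensor_left, symmetric])
  qed
  show "super_flip V V (v \<otimes>\<^sub>C w) = w \<otimes>\<^sub>C (parity_op V ^^ r) v"
    if w: "w \<in> grade V r" and r: "r \<in> {0, 1}"
  proof -
    have "component V 0 w = (if r = 0 then w else 0)" "component V 1 w = (if r = 1 then w else 0)"
      using component_homogeneous[OF w r] by auto
    then show ?thesis
      using r component_decomposition(3)[of v]
      unfolding super_flip_def tensor_lift_pure[OF c]
      by (auto simp: zero scaleC_one parity_op_component tensor_add_right [symmetric]
          clinearD(5)[OF clinear_tensor_right, symmetric])
  qed
qed

text \<open>A maximal independent set of homogeneous vectors spans, because the homogeneous vectors
  do. This makes the choice in \<open>hbasis\<close> meaningful.\<close>

lemma homogeneous_basis_exists:
  assumes "finite_dim TYPE('v)"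
  shows "homogeneous_basis V (hbasis V)"
proof -
  obtain B where B: "B \<subseteq> grade V 0 \<union> grade V 1" "cvs.independent B"
      "grade V 0 \<union> grade V 1 \<subseteq> cvs.span B"
    using cvs.maximal_independent_subset[of "grade V 0 \<union> grade V 1"] by blast
  have "cvs.span B = UNIV"
    using cvs.span_minimal[OF B(3) cvs.subspace_span] homogeneous_span by auto
  moreover obtain C :: "'v set" where "finite C" "cvs.span C = UNIV"
    using assms by (auto simp: finite_dim_def)
  then have "finite B"
    using cvs.independent_span_bound[of C B] B(2) by auto
  ultimately have "homogeneous_basis V B"
    using B by (simp add: homogeneous_basis_def)
  then show ?thesis unfolding hbasis_def by (rule someI)
qed

end

section \<open>The twist on weight vectors\<close>

lemma funpow_eigenvector: "clinear A \<Longrightarrow> A u = c *\<^sub>C u \<Longrightarrow> (A ^^ n) u = c ^ n *\<^sub>C u"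
  for A :: "'a::complex_vec \<Rightarrow> 'a"
  by (induction n) (simp_all add: scaleC_one clinearD scaleC_scaleC mult.commute)

locale uh_object =
  fixes V :: "('v::complex_vec) uh_module" and l :: nat
  assumes l_odd: "odd l" "l \<ge> 3" and object: "CH_object l V"
begin

definition "h1 = act_h V 1"
definition "h2 = act_h V 2"
definition "k1 = act_k V 1"
definition "k2 = act_k V 2"
definition "k1' = act_kinv V 1"
definition "k2' = act_kinv V 2"
definition "e1 = act_e V 1"
definition "e2 = act_e V 2"
definition "f1 = act_f V 1"
definition "f2 = act_f V 2"

lemmas gen_defs = h1_def h2_def k1_def k2_def k1'_def k2'_def e1_def e2_def f1_def f2_def

lemma representation: "uh_representation l V"
  using object by (simp add: CH_object_def)

lemma lin_gen: "clinear h1" "clinear h2" "clinear k1" "clinear k2" "clinear k1'" "clinear k2'"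
    "clinear e1" "clinear e2" "clinear f1" "clinear f2"
  using representation by (simp_all add: uh_representation_def gen_defs)

lemma degree_gen: "has_degree V 0 h1" "has_degree V 0 h2" "has_degree V 0 e1" "has_degree V 1 e2"
    "has_degree V 0 f1" "has_degree V 1 f2"
  using representation by (simp_all add: uh_representation_def gen_defs gen_degree_def)

sublocale super_vector_space V
  by unfold_locales (use representation in \<open>simp add: uh_representation_def\<close>)

lemma xipow_2: "xipow l 2 = xi l ^ 2" "xipow l (- 2) = inverse (xi l ^ 2)"
proof -
  show "xipow l 2 = xi l ^ 2"
    using xipow_of_nat_mult[of l 2 1] by simp
  then show "xipow l (- 2) = inverse (xi l ^ 2)"
    by (simp add: xipow_minus)
qed

lemma relations: "uh_relations l V"
  using representation by (simp add: uh_representation_def)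

lemma cartan_relations:
  assumes "i \<in> {1, 2}" "j \<in> {1, 2}"
  shows "act_k V i (act_kinv V i v) = v" "act_kinv V i (act_k V i v) = v"
    "act_k V i (act_e V j (act_kinv V i v)) = xipow l (cartan i j) *\<^sub>C act_e V j v"
    "act_k V i (act_f V j (act_kinv V i v)) = xipow l (- cartan i j) *\<^sub>C act_f V j v"
    "act_h V i (act_e V j v) = act_e V j (act_h V i v) + cartan i j *\<^sub>C act_e V j v"
    "act_h V i (act_f V j v) = act_f V j (act_h V i v) - cartan i j *\<^sub>C act_f V j v"
    "act_h V i (act_h V j v) = act_h V j (act_h V i v)"
proof -
  have "\<forall>i\<in>{1, 2}. \<forall>j\<in>{1, 2}. \<forall>v.
      act_k V i (act_kinv V i v) = v \<and> act_kinv V i (act_k V i v) = v \<and>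
      act_k V i (act_e V j (act_kinv V i v)) = xipow l (cartan i j) *\<^sub>C act_e V j v \<and>
      act_k V i (act_f V j (act_kinv V i v)) = xipow l (- cartan i j) *\<^sub>C act_f V j v \<and>
      act_h V i (act_e V j v) - act_e V j (act_h V i v) = cartan i j *\<^sub>C act_e V j v \<and>
      act_h V i (act_f V j v) - act_f V j (act_h V i v) = - cartan i j *\<^sub>C act_f V j v \<and>
      act_h V i (act_h V j v) = act_h V j (act_h V i v)"
    using relations unfolding uh_relations_def Let_def by blast
  then have r: "act_k V i (act_kinv V i v) = v \<and> act_kinv V i (act_k V i v) = v \<and>
      act_k V i (act_e V j (act_kinv V i v)) = xipow l (cartan i j) *\<^sub>C act_e V j v \<and>
      act_k V i (act_f V j (act_kinv V i v)) = xipow l (- cartan i j) *\<^sub>C act_f V j v \<and>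
      act_h V i (act_e V j v) - act_e V j (act_h V i v) = cartan i j *\<^sub>C act_e V j v \<and>
      act_h V i (act_f V j v) - act_f V j (act_h V i v) = - cartan i j *\<^sub>C act_f V j v \<and>
      act_h V i (act_h V j v) = act_h V j (act_h V i v)"
    using assms by blast
  then show "act_k V i (act_kinv V i v) = v" "act_kinv V i (act_k V i v) = v"
    "act_k V i (act_e V j (act_kinv V i v)) = xipow l (cartan i j) *\<^sub>C act_e V j v"
    "act_k V i (act_f V j (act_kinv V i v)) = xipow l (- cartan i j) *\<^sub>C act_f V j v"
    "act_h V i (act_h V j v) = act_h V j (act_h V i v)"
    by blast+
  from r have "act_h V i (act_e V j v) - act_e V j (act_h V i v) = cartan i j *\<^sub>C act_e V j v"
    "act_h V i (act_f V j v) - act_f V j (act_h V i v) = - (cartan i j *\<^sub>C act_f V j v)"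
    by simp_all
  then show "act_h V i (act_e V j v) = act_e V j (act_h V i v) + cartan i j *\<^sub>C act_e V j v"
    "act_h V i (act_f V j v) = act_f V j (act_h V i v) - cartan i j *\<^sub>C act_f V j v"
    by (metis add.commute diff_add_cancel, metis add.commute diff_add_cancel uminus_add_conv_diff)
qed

lemma cartan_simps: "cartan 1 1 = 2" "cartan 1 2 = - 1" "cartan 2 1 = - 1" "cartan 2 2 = 0"
  by (simp_all add: cartan_def)

lemma sl21_relations:
  "act_e V 1 (act_f V 1 v) - act_f V 1 (act_e V 1 v) = inverse (xi_bracket l) *\<^sub>C (act_k V 1 v - act_kinv V 1 v)"
  "act_e V 2 (act_f V 2 v) + act_f V 2 (act_e V 2 v) = inverse (xi_bracket l) *\<^sub>C (act_k V 2 v - act_kinv V 2 v)"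
  "act_e V 1 (act_f V 2 v) = act_f V 2 (act_e V 1 v)" "act_e V 2 (act_f V 1 v) = act_f V 1 (act_e V 2 v)"
  "act_e V 2 (act_e V 2 v) = 0" "act_f V 2 (act_f V 2 v) = 0"
  using relations unfolding uh_relations_def Let_def by blast+

sublocale uq_sl21 "xi l" l e1 e2 f1 f2 k1 k2 k1' k2'
proof
  show "odd l" "l \<ge> 3" by (fact l_odd)+
  show "xi l ^ n = 1 \<longleftrightarrow> l dvd n" for n
    using l_odd by (intro xi_power_eq_1_iff) simp
  show "clinear e1" "clinear e2" "clinear f1" "clinear f2" "clinear k1" "clinear k2" "clinear k1'" "clinear k2'"
    by (fact lin_gen)+
  fix v
  have i: "(1::nat) \<in> {1, 2}" "(2::nat) \<in> {1, 2}" by auto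
  show "k1 (k1' v) = v" "k1' (k1 v) = v" "k2 (k2' v) = v" "k2' (k2 v) = v"
    unfolding gen_defs by (fact cartan_relations[OF i(1) i(1)] cartan_relations[OF i(2) i(2)])+
  show "k1 (e1 (k1' v)) = xi l ^ 2 *\<^sub>C e1 v" "k1 (e2 (k1' v)) = inverse (xi l) *\<^sub>C e2 v"
    "k2 (e1 (k2' v)) = inverse (xi l) *\<^sub>C e1 v" "k2 (e2 (k2' v)) = e2 v"
    "k1 (f1 (k1' v)) = inverse (xi l ^ 2) *\<^sub>C f1 v" "k1 (f2 (k1' v)) = xi l *\<^sub>C f2 v"
    "k2 (f1 (k2' v)) = xi l *\<^sub>C f1 v" "k2 (f2 (k2' v)) = f2 v"
    unfolding gen_defs
    using cartan_relations(3,4)[OF i(1) i(1), of v] cartan_relations(3,4)[OF i(1) i(2), of v]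
      cartan_relations(3,4)[OF i(2) i(1), of v] cartan_relations(3,4)[OF i(2) i(2), of v]
    by (simp_all only: cartan_simps xipow_2 xipow_minus minus_minus minus_zero
        xipow_zero scaleC_one inverse_inverse_eq)
  show "e1 (f1 v) - f1 (e1 v) = inverse (xi l - inverse (xi l)) *\<^sub>C (k1 v - k1' v)"
    "e2 (f2 v) + f2 (e2 v) = inverse (xi l - inverse (xi l)) *\<^sub>C (k2 v - k2' v)"
    "e1 (f2 v) = f2 (e1 v)" "e2 (f1 v) = f1 (e2 v)" "e2 (e2 v) = 0" "f2 (f2 v) = 0"
    unfolding gen_defs xi_bracket_def [symmetric] by (rule sl21_relations)+
  show "(e1 ^^ l) v = 0" "(f1 ^^ l) v = 0"
    using object unfolding CH_object_def gen_defs by blast+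
qed

lemma act_e3_eq: "act_e3 l V = e3" and act_f3_eq: "act_f3 l V = f3"
  unfolding act_e3_def e3_def act_f3_def f3_def unfolding gen_defs by (intro ext refl)+

text \<open>Eigenvalues of \<open>h1\<close> and \<open>h2\<close> are recorded, not only those of
  \<open>k1\<close> and \<open>k2\<close>, because the exponent of the Cartan factor is bilinear in
  them.\<close>

definition wt :: "complex \<Rightarrow> complex \<Rightarrow> 'v \<Rightarrow> bool"
  where "wt a b v \<longleftrightarrow> h1 v = a *\<^sub>C v \<and> h2 v = b *\<^sub>C v"

lemma h_e: "h1 (e1 v) = e1 (h1 v) + 2 *\<^sub>C e1 v" "h1 (e2 v) = e2 (h1 v) - e2 v"
    "h2 (e1 v) = e1 (h2 v) - e1 v" "h2 (e2 v) = e2 (h2 v)"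
  and h_f: "h1 (f1 v) = f1 (h1 v) - 2 *\<^sub>C f1 v" "h1 (f2 v) = f2 (h1 v) + f2 v"
    "h2 (f1 v) = f1 (h2 v) + f1 v" "h2 (f2 v) = f2 (h2 v)"
  unfolding gen_defs
  using cartan_relations(5,6)[of 1 1 v] cartan_relations(5,6)[of 1 2 v]
    cartan_relations(5,6)[of 2 1 v] cartan_relations(5,6)[of 2 2 v]
  by (simp_all only: cartan_simps) (simp_all add: scaleC_one)

lemma wt_diff_scale: "wt a b u \<Longrightarrow> wt a b w \<Longrightarrow> wt a b (u - c *\<^sub>C w)"
  by (simp add: wt_def clinearD[OF lin_gen(1)] clinearD[OF lin_gen(2)] scaleC_scaleC
      cvs.scale_right_diff_distrib mult.commute)

lemma wt_move:
  shows "wt a b v \<Longrightarrow> wt (a + 2) (b - 1) (e1 v)" "wt a b v \<Longrightarrow> wt (a - 1) b (e2 v)"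
    "wt a b v \<Longrightarrow> wt (a - 2) (b + 1) (f1 v)" "wt a b v \<Longrightarrow> wt (a + 1) b (f2 v)"
  by (simp_all add: wt_def h_e h_f linD scaleC_add_left cvs.scale_left_diff_distrib scaleC_one)

lemma wt_move3:
  assumes "wt a b v"
  shows "wt (a + 1) (b - 1) (e3 v)" "wt (a - 1) (b + 1) (f3 v)"
proof -
  have "wt (a + 1) (b - 1) (e1 (e2 v))" "wt (a + 1) (b - 1) (e2 (e1 v))"
    "wt (a - 1) (b + 1) (f2 (f1 v))" "wt (a - 1) (b + 1) (f1 (f2 v))"
    using wt_move(1)[OF wt_move(2)[OF assms]] wt_move(2)[OF wt_move(1)[OF assms]]
      wt_move(4)[OF wt_move(3)[OF assms]] wt_move(3)[OF wt_move(4)[OF assms]]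
    by (simp_all add: add.commute)
  then show "wt (a + 1) (b - 1) (e3 v)" "wt (a - 1) (b + 1) (f3 v)"
    unfolding e3_def f3_def by (auto intro: wt_diff_scale)
qed

lemma wt_power:
  assumes "wt a b v"
  shows "wt (a + 2 * of_nat i) (b - of_nat i) ((e1 ^^ i) v)"
    "wt (a - 2 * of_nat i) (b + of_nat i) ((f1 ^^ i) v)"
proof (induction i)
  case 0
  show "wt (a + 2 * of_nat 0) (b - of_nat 0) ((e1 ^^ 0) v)"
    "wt (a - 2 * of_nat 0) (b + of_nat 0) ((f1 ^^ 0) v)" using assms by simp_all
next
  case (Suc i)
  show "wt (a + 2 * of_nat (Suc i)) (b - of_nat (Suc i)) ((e1 ^^ Suc i) v)"
    "wt (a - 2 * of_nat (Suc i)) (b + of_nat (Suc i)) ((f1 ^^ Suc i) v)"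
    using wt_move(1)[OF Suc(1)] wt_move(3)[OF Suc(2)] by (simp_all add: algebra_simps)
qed

lemma diagonalizable_h: "diagonalizable h1" "diagonalizable h2"
  and k_xi_exp: "k1 = xi_exp l h1" "k2 = xi_exp l h2"
  using object unfolding CH_object_def gen_defs by blast+

lemma wt_kwt:
  assumes "wt a b v"
  shows "kwt (xipow l a) (xipow l b) v"
proof -
  have "k1 v = xipow l a *\<^sub>C v"
    unfolding k_xi_exp(1)
    by (rule xi_exp_eigen(2)[OF lin_gen(1) diagonalizable_span[OF diagonalizable_h(1)]])
      (use assms in \<open>simp add: wt_def\<close>)
  moreover have "k2 v = xipow l b *\<^sub>C v"
    unfolding k_xi_exp(2)
    by (rule xi_exp_eigen(2)[OF lin_gen(2) diagonalizable_span[OF diagonalizable_h(2)]])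
      (use assms in \<open>simp add: wt_def\<close>)
  ultimately show ?thesis by (simp add: kwt_def)
qed

lemma weight_span: "cvs.span {v. \<exists>a b. wt a b v} = UNIV"
  unfolding wt_def
proof (rule commuting_eigenvectors_span)
  show "h1 (h2 v) = h2 (h1 v)" for v
    unfolding gen_defs by (rule cartan_relations) simp_all
qed (intro lin_gen diagonalizable_span diagonalizable_h)+

lemma degree_0D: "has_degree V 0 A \<Longrightarrow> p \<in> {0, 1} \<Longrightarrow> v \<in> grade V p \<Longrightarrow> A v \<in> grade V p"
  unfolding has_degree_def by force

lemma degree_1D: "has_degree V 1 A \<Longrightarrow> p \<in> {0, 1} \<Longrightarrow> v \<in> grade V p \<Longrightarrow> A v \<in> grade V (1 - p)"
  unfolding has_degree_def by force

text \<open>\<open>h1\<close> and \<open>h2\<close> are even, so they commute with the projections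
  to the homogeneous components; hence homogeneous weight vectors span.\<close>

lemma component_wt:
  assumes "wt a b v" "p \<in> {0, 1}"
  shows "wt a b (component V p v)"
proof -
  have comm: "component V p (A v) = A (component V p v)" if A: "clinear A" "has_degree V 0 A" for A
  proof (rule homogeneous_eqI[where f = "\<lambda>v. component V p (A v)" and g = "\<lambda>v. A (component V p v)"])
    show "clinear (\<lambda>v. component V p (A v))" "clinear (\<lambda>v. A (component V p v))"
      using A(1) clinear_component[OF assms(2)] by (simp_all add: clinear_iff)
  next
    fix s u assume s: "s \<in> {0, 1}" and u: "u \<in> grade V s"
    show "component V p (A u) = A (component V p u)"
      unfolding component_homogeneous[OF u s assms(2)]
        component_homogeneous[OF degree_0D[OF A(2) s u] s assms(2)]
      by (simp add: clinearD(3)[OF A(1)])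
  qed
  have "h1 (component V p v) = a *\<^sub>C component V p v" "h2 (component V p v) = b *\<^sub>C component V p v"
    using assms(1) unfolding comm[OF lin_gen(1) degree_gen(1), symmetric]
      comm[OF lin_gen(2) degree_gen(2), symmetric] wt_def
    by (simp_all add: clinearD(2)[OF clinear_component[OF assms(2)]])
  then show ?thesis by (simp add: wt_def)
qed

lemma weight_homogeneous_eqI:
  assumes "clinear f" "clinear g"
    and "\<And>a b p v. wt a b v \<Longrightarrow> p \<in> {0, 1} \<Longrightarrow> v \<in> grade V p \<Longrightarrow> f v = g v"
  shows "f = g"
proof (rule clinear_eq_on_spanning[OF assms(1,2) weight_span])
  fix v assume "v \<in> {v. \<exists>a b. wt a b v}"
  then obtain a b where "wt a b v" by blast
  then have "f (component V 0 v) = g (component V 0 v)" "f (component V 1 v) = g (component V 1 v)"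
    using assms(3)[OF component_wt] component_decomposition(1,2)[of v] by blast+
  then have "f (component V 0 v + component V 1 v) = g (component V 0 v + component V 1 v)"
    using assms(1,2) by (simp only: clinearD)
  then show "f v = g v" by (simp only: component_decomposition(3))
qed

section \<open>The braiding on weight vectors\<close>

abbreviation "P \<equiv> parity_op V"
abbreviation "dv \<equiv> dual_vec (hbasis V)"

definition bform :: "complex \<Rightarrow> complex \<Rightarrow> complex \<Rightarrow> complex \<Rightarrow> complex"
  where "bform a b c d = - (a * d) - b * c - 2 * b * d"

text \<open>The Cartan factor seen by the other tensor factor when one factor has weight
  \<open>a\<close>, \<open>b\<close>. An operator is needed because that other factor comes from
  \<open>hbasis V\<close>, whose members need not be weight vectors. By symmetry of
  \<open>bform\<close> it serves on either side.\<close>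

definition weight_op :: "complex \<Rightarrow> complex \<Rightarrow> 'v \<Rightarrow> 'v"
  where "weight_op a b = xi_exp l (\<lambda>w. - (a *\<^sub>C h2 w) - b *\<^sub>C h1 w - (2 * b) *\<^sub>C h2 w)"

lemma weight_op:
  shows "clinear (weight_op a b)"
    and "wt c d w \<Longrightarrow> weight_op a b w = xipow l (bform a b c d) *\<^sub>C w"
proof -
  let ?A = "\<lambda>w. - (a *\<^sub>C h2 w) - b *\<^sub>C h1 w - (2 * b) *\<^sub>C h2 w"
  have lin: "clinear ?A"
    by (intro clinear_diff clinear_uminus clinear_scale lin_gen)
  have ev: "?A w = bform a b c d *\<^sub>C w" if "wt c d w" for c d w
    using that by (simp add: wt_def bform_def scaleC_scaleC cvs.scale_left_diff_distrib)
  have "{v. \<exists>a b. wt a b v} \<subseteq> {w. \<exists>c. ?A w = c *\<^sub>C w}" using ev by blast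
  then have span: "cvs.span {w. \<exists>c. ?A w = c *\<^sub>C w} = UNIV"
    using cvs.span_mono weight_span by (metis (no_types, lifting) top.extremum_uniqueI)
  show "clinear (weight_op a b)"
    unfolding weight_op_def by (rule xi_exp_eigen(1)[OF lin span])
  show "weight_op a b w = xipow l (bform a b c d) *\<^sub>C w" if "wt c d w"
    unfolding weight_op_def by (rule xi_exp_eigen(2)[OF lin span ev[OF that]])
qed

lemma K_op_eigen:
  shows "clinear (K_op l V V)"
    and "wt a b v \<Longrightarrow> wt c d w \<Longrightarrow> K_op l V V (v \<otimes>\<^sub>C w) = xipow l (bform a b c d) *\<^sub>C (v \<otimes>\<^sub>C w)"
proof -
  let ?A = "\<lambda>t. - super_act V 0 h1 h2 t - super_act V 0 h2 h1 t - 2 *\<^sub>C super_act V 0 h2 h2 t"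
  have lin: "clinear ?A"
    by (intro clinear_diff clinear_uminus clinear_scale super_act_pure(3) lin_gen)
  have ev: "?A (v \<otimes>\<^sub>C w) = bform a b c d *\<^sub>C (v \<otimes>\<^sub>C w)" if "wt a b v" "wt c d w" for a b c d v w
    using that unfolding super_act_pure(1)[OF lin_gen(1,2)] super_act_pure(1)[OF lin_gen(2,1)]
      super_act_pure(1)[OF lin_gen(2,2)]
    by (simp add: wt_def bform_def scaleC_scaleC cvs.scale_left_diff_distrib tensor_scale_left
        tensor_scale_right mult_ac)
  have "{v \<otimes>\<^sub>C w |v w. v \<in> {v. \<exists>a b. wt a b v} \<and> w \<in> {v. \<exists>a b. wt a b v}} \<subseteq> {t. \<exists>c. ?A t = c *\<^sub>C t}"
    using ev by blast
  then have "cvs.span {v \<otimes>\<^sub>C w |v w. v \<in> {v. \<exists>a b. wt a b v} \<and> w \<in> {v. \<exists>a b. wt a b v}}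
      \<subseteq> cvs.span {t. \<exists>c. ?A t = c *\<^sub>C t}"
    by (rule cvs.span_mono)
  then have span: "cvs.span {t. \<exists>c. ?A t = c *\<^sub>C t} = UNIV"
    unfolding tensor_span[OF weight_span weight_span] by auto
  show "clinear (K_op l V V)"
    unfolding K_op_def gen_defs [symmetric] by (rule xi_exp_eigen(1)[OF lin span])
  show "K_op l V V (v \<otimes>\<^sub>C w) = xipow l (bform a b c d) *\<^sub>C (v \<otimes>\<^sub>C w)" if "wt a b v" "wt c d w"
    unfolding K_op_def gen_defs [symmetric] by (rule xi_exp_eigen(2)[OF lin span ev[OF that]])
qed

lemma bform_commute: "bform a b c d = bform c d a b"
  by (simp add: bform_def algebra_simps)

lemma K_op_weight:
  assumes "wt a b v"
  shows "K_op l V V (v \<otimes>\<^sub>C w) = v \<otimes>\<^sub>C weight_op a b w"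
    and "K_op l V V (w \<otimes>\<^sub>C v) = weight_op a b w \<otimes>\<^sub>C v"
proof -
  have "(\<lambda>w. K_op l V V (v \<otimes>\<^sub>C w)) = (\<lambda>w. v \<otimes>\<^sub>C weight_op a b w)"
  proof (rule weight_homogeneous_eqI)
    show "clinear (\<lambda>w. K_op l V V (v \<otimes>\<^sub>C w))" "clinear (\<lambda>w. v \<otimes>\<^sub>C weight_op a b w)"
      using clinear_compose[OF K_op_eigen(1) clinear_tensor_right]
        clinear_compose[OF clinear_tensor_right weight_op(1)] by blast+
    show "K_op l V V (v \<otimes>\<^sub>C w) = v \<otimes>\<^sub>C weight_op a b w" if "wt c d w" for c d w
      by (simp only: K_op_eigen(2)[OF assms that] weight_op(2)[OF that] tensor_scale_right)
  qed
  then show "K_op l V V (v \<otimes>\<^sub>C w) = v \<otimes>\<^sub>C weight_op a b w" by (rule fun_cong)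
  have "(\<lambda>w. K_op l V V (w \<otimes>\<^sub>C v)) = (\<lambda>w. weight_op a b w \<otimes>\<^sub>C v)"
  proof (rule weight_homogeneous_eqI)
    show "clinear (\<lambda>w. K_op l V V (w \<otimes>\<^sub>C v))" "clinear (\<lambda>w. weight_op a b w \<otimes>\<^sub>C v)"
      using clinear_compose[OF K_op_eigen(1) clinear_tensor_left]
        clinear_compose[OF clinear_tensor_left weight_op(1)] by blast+
    show "K_op l V V (w \<otimes>\<^sub>C v) = weight_op a b w \<otimes>\<^sub>C v" if "wt c d w" for c d w
      by (simp only: K_op_eigen(2)[OF that assms] weight_op(2)[OF that] tensor_scale_left
          bform_commute[of a b])
  qed
  then show "K_op l V V (w \<otimes>\<^sub>C v) = weight_op a b w \<otimes>\<^sub>C v" by (rule fun_cong)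
qed

lemma grade_move:
  assumes "p \<in> {0, 1}" "v \<in> grade V p"
  shows "(e1 ^^ i) v \<in> grade V p" "(f1 ^^ i) v \<in> grade V p"
    "e2 v \<in> grade V (1 - p)" "f2 v \<in> grade V (1 - p)" "e3 v \<in> grade V (1 - p)" "f3 v \<in> grade V (1 - p)"
proof -
  have p': "1 - p \<in> {0, 1}" using assms by auto
  note d0 = degree_0D[OF degree_gen(3)] degree_0D[OF degree_gen(5)]
  note d1 = degree_1D[OF degree_gen(4)] degree_1D[OF degree_gen(6)]
  show "(e1 ^^ i) v \<in> grade V p" "(f1 ^^ i) v \<in> grade V p"
    using assms d0 by (induction i) auto
  show "e2 v \<in> grade V (1 - p)" "f2 v \<in> grade V (1 - p)"
    by (rule d1[OF assms])+
  note S = cvs.subspace_diff[OF grade_subspace[OF p']] cvs.subspace_scale[OF grade_subspace[OF p']]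
  show "e3 v \<in> grade V (1 - p)" "f3 v \<in> grade V (1 - p)"
    unfolding e3_def f3_def
    by (intro S d0[OF p'] d1[OF assms(1)] d1[OF assms] assms(2) d0[OF assms])+
qed

lemma parity_e2: "P (e2 (P u)) = - e2 u"
proof (rule homogeneous_eqI[where f = "\<lambda>u. P (e2 (P u))" and g = "\<lambda>u. - e2 u"])
  show "clinear (\<lambda>u. P (e2 (P u)))" "clinear (\<lambda>u. - e2 u)"
    using clinear_parity_op lin_gen(8) by (simp_all add: clinear_iff)
  fix p u assume p: "p \<in> {0, 1}" and u: "u \<in> grade V p"
  have p': "1 - p \<in> {0, 1}" using p by auto
  have "P (e2 (P u)) = ((-1) ^ p * (-1) ^ (1 - p)) *\<^sub>C e2 u"
    using parity_op_homogeneous[OF grade_move(3)[OF p u] p']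
    by (simp add: parity_op_homogeneous[OF u p] clinearD[OF lin_gen(8)]
        clinearD[OF clinear_parity_op] scaleC_scaleC)
  then show "P (e2 (P u)) = - e2 u"
    using p by (auto simp: scaleC_one)
qed

text \<open>The last sign arises when the odd \<open>f2\<close> passes the odd \<open>e3\<close>:
  the product of the two factors \<open>- xi_bracket l\<close> is positive, and the super sign makes
  it negative.\<close>

lemma R_check_pure:
  "R_check l V V (u \<otimes>\<^sub>C w) = (\<Sum>i<l. rcoeff (xi l) i *\<^sub>C
    ((e1 ^^ i) u \<otimes>\<^sub>C (f1 ^^ i) w
     - xi_bracket l *\<^sub>C ((e1 ^^ i) (e2 (P u)) \<otimes>\<^sub>C (f1 ^^ i) (f2 w))
     - xi_bracket l *\<^sub>C ((e1 ^^ i) (e3 (P u)) \<otimes>\<^sub>C (f1 ^^ i) (f3 w))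
     - (xi_bracket l ^ 2) *\<^sub>C ((e1 ^^ i) (e3 (e2 u)) \<otimes>\<^sub>C (f1 ^^ i) (f3 (f2 w)))))"
  and clinear_R_check: "clinear (R_check l V V)"
proof -
  let ?b = "xi_bracket l"
  let ?X = "\<lambda>t. t - ?b *\<^sub>C super_act V 1 e2 f2 t" and ?Y = "\<lambda>t. t - ?b *\<^sub>C super_act V 1 e3 f3 t"
  let ?Z = "\<lambda>t. \<Sum>i<l. rcoeff (xi l) i *\<^sub>C super_act V 0 (e1 ^^ i) (f1 ^^ i) t"
  have R: "R_check l V V = ?Z \<circ> ?Y \<circ> ?X"
    unfolding R_check_def act_e3_eq act_f3_eq gen_defs [symmetric] rcoeff_def xi_bracket_def ..
  note l2 = super_act_pure(3)[OF lin_gen(8,10)] and l3 = super_act_pure(3)[OF lin3]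
    and l1 = super_act_pure(3)[OF lin_power]
  have X: "?X (u \<otimes>\<^sub>C w) = u \<otimes>\<^sub>C w - ?b *\<^sub>C (e2 (P u) \<otimes>\<^sub>C f2 w)"
    unfolding super_act_pure(2)[OF lin_gen(8,10)] ..
  have "e3 (P (e2 (P u))) = - e3 (e2 u)"
    by (simp add: parity_e2 clinearD[OF lin3(1)])
  then have E: "super_act V 1 e3 f3 (e2 (P u) \<otimes>\<^sub>C f2 w) = - (e3 (e2 u) \<otimes>\<^sub>C f3 (f2 w))"
    unfolding super_act_pure(2)[OF lin3] by (simp add: tensor_minus_left)
  have Y: "?Y (?X (u \<otimes>\<^sub>C w)) = u \<otimes>\<^sub>C w - ?b *\<^sub>C (e2 (P u) \<otimes>\<^sub>C f2 w)
      - ?b *\<^sub>C (e3 (P u) \<otimes>\<^sub>C f3 w) - ?b ^ 2 *\<^sub>C (e3 (e2 u) \<otimes>\<^sub>C f3 (f2 w))"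
    unfolding X clinearD[OF l3] E unfolding super_act_pure(2)[OF lin3]
    by (simp add: cvs.scale_right_diff_distrib scaleC_add_right scaleC_scaleC power2_eq_square)
  show "R_check l V V (u \<otimes>\<^sub>C w) = (\<Sum>i<l. rcoeff (xi l) i *\<^sub>C
    ((e1 ^^ i) u \<otimes>\<^sub>C (f1 ^^ i) w
     - ?b *\<^sub>C ((e1 ^^ i) (e2 (P u)) \<otimes>\<^sub>C (f1 ^^ i) (f2 w))
     - ?b *\<^sub>C ((e1 ^^ i) (e3 (P u)) \<otimes>\<^sub>C (f1 ^^ i) (f3 w))
     - ?b ^ 2 *\<^sub>C ((e1 ^^ i) (e3 (e2 u)) \<otimes>\<^sub>C (f1 ^^ i) (f3 (f2 w)))))"
    unfolding R comp_apply Y clinearD[OF l1] super_act_pure(1)[OF lin_power] ..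
  have "clinear ?Z" "clinear ?Y" "clinear ?X"
    by (intro clinear_sum clinear_scale clinear_diff clinear_id l1 l2 l3)+
  then show "clinear (R_check l V V)"
    unfolding R by (intro clinear_comp)
qed

section \<open>Scalars from the pivotal element and the Cartan factor\<close>

definition pivot :: "complex \<Rightarrow> complex \<Rightarrow> complex"
  where "pivot c d = xipow l (- (of_nat l * c) - 2 * d)"

lemma act_phi0_weight:
  assumes "wt c d u"
  shows "act_phi0 l V u = pivot c d *\<^sub>C u" "act_phi0_inv l V u = inverse (pivot c d) *\<^sub>C u"
proof -
  note k = wt_kwt[OF assms]
  have "k1 u = xipow l c *\<^sub>C u" "k2 u = xipow l d *\<^sub>C u" using k by (simp_all add: kwt_def)
  note pow = funpow_eigenvector[OF lin_gen(5) kwt_inv(1)[OF k]] funpow_eigenvector[OF lin_gen(6) kwt_inv(2)[OF k]]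
    funpow_eigenvector[OF lin_gen(3) this(1)] funpow_eigenvector[OF lin_gen(4) this(2)]
  have p: "pivot c d = inverse (xipow l c) ^ l * inverse (xipow l d) ^ 2"
    unfolding pivot_def xipow_diff xipow_minus xipow_of_nat_mult
    using xipow_of_nat_mult[of l 2 d] by (simp add: power_inverse)
  show "act_phi0 l V u = pivot c d *\<^sub>C u"
    unfolding act_phi0_def comp_apply gen_defs [symmetric] p
    by (simp only: pow clinearD(2)[OF clinear_funpow[OF lin_gen(5)]] scaleC_scaleC mult.commute)
  show "act_phi0_inv l V u = inverse (pivot c d) *\<^sub>C u"
    unfolding act_phi0_inv_def comp_apply gen_defs [symmetric] p
    by (simp only: pow clinearD(2)[OF clinear_funpow[OF lin_gen(4)]] scaleC_scaleC mult.commute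
        inverse_mult_distrib power_inverse inverse_inverse_eq)
qed

lemma clinear_phi0: "clinear (act_phi0 l V)" "clinear (act_phi0_inv l V)"
  unfolding act_phi0_def act_phi0_inv_def gen_defs [symmetric]
  by (intro clinear_comp clinear_funpow lin_gen)+

lemma xipow_shift:
  "xipow l (z + of_nat l * of_nat m) = xipow l z" "xipow l (z - of_nat l * of_nat m) = xipow l z"
proof -
  have "xipow l (of_nat l * of_nat m) = (xi l ^ l) ^ m"
    using xipow_of_nat_mult[of l "l * m" 1] by (simp add: power_mult)
  then have "xipow l (of_nat l * of_nat m) = 1"
    using l_odd by (simp add: xi_power_self)
  then show "xipow l (z + of_nat l * of_nat m) = xipow l z" "xipow l (z - of_nat l * of_nat m) = xipow l z"
    by (simp_all add: xipow_add xipow_diff)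
qed

text \<open>Here \<open>n\<close> and \<open>k\<close> count the letters \<open>e1\<close> and
  \<open>e2\<close> in a word applied to a vector of weight \<open>a\<close>, \<open>b\<close>,
  where \<open>e3\<close> counts as one of each. The term \<open>2 * h2 * h2\<close> of the Cartan
  exponent cancels \<open>2 * b * n\<close>; the power \<open>xi l ^ (2 * n)\<close> comes from
  \<open>k2\<close> in the pivot, and multiples of \<open>l\<close> drop out.\<close>

lemma twist_exponent:
  "xipow l (bform a b (a + 2 * of_nat n - of_nat k) (b - of_nat n)) * pivot (a + 2 * of_nat n - of_nat k) (b - of_nat n)
    = xipow l (bform a b a b) * pivot a b * (xipow l a ^ n * xipow l b ^ k * xi l ^ (2 * n))"
proof -
  have "bform a b (a + 2 * of_nat n - of_nat k) (b - of_nat n) +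
      (- (of_nat l * (a + 2 * of_nat n - of_nat k)) - 2 * (b - of_nat n)) =
      bform a b a b + (- (of_nat l * a) - 2 * b) + (of_nat n * a + of_nat k * b + of_nat (2 * n) * 1)
      + of_nat l * of_nat k - of_nat l * of_nat (2 * n)"
    by (simp add: bform_def algebra_simps)
  then show ?thesis
    unfolding pivot_def xipow_add [symmetric] xipow_of_nat_mult [symmetric] by (simp only: xipow_shift)
qed

text \<open>The same count with the letters \<open>f1\<close> and \<open>f2\<close>.\<close>

lemma twist_exponent':
  "xipow l (bform a b (a - 2 * of_nat n + of_nat k) (b + of_nat n)) * inverse (pivot (a - 2 * of_nat n + of_nat k) (b + of_nat n))
    = xipow l (bform a b a b) * inverse (pivot a b) * (inverse (xipow l a) ^ n * inverse (xipow l b) ^ k * xi l ^ (2 * n))"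
proof -
  have "bform a b (a - 2 * of_nat n + of_nat k) (b + of_nat n) -
      (- (of_nat l * (a - 2 * of_nat n + of_nat k)) - 2 * (b + of_nat n)) =
      bform a b a b - (- (of_nat l * a) - 2 * b) + (of_nat n * (- a) + of_nat k * (- b) + of_nat (2 * n) * 1)
      + of_nat l * of_nat k - of_nat l * of_nat (2 * n)"
    by (simp add: bform_def algebra_simps)
  then show ?thesis
    unfolding pivot_def xipow_minus [symmetric, of l a] xipow_minus [symmetric, of l b]
      xipow_diff [symmetric] xipow_add [symmetric] xipow_of_nat_mult [symmetric]
    by (simp only: xipow_shift)
qed

section \<open>The two twists as sums over a basis\<close>

lemma hbasis: "finite (hbasis V)" "cvs.independent (hbasis V)" "cvs.span (hbasis V) = UNIV"
  using homogeneous_basis_exists object by (simp_all add: homogeneous_basis_def CH_object_def)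

text \<open>What \<open>theta\<close> does after the braiding, on a single summand of the
  coevaluation: the strand carrying the functional is closed with the second tensor factor.\<close>

definition close_right :: "('v, 'v) tensor \<Rightarrow> 'v dual \<Rightarrow> 'v"
  where "close_right s \<phi> = unit_right (tensor_map id (ev_left l V) (assoc_right (s \<otimes>\<^sub>C \<phi>)))"

definition close_left :: "'v dual \<Rightarrow> ('v, 'v) tensor \<Rightarrow> 'v"
  where "close_left \<phi> s = unit_left (tensor_map ev_right id (assoc_left (\<phi> \<otimes>\<^sub>C s)))"

lemma clinear_phi0_parity: "clinear (\<lambda>v. act_phi0 l V (P v))" "clinear (\<lambda>v. act_phi0_inv l V (P v))"
  using clinear_compose[OF clinear_phi0(1) clinear_parity_op] clinear_compose[OF clinear_phi0(2) clinear_parity_op]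
  by blast+

lemma ev_left_pure: "ev_left l V (v \<otimes>\<^sub>C \<phi>) = dual_app \<phi> (act_phi0 l V (P v))"
  and clinear_ev_left: "clinear (ev_left l V)"
  unfolding ev_left_def
  by (rule tensor_lift_pure[OF cbilinear_dual_app_flip[OF clinear_phi0_parity(1)]]
      clinear_tensor_lift[OF cbilinear_dual_app_flip[OF clinear_phi0_parity(1)]])+

lemma close_right_pure: "close_right (z \<otimes>\<^sub>C u) \<phi> = dual_app \<phi> (act_phi0 l V (P u)) *\<^sub>C z"
  unfolding close_right_def assoc_right_pure tensor_map_pure[OF clinear_id(2) clinear_ev_left]
    unit_right_pure ev_left_pure by simp

lemma clinear_close_right: "clinear (\<lambda>s. close_right s \<phi>)"
  unfolding close_right_def
  by (rule clinear_compose[OF clinear_unit_right], rule clinear_compose[OF clinear_tensor_map],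
      rule clinear_id(2), rule clinear_ev_left, rule clinear_compose[OF clinear_assoc_right clinear_tensor_left])

lemma close_left_pure: "close_left \<phi> (z \<otimes>\<^sub>C u) = dual_app \<phi> z *\<^sub>C u"
  unfolding close_left_def assoc_left_pure tensor_map_pure[OF clinear_ev_right clinear_id(2)]
    unit_left_pure ev_right_pure by simp

lemma clinear_close_left: "clinear (close_left \<phi>)"
  unfolding close_left_def
  by (rule clinear_compose[OF clinear_unit_left], rule clinear_compose[OF clinear_tensor_map],
      rule clinear_ev_right, rule clinear_id(2), rule clinear_compose[OF clinear_assoc_left clinear_tensor_right])

lemma clinear_braiding: "clinear (braiding l V V)"
  unfolding braiding_def by (intro clinear_comp super_flip_pure(3) clinear_R_check K_op_eigen(1))

lemma clinear_coev: "clinear (coev_right V)" "clinear (coev_left l V)"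
  unfolding coev_right_def coev_left_def
  by (simp_all add: clinear_iff scaleC_add_left scaleC_complex_def scaleC_scaleC)

lemma theta_expansion: "theta l V v = (\<Sum>b\<in>hbasis V. close_right (braiding l V V (v \<otimes>\<^sub>C b)) (dv b))"
  unfolding theta_def comp_apply tensor_map_pure[OF clinear_id(2) clinear_coev(1)] close_right_def
  by (simp add: coev_right_def scaleC_one clinearD[OF clinear_tensor_right] clinearD[OF clinear_assoc_left]
      assoc_left_pure clinearD[OF clinear_tensor_map[OF clinear_braiding clinear_id(2)]]
      tensor_map_pure[OF clinear_braiding clinear_id(2)] clinearD[OF clinear_assoc_right]
      clinearD[OF clinear_tensor_map[OF clinear_id(2) clinear_ev_left]] clinearD[OF clinear_unit_right])

lemma theta'_expansion:
  "theta' l V v = (\<Sum>b\<in>hbasis V. close_left (dv b) (braiding l V V (act_phi0_inv l V (P b) \<otimes>\<^sub>C v)))"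
  unfolding theta'_def comp_apply tensor_map_pure[OF clinear_coev(2) clinear_id(2)] close_left_def
  by (simp add: coev_left_def scaleC_one clinearD[OF clinear_tensor_left] clinearD[OF clinear_assoc_right]
      assoc_right_pure clinearD[OF clinear_tensor_map[OF clinear_id(2) clinear_braiding]]
      tensor_map_pure[OF clinear_id(2) clinear_braiding] clinearD[OF clinear_assoc_left]
      clinearD[OF clinear_tensor_map[OF clinear_ev_right clinear_id(2)]] clinearD[OF clinear_unit_left])

lemma clinear_theta: "clinear (theta l V)" "clinear (theta' l V)"
proof -
  have "clinear (\<lambda>v. close_right (braiding l V V (v \<otimes>\<^sub>C b)) \<phi>)" for b \<phi>
    by (rule clinear_compose[OF clinear_close_right clinear_compose[OF clinear_braiding clinear_tensor_left]])
  then show "clinear (theta l V)"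
    unfolding theta_expansion[abs_def] by (intro clinear_sum)
  have "clinear (\<lambda>v. close_left \<phi> (braiding l V V (b \<otimes>\<^sub>C v)))" for b \<phi>
    by (rule clinear_compose[OF clinear_close_left clinear_compose[OF clinear_braiding clinear_tensor_right]])
  then show "clinear (theta' l V)"
    unfolding theta'_expansion[abs_def] by (intro clinear_sum)
qed

text \<open>The flip moves \<open>u\<close> to the right, where it is paired with the dual basis;
  completeness then replaces the basis vector by the pivotal element applied to \<open>P u\<close>.
  Of the sign, \<open>r\<close> stems from this parity operator and \<open>r * p\<close> from the
  flip.\<close>

lemma right_trace_term:
  assumes u: "r \<in> {0, 1}" "u \<in> grade V r" "wt c d u" and Z: "clinear Z"
    and p: "p \<in> {0, 1}" "Z u \<in> grade V p"
  shows "(\<Sum>b\<in>hbasis V. close_right (super_flip V V (u \<otimes>\<^sub>C Z (weight_op a b' b))) (dv b)) =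
    ((-1) ^ (r + r * p) * (xipow l (bform a b' c d) * pivot c d)) *\<^sub>C Z u"
proof -
  let ?G = "\<lambda>w. (P ^^ r) (Z (weight_op a b' w))"
  have G: "clinear ?G"
    by (rule clinear_compose[OF clinear_funpow[OF clinear_parity_op] clinear_compose[OF Z weight_op(1)]])
  have "(\<Sum>b\<in>hbasis V. close_right (super_flip V V (u \<otimes>\<^sub>C Z (weight_op a b' b))) (dv b)) =
      (\<Sum>b\<in>hbasis V. dual_app (dv b) (act_phi0 l V (P u)) *\<^sub>C ?G b)"
    by (simp only: super_flip_pure(1)[OF u(2,1)] close_right_pure)
  also have "\<dots> = ?G (act_phi0 l V (P u))"
    by (rule basis_expansion[OF hbasis G])
  also have "act_phi0 l V (P u) = ((-1) ^ r * pivot c d) *\<^sub>C u"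
    by (simp only: parity_op_homogeneous[OF u(2,1)] clinearD[OF clinear_phi0(1)] act_phi0_weight[OF u(3)]
        scaleC_scaleC)
  also have "?G (((-1) ^ r * pivot c d) *\<^sub>C u) =
      (((-1) ^ r * pivot c d) * xipow l (bform a b' c d) * (-1) ^ (r * p)) *\<^sub>C Z u"
    by (simp only: clinearD[OF weight_op(1)] weight_op(2)[OF u(3)] clinearD[OF Z]
        clinearD[OF clinear_funpow[OF clinear_parity_op]] parity_op_power_homogeneous[OF p(2,1)] scaleC_scaleC)
  finally show ?thesis by (simp add: power_add mult_ac)
qed

text \<open>The flip moves \<open>t\<close> next to the dual basis, so completeness replaces the
  basis vector by \<open>t\<close>. The sign \<open>r\<close> comes from the parity operator in
  \<open>coev_left\<close>.\<close>

lemma left_trace_term: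
  assumes t: "r \<in> {0, 1}" "t \<in> grade V r" "wt c d t" and Z: "clinear Z"
    and p: "p \<in> {0, 1}" "Z t \<in> grade V p"
  shows "(\<Sum>b\<in>hbasis V. close_left (dv b)
      (super_flip V V (Z (weight_op a b' (act_phi0_inv l V (P b))) \<otimes>\<^sub>C t))) =
    ((-1) ^ (r + r * p) * (xipow l (bform a b' c d) * inverse (pivot c d))) *\<^sub>C Z t"
proof -
  let ?G = "\<lambda>w. (P ^^ r) (Z (weight_op a b' (act_phi0_inv l V (P w))))"
  have G: "clinear ?G"
    by (rule clinear_compose[OF clinear_funpow[OF clinear_parity_op] clinear_compose[OF Z
        clinear_compose[OF weight_op(1) clinear_phi0_parity(2)]]])
  have "(\<Sum>b\<in>hbasis V. close_left (dv b)
      (super_flip V V (Z (weight_op a b' (act_phi0_inv l V (P b))) \<otimes>\<^sub>C t))) =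
      (\<Sum>b\<in>hbasis V. dual_app (dv b) t *\<^sub>C ?G b)"
    by (simp only: super_flip_pure(2)[OF t(2,1)] close_left_pure)
  also have "\<dots> = ?G t"
    by (rule basis_expansion[OF hbasis G])
  also have "\<dots> = ((-1) ^ r * inverse (pivot c d) * xipow l (bform a b' c d) * (-1) ^ (r * p)) *\<^sub>C Z t"
    by (simp only: parity_op_homogeneous[OF t(2,1)] clinearD[OF clinear_phi0(2)] act_phi0_weight[OF t(3)]
        scaleC_scaleC clinearD[OF weight_op(1)] weight_op(2)[OF t(3)] clinearD[OF Z]
        clinearD[OF clinear_funpow[OF clinear_parity_op]] parity_op_power_homogeneous[OF p(2,1)])
  finally show ?thesis by (simp add: power_add mult_ac)
qed

section \<open>The two twists on homogeneous weight vectors\<close>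

lemma lin_words: "clinear (\<lambda>w. (f1 ^^ i) (f2 w))" "clinear (\<lambda>w. (f1 ^^ i) (f3 w))"
    "clinear (\<lambda>w. (f1 ^^ i) (f3 (f2 w)))" "clinear (\<lambda>w. (e1 ^^ i) (e2 (P w)))"
    "clinear (\<lambda>w. (e1 ^^ i) (e3 (P w)))" "clinear (\<lambda>w. (e1 ^^ i) (e3 (e2 w)))"
proof -
  note e = clinear_compose[OF lin_power(1)] and f = clinear_compose[OF lin_power(2)]
  show "clinear (\<lambda>w. (f1 ^^ i) (f2 w))" "clinear (\<lambda>w. (f1 ^^ i) (f3 w))"
    "clinear (\<lambda>w. (f1 ^^ i) (f3 (f2 w)))" "clinear (\<lambda>w. (e1 ^^ i) (e2 (P w)))"
    "clinear (\<lambda>w. (e1 ^^ i) (e3 (P w)))" "clinear (\<lambda>w. (e1 ^^ i) (e3 (e2 w)))"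
    by (rule e[OF clinear_compose[OF lin_gen(8) clinear_parity_op]]
      e[OF clinear_compose[OF lin3(1) clinear_parity_op]] e[OF clinear_compose[OF lin3(1) lin_gen(8)]]
      f[OF lin_gen(10)] f[OF lin3(2)] f[OF clinear_compose[OF lin3(2) lin_gen(10)]])+
qed

lemma theta_homogeneous:
  assumes v: "p \<in> {0, 1}" "v \<in> grade V p" "wt a b v"
  shows "theta l V v = (xipow l (bform a b a b) * pivot a b) *\<^sub>C theta_sum (xipow l a) (xipow l b) v"
proof -
  let ?br = "xi_bracket l" and ?x = "xipow l a" and ?y = "xipow l b" and ?q = "xi l"
  let ?S = "\<lambda>t. \<Sum>b\<in>hbasis V. close_right (super_flip V V (t b)) (dv b)"
  let ?k = "xipow l (bform a b a b) * pivot a b"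
  define L where "L = weight_op a b"
  have p': "1 - p \<in> {0, 1}" and pp: "1 - (1 - p) = p" using v(1) by auto
  \<comment> \<open>In the terms with one odd pair, the parity operator of \<open>R_check\<close>
    gives \<open>(-1) ^ p\<close> and the trace gives the sign for degree \<open>1 - p\<close>.
    Their product is \<open>- 1\<close> for either parity, so the middle terms of
    \<open>theta_sum\<close> come with plus signs.\<close>
  have sign: "(-1) ^ (p + p * p) = (1 :: complex)" "(-1) ^ p * (-1) ^ (1 - p + (1 - p) * p) = (- 1 :: complex)"
    using v(1) by auto
  have Pv: "P v = (-1) ^ p *\<^sub>C v" by (rule parity_op_homogeneous[OF v(2,1)])
  note G = grade_move[OF v(1)] and G' = grade_move[OF p', unfolded pp]
  have braid: "braiding l V V (v \<otimes>\<^sub>C w) = super_flip V V (\<Sum>i<l. rcoeff ?q i *\<^sub>C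
    ((e1 ^^ i) v \<otimes>\<^sub>C (f1 ^^ i) (L w)
     - (?br * (-1) ^ p) *\<^sub>C ((e1 ^^ i) (e2 v) \<otimes>\<^sub>C (f1 ^^ i) (f2 (L w)))
     - (?br * (-1) ^ p) *\<^sub>C ((e1 ^^ i) (e3 v) \<otimes>\<^sub>C (f1 ^^ i) (f3 (L w)))
     - (?br ^ 2) *\<^sub>C ((e1 ^^ i) (e3 (e2 v)) \<otimes>\<^sub>C (f1 ^^ i) (f3 (f2 (L w))))))" for w
    unfolding braiding_def comp_apply K_op_weight[OF v(3)] R_check_pure Pv L_def
    by (simp only: clinearD[OF lin_gen(8)] clinearD[OF lin3(1)] clinearD[OF lin_power(1)]
        tensor_scale_left scaleC_scaleC)
  \<comment> \<open>The four traces use \<open>twist_exponent\<close> with letter counts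
    \<open>i, 0\<close>, then \<open>i, 1\<close>, then \<open>Suc i, 1\<close>, and
    \<open>Suc i, 2\<close>.\<close>
  have T1: "?S (\<lambda>w. (e1 ^^ i) v \<otimes>\<^sub>C (f1 ^^ i) (L w)) =
      (?k * (?x ^ i * ?q ^ (2 * i))) *\<^sub>C (f1 ^^ i) ((e1 ^^ i) v)" for i
    using right_trace_term[OF v(1) G(1)[OF v(2), of i] wt_power(1)[OF v(3), of i] lin_power(2)[of i] v(1)
        G(2)[OF G(1)[OF v(2), of i], of i], where a = a and b' = b]
      twist_exponent[of a b i 0] unfolding L_def by (simp add: sign)
  have T2: "?S (\<lambda>w. (e1 ^^ i) (e2 v) \<otimes>\<^sub>C (f1 ^^ i) (f2 (L w))) =
      ((-1) ^ (1 - p + (1 - p) * p) * (?k * (?x ^ i * ?y * ?q ^ (2 * i)))) *\<^sub>C (f1 ^^ i) (f2 ((e1 ^^ i) (e2 v)))" for i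
    using right_trace_term[OF p' G'(1)[OF G(3)[OF v(2)], of i] wt_power(1)[OF wt_move(2)[OF v(3)], of i] lin_words(1)[of i] v(1)
        G(2)[OF G'(4)[OF G'(1)[OF G(3)[OF v(2)], of i]], of i], where a = a and b' = b]
      twist_exponent[of a b i 1] unfolding L_def by (simp add: algebra_simps)
  have T3: "?S (\<lambda>w. (e1 ^^ i) (e3 v) \<otimes>\<^sub>C (f1 ^^ i) (f3 (L w))) =
      ((-1) ^ (1 - p + (1 - p) * p) * (?k * (?x ^ Suc i * ?y * ?q ^ (2 * Suc i)))) *\<^sub>C (f1 ^^ i) (f3 ((e1 ^^ i) (e3 v)))" for i
    using right_trace_term[OF p' G'(1)[OF G(5)[OF v(2)], of i] wt_power(1)[OF wt_move3(1)[OF v(3)], of i] lin_words(2)[of i] v(1)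
        G(2)[OF G'(6)[OF G'(1)[OF G(5)[OF v(2)], of i]], of i], where a = a and b' = b]
      twist_exponent[of a b "Suc i" 1] unfolding L_def by (simp add: algebra_simps)
  have T4: "?S (\<lambda>w. (e1 ^^ i) (e3 (e2 v)) \<otimes>\<^sub>C (f1 ^^ i) (f3 (f2 (L w)))) =
      (?k * (?x ^ Suc i * ?y ^ 2 * ?q ^ (2 * Suc i))) *\<^sub>C (f1 ^^ i) (f3 (f2 ((e1 ^^ i) (e3 (e2 v)))))" for i
    using right_trace_term[OF v(1) G(1)[OF G'(5)[OF G(3)[OF v(2)]], of i]
        wt_power(1)[OF wt_move3(1)[OF wt_move(2)[OF v(3)]], of i] lin_words(3)[of i] v(1)
        G(2)[OF G'(6)[OF G(4)[OF G(1)[OF G'(5)[OF G(3)[OF v(2)]], of i]]], of i], where a = a and b' = b]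
      twist_exponent[of a b "Suc i" 2] sign unfolding L_def by (simp add: algebra_simps)
  have "theta l V v = (\<Sum>i<l. rcoeff ?q i *\<^sub>C
    (?S (\<lambda>w. (e1 ^^ i) v \<otimes>\<^sub>C (f1 ^^ i) (L w))
     - (?br * (-1) ^ p) *\<^sub>C ?S (\<lambda>w. (e1 ^^ i) (e2 v) \<otimes>\<^sub>C (f1 ^^ i) (f2 (L w)))
     - (?br * (-1) ^ p) *\<^sub>C ?S (\<lambda>w. (e1 ^^ i) (e3 v) \<otimes>\<^sub>C (f1 ^^ i) (f3 (L w)))
     - (?br ^ 2) *\<^sub>C ?S (\<lambda>w. (e1 ^^ i) (e3 (e2 v)) \<otimes>\<^sub>C (f1 ^^ i) (f3 (f2 (L w))))))"
    unfolding theta_expansion braid clinearD[OF super_flip_pure(3)] clinearD[OF clinear_close_right]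
    by (subst sum.swap) (simp only: cvs.scale_sum_right sum_subtractf cvs.scale_right_diff_distrib)
  also have "\<dots> = ?k *\<^sub>C theta_sum ?x ?y v"
    unfolding T1 T2 T3 T4 theta_sum_def cvs.scale_sum_right
  proof (rule sum.cong[OF refl], rule vec_eqI)
    fix i and g :: "'v \<Rightarrow> complex" assume g: "clinear g"
    define s t X Q where "s = ((-1) ^ p :: complex)" and "t = ((-1) ^ (1 - p + (1 - p) * p) :: complex)"
      and "X = ?x ^ i" and "Q = ?q ^ (2 * i)"
    have st: "s * t = - 1" using sign(2) by (simp only: s_def t_def)
    have pw: "?x ^ Suc i = ?x * X" "?q ^ (2 * Suc i) = ?q ^ 2 * Q"
      by (simp_all only: X_def Q_def power_Suc mult_Suc_right power_add)
    show "g (rcoeff ?q i *\<^sub>C ((?k * (?x ^ i * ?q ^ (2 * i))) *\<^sub>C (f1 ^^ i) ((e1 ^^ i) v)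
      - (?br * (-1) ^ p) *\<^sub>C ((-1) ^ (1 - p + (1 - p) * p) * (?k * (?x ^ i * ?y * ?q ^ (2 * i)))) *\<^sub>C
          (f1 ^^ i) (f2 ((e1 ^^ i) (e2 v)))
      - (?br * (-1) ^ p) *\<^sub>C ((-1) ^ (1 - p + (1 - p) * p) * (?k * (?x ^ Suc i * ?y * ?q ^ (2 * Suc i)))) *\<^sub>C
          (f1 ^^ i) (f3 ((e1 ^^ i) (e3 v)))
      - ?br ^ 2 *\<^sub>C (?k * (?x ^ Suc i * ?y ^ 2 * ?q ^ (2 * Suc i))) *\<^sub>C
          (f1 ^^ i) (f3 (f2 ((e1 ^^ i) (e3 (e2 v))))))) =
      g (?k *\<^sub>C (rcoeff ?q i * ?q ^ (2 * i) * ?x ^ i) *\<^sub>C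
      ((f1 ^^ i) ((e1 ^^ i) v)
       + ((?q - inverse ?q) * ?q ^ 2 * ?x * ?y) *\<^sub>C (f1 ^^ i) (f3 ((e1 ^^ i) (e3 v)))
       + ((?q - inverse ?q) * ?y) *\<^sub>C (f1 ^^ i) (f2 ((e1 ^^ i) (e2 v)))
       - ((?q - inverse ?q) ^ 2 * ?q ^ 2 * ?x * ?y ^ 2) *\<^sub>C (f1 ^^ i) (f3 (f2 ((e1 ^^ i) (e3 (e2 v)))))))"
      unfolding pw s_def [symmetric] t_def [symmetric] X_def [symmetric] Q_def [symmetric]
        xi_bracket_def [symmetric]
      by (simp only: clinearD[OF g] scaleC_complex_def) (use st in algebra)
  qed
  finally show ?thesis .
qed

lemma parity_grade: "p \<in> {0, 1} \<Longrightarrow> v \<in> grade V p \<Longrightarrow> P v \<in> grade V p"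
  by (simp only: parity_op_homogeneous cvs.subspace_scale[OF grade_subspace])

lemma theta'_homogeneous:
  assumes v: "p \<in> {0, 1}" "v \<in> grade V p" "wt a b v"
  shows "theta' l V v = (xipow l (bform a b a b) * inverse (pivot a b)) *\<^sub>C theta_sum' (xipow l a) (xipow l b) v"
proof -
  let ?br = "xi_bracket l" and ?x = "inverse (xipow l a)" and ?y = "inverse (xipow l b)" and ?q = "xi l"
  let ?S = "\<lambda>z t. \<Sum>b\<in>hbasis V. close_left (dv b) (super_flip V V (z b \<otimes>\<^sub>C t))"
  let ?k = "xipow l (bform a b a b) * inverse (pivot a b)"
  define L where "L = (\<lambda>w. weight_op a b (act_phi0_inv l V (P w)))"
  have p': "1 - p \<in> {0, 1}" and pp: "1 - (1 - p) = p" using v(1) by auto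
  \<comment> \<open>Here the parity operator of \<open>R_check\<close> sits on the basis vector and
    hits \<open>t\<close>, of degree \<open>1 - p\<close>, once the sum has collapsed. This time the
    product of signs is \<open>1\<close>, so \<open>theta_sum'\<close> keeps its minus
    signs.\<close>
  have sign: "(-1) ^ (p + p * p) = (1 :: complex)" "(-1) ^ (1 - p + (1 - p) * p) * (-1) ^ (1 - p) = (1 :: complex)"
    using v(1) by auto
  note G = grade_move[OF v(1)] and G' = grade_move[OF p', unfolded pp]
  have braid: "braiding l V V (act_phi0_inv l V (P w) \<otimes>\<^sub>C v) = super_flip V V (\<Sum>i<l. rcoeff ?q i *\<^sub>C
    ((e1 ^^ i) (L w) \<otimes>\<^sub>C (f1 ^^ i) v
     - ?br *\<^sub>C ((e1 ^^ i) (e2 (P (L w))) \<otimes>\<^sub>C (f1 ^^ i) (f2 v))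
     - ?br *\<^sub>C ((e1 ^^ i) (e3 (P (L w))) \<otimes>\<^sub>C (f1 ^^ i) (f3 v))
     - (?br ^ 2) *\<^sub>C ((e1 ^^ i) (e3 (e2 (L w))) \<otimes>\<^sub>C (f1 ^^ i) (f3 (f2 v)))))" for w
    unfolding braiding_def comp_apply K_op_weight[OF v(3)] R_check_pure L_def ..
  have T1: "?S (\<lambda>w. (e1 ^^ i) (L w)) ((f1 ^^ i) v) =
      (?k * (?x ^ i * ?q ^ (2 * i))) *\<^sub>C (e1 ^^ i) ((f1 ^^ i) v)" for i
    using left_trace_term[OF v(1) G(2)[OF v(2), of i] wt_power(2)[OF v(3), of i] lin_power(1)[of i] v(1)
        G(1)[OF G(2)[OF v(2), of i], of i], where a = a and b' = b]
      twist_exponent'[of a b i 0] unfolding L_def by (simp add: sign)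
  have Pt: "(e1 ^^ i) (e (P t)) = (-1) ^ (1 - p) *\<^sub>C (e1 ^^ i) (e t)"
    if "t \<in> grade V (1 - p)" "clinear e" for e t i
    by (simp only: parity_op_homogeneous[OF that(1) p'] clinearD[OF that(2)] clinearD[OF lin_power(1)])
  have T2: "?S (\<lambda>w. (e1 ^^ i) (e2 (P (L w)))) ((f1 ^^ i) (f2 v)) =
      (?k * (?x ^ i * ?y * ?q ^ (2 * i))) *\<^sub>C (e1 ^^ i) (e2 ((f1 ^^ i) (f2 v)))" for i
  proof -
    have t: "(f1 ^^ i) (f2 v) \<in> grade V (1 - p)" by (rule G'(2)[OF G(4)[OF v(2)]])
    have "?S (\<lambda>w. (e1 ^^ i) (e2 (P (L w)))) ((f1 ^^ i) (f2 v)) =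
        ((-1) ^ (1 - p + (1 - p) * p) * (?k * (?x ^ i * ?y * ?q ^ (2 * i)))) *\<^sub>C
          (e1 ^^ i) (e2 (P ((f1 ^^ i) (f2 v))))"
      using left_trace_term[OF p' t wt_power(2)[OF wt_move(4)[OF v(3)], of i] lin_words(4)[of i] v(1)
          G(1)[OF G'(3)[OF parity_grade[OF p' t]], of i], where a = a and b' = b]
        twist_exponent'[of a b i 1] unfolding L_def by (simp add: algebra_simps)
    then show ?thesis
      unfolding Pt[OF t lin_gen(8)] scaleC_scaleC using sign(2) by (simp add: mult_ac)
  qed
  have T3: "?S (\<lambda>w. (e1 ^^ i) (e3 (P (L w)))) ((f1 ^^ i) (f3 v)) =
      (?k * (?x ^ Suc i * ?y * ?q ^ (2 * Suc i))) *\<^sub>C (e1 ^^ i) (e3 ((f1 ^^ i) (f3 v)))" for i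
  proof -
    have t: "(f1 ^^ i) (f3 v) \<in> grade V (1 - p)" by (rule G'(2)[OF G(6)[OF v(2)]])
    have "?S (\<lambda>w. (e1 ^^ i) (e3 (P (L w)))) ((f1 ^^ i) (f3 v)) =
        ((-1) ^ (1 - p + (1 - p) * p) * (?k * (?x ^ Suc i * ?y * ?q ^ (2 * Suc i)))) *\<^sub>C
          (e1 ^^ i) (e3 (P ((f1 ^^ i) (f3 v))))"
      using left_trace_term[OF p' t wt_power(2)[OF wt_move3(2)[OF v(3)], of i] lin_words(5)[of i] v(1)
          G(1)[OF G'(5)[OF parity_grade[OF p' t]], of i], where a = a and b' = b]
        twist_exponent'[of a b "Suc i" 1] unfolding L_def by (simp add: algebra_simps)
    then show ?thesis
      unfolding Pt[OF t lin3(1)] scaleC_scaleC using sign(2) by (simp add: mult_ac)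
  qed
  have T4: "?S (\<lambda>w. (e1 ^^ i) (e3 (e2 (L w)))) ((f1 ^^ i) (f3 (f2 v))) =
      (?k * (?x ^ Suc i * ?y ^ 2 * ?q ^ (2 * Suc i))) *\<^sub>C (e1 ^^ i) (e3 (e2 ((f1 ^^ i) (f3 (f2 v)))))" for i
    using left_trace_term[OF v(1) G(2)[OF G'(6)[OF G(4)[OF v(2)]], of i]
        wt_power(2)[OF wt_move3(2)[OF wt_move(4)[OF v(3)]], of i] lin_words(6)[of i] v(1)
        G(1)[OF G'(5)[OF G(3)[OF G(2)[OF G'(6)[OF G(4)[OF v(2)]], of i]]], of i], where a = a and b' = b]
      twist_exponent'[of a b "Suc i" 2] sign unfolding L_def by (simp add: algebra_simps)
  have "theta' l V v = (\<Sum>i<l. rcoeff ?q i *\<^sub>C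
    (?S (\<lambda>w. (e1 ^^ i) (L w)) ((f1 ^^ i) v)
     - ?br *\<^sub>C ?S (\<lambda>w. (e1 ^^ i) (e2 (P (L w)))) ((f1 ^^ i) (f2 v))
     - ?br *\<^sub>C ?S (\<lambda>w. (e1 ^^ i) (e3 (P (L w)))) ((f1 ^^ i) (f3 v))
     - (?br ^ 2) *\<^sub>C ?S (\<lambda>w. (e1 ^^ i) (e3 (e2 (L w)))) ((f1 ^^ i) (f3 (f2 v)))))"
    unfolding theta'_expansion braid clinearD[OF super_flip_pure(3)] clinearD[OF clinear_close_left]
    by (subst sum.swap) (simp only: cvs.scale_sum_right sum_subtractf cvs.scale_right_diff_distrib)
  also have "\<dots> = ?k *\<^sub>C theta_sum' (xipow l a) (xipow l b) v"
    unfolding T1 T2 T3 T4 theta_sum'_def cvs.scale_sum_right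
  proof (rule sum.cong[OF refl], rule vec_eqI)
    fix i and g :: "'v \<Rightarrow> complex" assume g: "clinear g"
    define X Q where "X = ?x ^ i" and "Q = ?q ^ (2 * i)"
    have pw: "?x ^ Suc i = ?x * X" "?q ^ (2 * Suc i) = ?q ^ 2 * Q"
      by (simp_all only: X_def Q_def power_Suc mult_Suc_right power_add)
    show "g (rcoeff ?q i *\<^sub>C ((?k * (?x ^ i * ?q ^ (2 * i))) *\<^sub>C (e1 ^^ i) ((f1 ^^ i) v)
      - ?br *\<^sub>C (?k * (?x ^ i * ?y * ?q ^ (2 * i))) *\<^sub>C (e1 ^^ i) (e2 ((f1 ^^ i) (f2 v)))
      - ?br *\<^sub>C (?k * (?x ^ Suc i * ?y * ?q ^ (2 * Suc i))) *\<^sub>C (e1 ^^ i) (e3 ((f1 ^^ i) (f3 v)))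
      - ?br ^ 2 *\<^sub>C (?k * (?x ^ Suc i * ?y ^ 2 * ?q ^ (2 * Suc i))) *\<^sub>C
          (e1 ^^ i) (e3 (e2 ((f1 ^^ i) (f3 (f2 v))))))) =
      g (?k *\<^sub>C (rcoeff ?q i * ?q ^ (2 * i) * ?x ^ i) *\<^sub>C
      ((e1 ^^ i) ((f1 ^^ i) v)
       - ((?q - inverse ?q) * ?q ^ 2 * ?x * ?y) *\<^sub>C (e1 ^^ i) (e3 ((f1 ^^ i) (f3 v)))
       - ((?q - inverse ?q) * ?y) *\<^sub>C (e1 ^^ i) (e2 ((f1 ^^ i) (f2 v)))
       - ((?q - inverse ?q) ^ 2 * ?q ^ 2 * ?x * ?y ^ 2) *\<^sub>C (e1 ^^ i) (e3 (e2 ((f1 ^^ i) (f3 (f2 v)))))))"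
      unfolding pw X_def [symmetric] Q_def [symmetric] xi_bracket_def [symmetric]
      by (simp only: clinearD[OF g] scaleC_complex_def) algebra
  qed
  finally show ?thesis .
qed

lemma theta_eq_theta': "theta l V = theta' l V"
proof (rule weight_homogeneous_eqI[OF clinear_theta])
  fix a b p v assume v: "wt a b v" "p \<in> {0, 1}" "v \<in> grade V p"
  \<comment> \<open>The pivot is \<open>x\<close> to the power \<open>- l\<close> times
    \<open>y\<close> to the power \<open>- 2\<close>, so the scalar of \<open>theta_sum_eq\<close>
    inverts it.\<close>
  have "pivot a b * (xipow l a ^ (2 * l) * xipow l b ^ 4) = inverse (pivot a b)"
  proof -
    have "- (of_nat l * a) - 2 * b + (of_nat (2 * l) * a + of_nat 4 * b) = - (- (of_nat l * a) - 2 * b)"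
      by simp
    then show ?thesis
      unfolding pivot_def xipow_of_nat_mult [symmetric] xipow_add [symmetric] xipow_minus [symmetric]
      by (rule arg_cong)
  qed
  then show "theta l V v = theta' l V v"
    unfolding theta_homogeneous[OF v(2,3,1)] theta'_homogeneous[OF v(2,3,1)]
      theta_sum_eq[OF wt_kwt[OF v(1)]]
    by (simp only: scaleC_scaleC mult.assoc)
qed

end

theorem proposition3p8:
  fixes V :: "('v::complex_vec) uh_module" and l :: nat
  assumes "odd l" and "l \<ge> 3"
    and "CH_object l V"
  shows "theta l V = theta' l V"
proof -
  interpret uh_object V l by unfold_locales (fact assms)+
  show ?thesis by (rule theta_eq_theta')
qed

end
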